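(* For every fixed $\lambda\ge 0$ and every sequence $t=t(n)=\lambda t_\star+o(t_\star)$: if $\lambda<1$ then $\min_{i\in V}\mathcal D_i(t)\to 1$ in probability as $n\to\infty$; and if $\lambda>1$ then $\max_{i\in V}\mathcal D_i(t)\to 0$ in probability as $n\to\infty$.
   Context: Configuration model: for each $n$, let $(d_i^-)_{1\le i\le n}$ and $(d_i^+)_{1\le i\le n}$ be positive integers with $\sum_i d_i^-=\sum_i d_i^+=m$. Each vertex $i\in V=\{1,\dots,n\}$ carries a set $E_i^+$ of $d_i^+$ tails and a set $E_i^-$ of $d_i^-$ heads. The environment $\omega$ is a uniformly random bijection from $\bigcup_i E_i^+$ to $\bigcup_i E_i^-$; each pair $\omega(e)=f$ is an arc from the vertex of $e$ to the vertex of $f$ (loops and multiple arcs allowed), giving a random directed multigraph $G$. The random walk on $G$ has transition matrix $P(i,j)=\frac{1}{d_i^+}\,|\{e\in E_i^+:\omega(e)\in E_j^-\}|$. All quantities depend on $n$ and limits are as $n\to\infty$. Standing assumption: $\delta:=\min_i\min(d_i^+,d_i^-)\ge 2$ and $\Delta:=\max_i\max(d_i^+,d_i^-)$ is bounded uniformly in $n$. With high probability (probability $\to1$) $G$ is strongly connected; $\pi_\star$ denotes the invariant probability measure of $P$ (unique with high probability). Define $\mathcal D_i(t)=\|P^t(i,\cdot)-\pi_\star\|_{\mathrm{TV}}=\frac12\sum_{j\in V}|P^t(i,j)-\pi_\star(j)|$, $\mu=\frac1m\sum_{i=1}^n d_i^-\ln d_i^+$ and $t_\star=\frac{\ln n}{\mu}$.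 *)

theory Defs
  imports "HOL-Probability.Probability" "HOL-Library.Landau_Symbols"
begin

text \<open>Configuration model on vertex set V = {0..<n}. Degrees are given by functions
  din, dout :: nat => nat (only values on {0..<n} matter). A tail of vertex i is a pair
  (i,k) with k < dout i; a head of vertex j is a pair (j,l) with l < din j.\<close>

definition tails :: "(nat \<Rightarrow> nat) \<Rightarrow> nat \<Rightarrow> (nat \<times> nat) set" where
  "tails dout n = {(i,k). i < n \<and> k < dout i}"

definition heads :: "(nat \<Rightarrow> nat) \<Rightarrow> nat \<Rightarrow> (nat \<times> nat) set" where
  "heads din n = {(j,l). j < n \<and> l < din j}"

definition envs :: "(nat \<Rightarrow> nat) \<Rightarrow> (nat \<Rightarrow> nat) \<Rightarrow> nat \<Rightarrow> (nat \<times> nat \<Rightarrow> nat \<times> nat) set" where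
  "envs din dout n = {\<omega> \<in> tails dout n \<rightarrow>\<^sub>E heads din n. bij_betw \<omega> (tails dout n) (heads din n)}"

definition env_pmf :: "(nat \<Rightarrow> nat) \<Rightarrow> (nat \<Rightarrow> nat) \<Rightarrow> nat \<Rightarrow> (nat \<times> nat \<Rightarrow> nat \<times> nat) pmf" where
  "env_pmf din dout n = pmf_of_set (envs din dout n)"

definition trans :: "(nat \<Rightarrow> nat) \<Rightarrow> (nat \<times> nat \<Rightarrow> nat \<times> nat) \<Rightarrow> nat \<Rightarrow> nat \<Rightarrow> real" where
  "trans dout \<omega> i j = real (card {k. k < dout i \<and> fst (\<omega> (i,k)) = j}) / real (dout i)"

fun trans_pow :: "(nat \<Rightarrow> nat) \<Rightarrow> nat \<Rightarrow> (nat \<times> nat \<Rightarrow> nat \<times> nat) \<Rightarrow> nat \<Rightarrow> nat \<Rightarrow> nat \<Rightarrow> real" where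
  "trans_pow dout n \<omega> 0 i j = (if i = j then 1 else 0)"
| "trans_pow dout n \<omega> (Suc t) i j = (\<Sum>k<n. trans_pow dout n \<omega> t i k * trans dout \<omega> k j)"

definition stationary :: "(nat \<Rightarrow> nat) \<Rightarrow> nat \<Rightarrow> (nat \<times> nat \<Rightarrow> nat \<times> nat) \<Rightarrow> (nat \<Rightarrow> real) \<Rightarrow> bool" where
  "stationary dout n \<omega> \<pi> \<longleftrightarrow>
     (\<forall>j. 0 \<le> \<pi> j) \<and> (\<forall>j. n \<le> j \<longrightarrow> \<pi> j = 0) \<and> sum \<pi> {..<n} = 1 \<and>
     (\<forall>j<n. (\<Sum>i<n. \<pi> i * trans dout \<omega> i j) = \<pi> j)"

text \<open>pi_star: the (with high probability unique) invariant probability measure.\<close>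
definition pi_star :: "(nat \<Rightarrow> nat) \<Rightarrow> nat \<Rightarrow> (nat \<times> nat \<Rightarrow> nat \<times> nat) \<Rightarrow> nat \<Rightarrow> real" where
  "pi_star dout n \<omega> = (THE \<pi>. stationary dout n \<omega> \<pi>)"

definition tv_dist :: "(nat \<Rightarrow> nat) \<Rightarrow> nat \<Rightarrow> (nat \<times> nat \<Rightarrow> nat \<times> nat) \<Rightarrow> nat \<Rightarrow> nat \<Rightarrow> real" where
  "tv_dist dout n \<omega> t i = (1/2) * (\<Sum>j<n. \<bar>trans_pow dout n \<omega> t i j - pi_star dout n \<omega> j\<bar>)"

definition mu :: "(nat \<Rightarrow> nat) \<Rightarrow> (nat \<Rightarrow> nat) \<Rightarrow> nat \<Rightarrow> real" where
  "mu din dout n = (1 / real (\<Sum>i<n. din i)) * (\<Sum>i<n. real (din i) * ln (real (dout i)))"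

definition t_star :: "(nat \<Rightarrow> nat) \<Rightarrow> (nat \<Rightarrow> nat) \<Rightarrow> nat \<Rightarrow> real" where
  "t_star din dout n = ln (real n) / mu din dout n"

end

theory Submission
  imports Defs "HOL-Combinatorics.Transposition" "HOL-Real_Asymp.Real_Asymp"
begin

text \<open>The environment is revealed tail by tail; given the revealed part, the rest of the matching is uniform. From a
  typical vertex one explores the out-tree up to depth close to $(1-\<beta>) t_\<star>$, along paths whose
  weight (the probability that the walk follows them) stays above $n^{-1+\<beta>/2}$. This takes $o(n)$ steps, so few of
  them collide with what has been reached, and an exponential supermartingale for the quadratic deviation of the
  logarithmic weights from the drift $\<mu>$ shows that, outside an event of probability $o(1/n)$, nearly all the mass of
  the walk sits on unmatched tails of weight $n^{-1+O(\<beta>)}$.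

  Before $t_\<star>$ the walk is therefore carried by $n^{1-\<beta>/2+o(1)}$ vertices, a set too small for the stationary law. After $t_\<star>$
  one also reveals a backward ball of radius $h$, of size $n^{O(\<beta>)}$, around the target $y$: the remaining uniform
  matching joins the two sides by many tiny contributions, and a Chernoff bound, which holds since uniform matchings
  are negatively associated, gives $P^t(x,y) \<ge> (1-\<delta>) \<nu>'(y) - \<delta>/n$ for all $x$ and $y$ at once. Here $\<nu>'$ is nearly $\<nu>$, the law after $h$ steps from a
  uniform head. Atypical starting vertices, whose out-ball contains two paths with a common end, are left quickly,
  because with high probability no vertex has its first two tails leading to such vertices. Since all rows of $P^t$ are then close to
  $\<nu>$, the chain contracts; this yields existence and uniqueness of the stationary law and its closeness to $\<nu>$.\<close>

subsection \<open>Uniform matchings\<close>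

text \<open>The shape of the proof comes from union bounds over n starting vertices and over n^2
  pairs. A ball with about n^{1/10} heads contains a collision with probability at most of order
  n^{-3/4}, which does not survive a sum over n vertices; two collisions have order n^{-3/2}. So bad
  vertices must be tolerated, and only two bad neighbours at once are excluded. Near the root the
  weights are of order one, and a single head can move the potential too much for a large
  exponential parameter. Hence the forward exploration begins with a complete ball of radius
  \<open>h0\<close> of order ln n; from then on all weights are at most \<open>(1/2) ^ h0\<close>, a
  negative power of n, and the parameter can be a positive power of n up to a logarithm. The weights
  kept at the end lie between n^{-(1-\<beta>/2)} and n^{-(1-2\<beta>)}. The lower end limits the
  number of steps, the upper end the size of the summands in the Chernoff bound. A backward radius
  of 5\<beta> ln n gives \<open>(1/2) ^ h\<close> at most n^{-3\<beta>}; since n * n^{-(1-2\<beta>)}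
  * n^{-3\<beta>} = n^{-\<beta>}, the failure probability exp(-\<delta>^2 n^\<beta>) beats
  n^2.\<close>

locale matching =
  fixes T :: "'a set" and H :: "'b set"
  assumes finite_T [simp]: "finite T" and finite_H [simp]: "finite H"
    and card_eq: "card H = card T"
begin

definition Om :: "('a \<Rightarrow> 'b) set" where
  "Om = {w \<in> T \<rightarrow>\<^sub>E H. bij_betw w T H}"

definition m :: nat where "m = card T"

lemma card_T: "card T = m" and card_H: "card H = m"
  by (simp_all add: m_def card_eq)

lemma OmD:
  assumes "w \<in> Om"
  shows "e \<in> T \<Longrightarrow> w e \<in> H" "inj_on w T" "w ` T = H" "w \<in> extensional T"
  using assms by (auto simp: Om_def bij_betw_def PiE_def)

lemma finite_Om [simp]: "finite Om"
  unfolding Om_def by (rule finite_subset[of _ "T \<rightarrow>\<^sub>E H"]) (auto intro: finite_PiE)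

section \<open>Partial matchings, cylinders and conditional averages\<close>

definition vld :: "('a \<rightharpoonup> 'b) \<Rightarrow> bool" where
  "vld s \<longleftrightarrow> dom s \<subseteq> T \<and> ran s \<subseteq> H \<and> inj_on s (dom s)"

definition Cyl :: "('a \<rightharpoonup> 'b) \<Rightarrow> ('a \<Rightarrow> 'b) set" where
  "Cyl s = {w \<in> Om. \<forall>e\<in>dom s. s e = Some (w e)}"
text \<open>Conditional expectation given the revealed part \<open>s\<close>: a uniform environment
  stays uniform on every cylinder, so all probabilities become counts.\<close>

definition avg :: "('a \<rightharpoonup> 'b) \<Rightarrow> (('a \<Rightarrow> 'b) \<Rightarrow> real) \<Rightarrow> real" where
  "avg s F = (\<Sum>w\<in>Cyl s. F w) / real (card (Cyl s))"

lemma finite_Cyl [simp]: "finite (Cyl s)"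
  by (simp add: Cyl_def)

lemma vld_empty [simp]: "vld Map.empty"
  by (simp add: vld_def)

lemma Cyl_empty [simp]: "Cyl Map.empty = Om"
  by (simp add: Cyl_def)

lemma vld_inj: "vld s \<Longrightarrow> s e = Some f \<Longrightarrow> s e' = Some f \<Longrightarrow> e = e'"
  unfolding vld_def inj_on_def by (metis domI)

lemma CylD: "w \<in> Cyl s \<Longrightarrow> s e = Some f \<Longrightarrow> w e = f"
  unfolding Cyl_def by force

lemma card_ran: "vld s \<Longrightarrow> card (ran s) = card (dom s)"
proof -
  assume v: "vld s"
  have "ran s = (the \<circ> s) ` dom s" by (force simp: ran_def dom_def image_iff)
  moreover have "inj_on (the \<circ> s) (dom s)"
    by (rule inj_onI) (metis comp_apply domIff option.collapse v vld_inj)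
  ultimately show ?thesis using card_image by metis
qed

lemma card_free: "vld s \<Longrightarrow> card (H - ran s) = m - card (dom s)"
  "vld s \<Longrightarrow> card (T - dom s) = m - card (dom s)"
  "vld s \<Longrightarrow> card (dom s) \<le> m"
proof -
  assume v: "vld s"
  have "finite (ran s)" "finite (dom s)" using v finite_subset[OF _ finite_T] finite_subset[OF _ finite_H] by (auto simp: vld_def)
  thus "card (H - ran s) = m - card (dom s)" "card (T - dom s) = m - card (dom s)" "card (dom s) \<le> m"
    using v card_ran[OF v] card_mono[OF finite_T, of "dom s"]
    by (auto simp: card_Diff_subset vld_def card_H card_T)
qed

text \<open>A partial injection leaves equally many free tails and free heads, and any bijection
  between these extends it. This keeps the denominator of \<open>avg\<close> away from 0.\<close>

lemma Cyl_nonempty: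
  assumes v: "vld s" shows "Cyl s \<noteq> {}"
proof -
  have "card (T - dom s) = card (H - ran s)" using card_free v by simp
  then obtain g where g: "bij_betw g (T - dom s) (H - ran s)"
    by (meson finite_Diff finite_H finite_T finite_same_card_bij)
  define w where "w e = (if e \<in> dom s then the (s e) else if e \<in> T then g e else undefined)" for e
  have b1: "bij_betw w (dom s) (ran s)"
    unfolding bij_betw_def
  proof
    show "inj_on w (dom s)"
      unfolding w_def by (rule inj_onI) (metis domIff option.collapse v vld_inj)
    show "w ` dom s = ran s" unfolding w_def by (force simp: ran_def dom_def image_iff)
  qed
  have b2: "bij_betw w (T - dom s) (H - ran s)"
    using g by (rule bij_betw_cong[THEN iffD1, rotated]) (auto simp: w_def)
  have "bij_betw w (dom s \<union> (T - dom s)) (ran s \<union> (H - ran s))"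
    by (rule bij_betw_combine[OF b1 b2]) auto
  moreover have "dom s \<union> (T - dom s) = T" "ran s \<union> (H - ran s) = H" using v by (auto simp: vld_def)
  ultimately have bw: "bij_betw w T H" by simp
  have "w e = undefined" if "e \<notin> T" for e using that v by (auto simp: w_def vld_def)
  hence "w \<in> Om" unfolding Om_def
    using bw by (auto simp: PiE_def extensional_def dest: bij_betwE)
  moreover have "\<forall>e\<in>dom s. s e = Some (w e)" by (auto simp: w_def)
  ultimately show ?thesis by (auto simp: Cyl_def)
qed

lemma card_Cyl_pos: "vld s \<Longrightarrow> 0 < card (Cyl s)"
  using Cyl_nonempty by (simp add: card_gt_0_iff)

lemma Om_nonempty: "Om \<noteq> {}"
  using Cyl_nonempty[OF vld_empty] by simp

lemma vld_upd:
  assumes "vld s" "e \<in> T - dom s" "f \<in> H - ran s"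
  shows "vld (s(e \<mapsto> f))"
  using assms unfolding vld_def inj_on_def
  by (auto simp: dom_def ran_def)

text \<open>Exchangeability of the heads as an involution of \<open>Om\<close>. The restriction to
  \<open>T\<close> keeps the result extensional.\<close>

definition swap_heads :: "'b \<Rightarrow> 'b \<Rightarrow> ('a \<Rightarrow> 'b) \<Rightarrow> 'a \<Rightarrow> 'b" where
  "swap_heads f1 f2 w = (\<lambda>e\<in>T. Transposition.transpose f1 f2 (w e))"

lemma swap_heads_Om:
  assumes "w \<in> Om" "f1 \<in> H" "f2 \<in> H"
  shows "swap_heads f1 f2 w \<in> Om"
proof -
  have "bij_betw (Transposition.transpose f1 f2) H H"
    unfolding bij_betw_def using inj_on_subset[OF bij_is_inj[OF bij_swap] subset_UNIV] assms
    by (simp add: transpose_image_eq)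
  hence "bij_betw (Transposition.transpose f1 f2 \<circ> w) T H"
    using assms(1) by (auto simp: Om_def intro: bij_betw_trans)
  hence "bij_betw (swap_heads f1 f2 w) T H"
    by (rule bij_betw_cong[THEN iffD1, rotated]) (auto simp: swap_heads_def)
  thus ?thesis by (auto simp: Om_def swap_heads_def bij_betw_def)
qed

lemma swap_heads_swap_heads: "w \<in> Om \<Longrightarrow> swap_heads f1 f2 (swap_heads f1 f2 w) = w"
  using OmD(4)[of w] by (auto simp: swap_heads_def extensional_def restrict_def fun_eq_iff)

lemma swap_heads_Cyl:
  assumes v: "vld s" and e: "e \<in> T - dom s" and f: "f1 \<in> H - ran s" "f2 \<in> H - ran s"
    and w: "w \<in> Cyl (s(e \<mapsto> f1))"
  shows "swap_heads f1 f2 w \<in> Cyl (s(e \<mapsto> f2))"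
proof -
  have wO: "w \<in> Om" using w by (simp add: Cyl_def)
  have "(s(e \<mapsto> f2)) e' = Some (swap_heads f1 f2 w e')" if "e' \<in> dom (s(e \<mapsto> f2))" for e'
  proof (cases "e' = e")
    case True
    have "w e = f1" using w by (auto simp: Cyl_def)
    thus ?thesis using True e by (simp add: swap_heads_def)
  next
    case False
    hence d: "e' \<in> dom s" using that by auto
    then obtain f where f': "s e' = Some f" by blast
    hence "s e' = Some (w e')" using CylD[OF w, of e' f] False by simp
    moreover from this have "w e' \<in> ran s" by (auto simp: ran_def)
    moreover from this have "w e' \<noteq> f1" "w e' \<noteq> f2" using f by auto
    ultimately show ?thesis using False d v
      by (auto simp: swap_heads_def Transposition.transpose_def vld_def)
  qed
  thus ?thesis using swap_heads_Om[OF wO] f by (auto simp: Cyl_def)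
qed

text \<open>The involution exchanges the cases in which \<open>e\<close> receives \<open>f1\<close>
  and \<open>f2\<close>, so all free heads are equally likely for the next revealed tail.\<close>

lemma swap_heads_bij:
  assumes v: "vld s" and e: "e \<in> T - dom s" and f: "f1 \<in> H - ran s" "f2 \<in> H - ran s"
  shows "bij_betw (swap_heads f1 f2) (Cyl (s(e \<mapsto> f1))) (Cyl (s(e \<mapsto> f2)))"
proof (rule bij_betw_byWitness[where f' = "swap_heads f1 f2"])
  show "\<forall>a\<in>Cyl (s(e \<mapsto> f1)). swap_heads f1 f2 (swap_heads f1 f2 a) = a" by (auto simp: Cyl_def swap_heads_swap_heads)
  show "\<forall>a\<in>Cyl (s(e \<mapsto> f2)). swap_heads f1 f2 (swap_heads f1 f2 a) = a" by (auto simp: Cyl_def swap_heads_swap_heads)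
  show "swap_heads f1 f2 ` Cyl (s(e \<mapsto> f1)) \<subseteq> Cyl (s(e \<mapsto> f2))" using swap_heads_Cyl[OF v e f] by auto
  have "swap_heads f1 f2 = swap_heads f2 f1" by (auto simp: swap_heads_def fun_eq_iff transpose_commute)
  thus "swap_heads f1 f2 ` Cyl (s(e \<mapsto> f2)) \<subseteq> Cyl (s(e \<mapsto> f1))" using swap_heads_Cyl[OF v e f(2,1)] by auto
qed

lemma Cyl_branch:
  assumes v: "vld s" and e: "e \<in> T - dom s"
  shows "Cyl s = (\<Union>f\<in>H - ran s. Cyl (s(e \<mapsto> f)))"
proof
  show "(\<Union>f\<in>H - ran s. Cyl (s(e \<mapsto> f))) \<subseteq> Cyl s"
    using e by (auto simp: Cyl_def dom_def split: if_splits)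
  show "Cyl s \<subseteq> (\<Union>f\<in>H - ran s. Cyl (s(e \<mapsto> f)))"
  proof
    fix w assume w: "w \<in> Cyl s"
    hence wO: "w \<in> Om" by (simp add: Cyl_def)
    have "w e \<notin> ran s"
    proof
      assume "w e \<in> ran s"
      then obtain e' where e': "s e' = Some (w e)" by (auto simp: ran_def)
      hence d: "e' \<in> dom s" by auto
      with w e' have "w e' = w e" by (auto simp: Cyl_def)
      hence "e' = e" using OmD(2)[OF wO] d e v by (auto simp: inj_on_def vld_def)
      thus False using d e by auto
    qed
    moreover have "w e \<in> H" using OmD(1)[OF wO] e by auto
    moreover have "w \<in> Cyl (s(e \<mapsto> w e))" using w by (auto simp: Cyl_def)
    ultimately show "w \<in> (\<Union>f\<in>H - ran s. Cyl (s(e \<mapsto> f)))" by blast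
  qed
qed

text \<open>Law of total expectation for one reveal: the cylinder splits according to the head of
  \<open>e\<close>, and \<open>swap_heads_bij\<close> makes the pieces equinumerous.\<close>

lemma avg_branch:
  assumes v: "vld s" and e: "e \<in> T - dom s"
  shows "avg s F = (\<Sum>f\<in>H - ran s. avg (s(e \<mapsto> f)) F) / real (card (H - ran s))"
    and "0 < card (H - ran s)"
proof -
  have "card (dom s) < card T"
    by (rule psubset_card_mono) (use v e in \<open>auto simp: vld_def\<close>)
  thus pos: "0 < card (H - ran s)" using card_free[OF v] by (simp add: card_T)
  then obtain f0 where f0: "f0 \<in> H - ran s" by (metis card_gt_0_iff ex_in_conv)
  define N where "N = card (Cyl (s(e \<mapsto> f0)))"
  have N: "card (Cyl (s(e \<mapsto> f))) = N" if "f \<in> H - ran s" for f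
    unfolding N_def using swap_heads_bij[OF v e that f0] by (rule bij_betw_same_card)
  have Np: "N > 0" unfolding N_def by (rule card_Cyl_pos[OF vld_upd[OF v e f0]])
  have disj: "\<forall>f\<in>H - ran s. \<forall>f'\<in>H - ran s. f \<noteq> f' \<longrightarrow> Cyl (s(e \<mapsto> f)) \<inter> Cyl (s(e \<mapsto> f')) = {}"
  proof -
    have "w e = f" if "w \<in> Cyl (s(e \<mapsto> f))" for w f using that by (simp add: Cyl_def)
    thus ?thesis by blast
  qed
  have c: "card (Cyl s) = card (H - ran s) * N"
    unfolding Cyl_branch[OF v e]
    by (subst card_UN_disjoint) (use disj N in auto)
  have "(\<Sum>w\<in>Cyl s. F w) = (\<Sum>f\<in>H - ran s. \<Sum>w\<in>Cyl (s(e \<mapsto> f)). F w)"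
    unfolding Cyl_branch[OF v e]
    by (subst sum.UNION_disjoint) (use disj in auto)
  also have "\<dots> = (\<Sum>f\<in>H - ran s. real N * avg (s(e \<mapsto> f)) F)"
    by (rule sum.cong) (use Np in \<open>auto simp: avg_def N\<close>)
  also have "\<dots> = real N * (\<Sum>f\<in>H - ran s. avg (s(e \<mapsto> f)) F)"
    by (simp add: sum_distrib_left)
  finally show "avg s F = (\<Sum>f\<in>H - ran s. avg (s(e \<mapsto> f)) F) / real (card (H - ran s))"
    unfolding avg_def[of s] c using Np by simp
qed

lemma avg_mono: "(\<And>w. w \<in> Cyl s \<Longrightarrow> F w \<le> G w) \<Longrightarrow> avg s F \<le> avg s G"
  unfolding avg_def by (intro divide_right_mono sum_mono) auto

lemma avg_const: "vld s \<Longrightarrow> avg s (\<lambda>_. c) = c"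
  using Cyl_nonempty[of s] by (simp add: avg_def)

lemma avg_cmult: "avg s (\<lambda>w. c * F w) = c * avg s F"
  unfolding avg_def by (simp add: sum_distrib_left)

lemma avg_add: "avg s (\<lambda>w. F w + G w) = avg s F + avg s G"
  unfolding avg_def by (simp add: sum.distrib add_divide_distrib)

lemma avg_cong: "(\<And>w. w \<in> Cyl s \<Longrightarrow> F w = G w) \<Longrightarrow> avg s F = avg s G"
  unfolding avg_def by (simp cong: sum.cong)

definition pr :: "(('a \<Rightarrow> 'b) \<Rightarrow> bool) \<Rightarrow> real" where
  "pr Q = avg Map.empty (\<lambda>w. of_bool (Q w))"

lemma pr_mono: "(\<And>w. w \<in> Om \<Longrightarrow> Q w \<Longrightarrow> R w) \<Longrightarrow> pr Q \<le> pr R"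
  unfolding pr_def by (rule avg_mono) (auto simp: of_bool_def)

lemma pr_union: "pr (\<lambda>w. Q w \<or> R w) \<le> pr Q + pr R"
  unfolding pr_def avg_add[symmetric] by (rule avg_mono) auto

lemma pr_union_fin:
  assumes "finite I" and "\<And>i. i \<in> I \<Longrightarrow> pr (Q i) \<le> c"
  shows "pr (\<lambda>w. \<exists>i\<in>I. Q i w) \<le> real (card I) * c"
  using assms
proof (induction I rule: finite_induct)
  case empty thus ?case by (simp add: pr_def avg_def)
next
  case (insert i I)
  have "pr (\<lambda>w. \<exists>i\<in>insert i I. Q i w) = pr (\<lambda>w. Q i w \<or> (\<exists>i\<in>I. Q i w))" by simp
  also have "\<dots> \<le> pr (Q i) + pr (\<lambda>w. \<exists>i\<in>I. Q i w)" by (rule pr_union)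
  also have "\<dots> \<le> c + real (card I) * c" using insert by (intro add_mono) auto
  finally show ?case using insert by (simp add: algebra_simps)
qed

text \<open>The cylinders over self-determined sets of revealed tails partition the space, and the environment is uniform on each.\<close>
lemma avg_partition:
  assumes S: "\<And>w. w \<in> Om \<Longrightarrow> S w \<subseteq> T"
    and det: "\<And>w w'. w \<in> Om \<Longrightarrow> w' \<in> Om \<Longrightarrow> (\<forall>e\<in>S w. w' e = w e) \<Longrightarrow> S w' = S w"
    and le: "\<And>w. w \<in> Om \<Longrightarrow> avg (\<lambda>e. if e \<in> S w then Some (w e) else None) F \<le> c"
  shows "avg Map.empty F \<le> c"
proof -
  define C where "C w = Cyl (\<lambda>e. if e \<in> S w then Some (w e) else None)" for w
  have C: "C w = {w' \<in> Om. \<forall>e\<in>S w. w' e = w e}" if "w \<in> Om" for w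
    unfolding C_def Cyl_def using that by (auto simp: dom_def)
  have self: "w \<in> C w" if "w \<in> Om" for w using that by (simp add: C)
  have eq: "C w' = C w" if "w \<in> Om" "w' \<in> C w" for w w'
  proof -
    have w': "w' \<in> Om" "\<forall>e\<in>S w. w' e = w e" using that C by auto
    have "S w' = S w" by (rule det[OF that(1) w'])
    thus ?thesis using w' that by (auto simp: C)
  qed
  have UC: "(\<Union>(C ` Om)) = Om" using self by (auto simp: C)
  have disj: "\<And>A B. A \<in> C ` Om \<Longrightarrow> B \<in> C ` Om \<Longrightarrow> A \<noteq> B \<Longrightarrow> A \<inter> B = {}"
  proof -
    fix A B assume AB: "A \<in> C ` Om" "B \<in> C ` Om" "A \<noteq> B"
    then obtain w w' where "w \<in> Om" "w' \<in> Om" "A = C w" "B = C w'" by blast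
    thus "A \<inter> B = {}" using eq[of w] eq[of w'] AB by blast
  qed
  have fC: "finite (C w)" for w by (simp add: C_def)
  have "(\<Sum>w\<in>Om. F w) = (\<Sum>A\<in>C ` Om. \<Sum>w\<in>A. F w)"
    by (subst UC[symmetric], subst sum.Union_disjoint) (use disj fC in auto)
  also have "\<dots> \<le> (\<Sum>A\<in>C ` Om. c * real (card A))"
  proof (rule sum_mono)
    fix A assume "A \<in> C ` Om"
    then obtain w where w: "w \<in> Om" "A = C w" by auto
    have "card A > 0" using self w fC by (auto simp: card_gt_0_iff)
    thus "(\<Sum>w\<in>A. F w) \<le> c * real (card A)"
      using le[OF w(1)] unfolding avg_def w(2) C_def by (simp add: divide_simps)
  qed
  also have "\<dots> = c * real (card Om)"
  proof -
    have "card Om = (\<Sum>A\<in>C ` Om. card A)"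
      by (subst UC[symmetric], rule card_Union_disjoint) (use disj fC in \<open>auto simp: pairwise_def disjnt_def\<close>)
    thus ?thesis by (simp add: sum_distrib_left)
  qed
  finally show ?thesis using Om_nonempty
    by (simp add: avg_def divide_simps card_gt_0_iff)
qed

lemma vld_restr:
  assumes "w \<in> Om" "S \<subseteq> T"
  shows "vld (\<lambda>e. if e \<in> S then Some (w e) else None)"
  using assms OmD[OF assms(1)] unfolding vld_def
  by (auto simp: dom_def ran_def inj_on_def split: if_splits)

text \<open>The sum of \<open>(a i - a j) * (b i - b j)\<close> over all pairs is twice the
  difference of the two sides.\<close>

lemma chebyshev_sum:
  fixes a b :: "'x \<Rightarrow> real"
  assumes "\<And>i j. i \<in> I \<Longrightarrow> j \<in> I \<Longrightarrow> (a i - a j) * (b i - b j) \<le> 0"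
  shows "real (card I) * (\<Sum>i\<in>I. a i * b i) \<le> (\<Sum>i\<in>I. a i) * (\<Sum>i\<in>I. b i)"
proof -
  have "0 \<ge> (\<Sum>i\<in>I. \<Sum>j\<in>I. (a i - a j) * (b i - b j))" by (intro sum_nonpos assms)
  also have "(\<Sum>i\<in>I. \<Sum>j\<in>I. (a i - a j) * (b i - b j)) =
    (\<Sum>i\<in>I. \<Sum>j\<in>I. a i * b i) + (\<Sum>i\<in>I. \<Sum>j\<in>I. a j * b j) - (\<Sum>i\<in>I. \<Sum>j\<in>I. a i * b j) - (\<Sum>i\<in>I. \<Sum>j\<in>I. b i * a j)"
    by (simp only: sum.distrib[symmetric] sum_subtractf[symmetric]) (simp add: algebra_simps)
  also have "(\<Sum>i\<in>I. \<Sum>j\<in>I. a i * b j) = (\<Sum>i\<in>I. a i) * (\<Sum>i\<in>I. b i)" by (rule sum_product[symmetric])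
  also have "(\<Sum>i\<in>I. \<Sum>j\<in>I. b i * a j) = (\<Sum>i\<in>I. b i) * (\<Sum>i\<in>I. a i)" by (rule sum_product[symmetric])
  also have "(\<Sum>i\<in>I. \<Sum>j\<in>I. a i * b i) + (\<Sum>i\<in>I. \<Sum>j\<in>I. a j * b j) - (\<Sum>i\<in>I. a i) * (\<Sum>i\<in>I. b i) - (\<Sum>i\<in>I. b i) * (\<Sum>i\<in>I. a i)
     = 2 * (real (card I) * (\<Sum>i\<in>I. a i * b i)) - 2 * ((\<Sum>i\<in>I. a i) * (\<Sum>i\<in>I. b i))"
    by (simp add: sum_distrib_left[symmetric])
  finally show ?thesis by simp
qed

text \<open>Negative association: swapping two heads shows that the mean of the remaining product increases with the
  weight of the head matched to e, so Chebyshev's sum inequality applies.\<close>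
lemma avg_prod_le:
  fixes u :: "'b \<Rightarrow> real" and g :: "'a \<Rightarrow> real \<Rightarrow> real"
  assumes anti: "\<And>e x y. x \<le> y \<Longrightarrow> g e y \<le> g e x" and nn: "\<And>e x. 0 \<le> g e x"
    and v: "vld s" and A: "A \<subseteq> T - dom s"
  shows "avg s (\<lambda>w. \<Prod>e\<in>A. g e (u (w e))) \<le> (\<Prod>e\<in>A. (\<Sum>f\<in>H - ran s. g e (u f)) / real (card (H - ran s)))"
proof -
  have "finite A" using A by (rule finite_subset) simp
  thus ?thesis using A
  proof (induction A rule: finite_induct)
    case empty
    thus ?case using avg_const[OF v] by simp
  next
    case (insert e A)
    have e: "e \<in> T - dom s" and A: "A \<subseteq> T" using insert by auto
    define N where "N = real (card (H - ran s))"
    have N: "N > 0" using avg_branch(2)[OF v e] by (simp add: N_def)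
    define h where "h f = avg (s(e \<mapsto> f)) (\<lambda>w. \<Prod>e\<in>A. g e (u (w e)))" for f
    have h_mono: "h f1 \<le> h f2" if f: "f1 \<in> H - ran s" "f2 \<in> H - ran s" and le: "u f1 \<le> u f2" for f1 f2
    proof -
      have b: "bij_betw (swap_heads f1 f2) (Cyl (s(e \<mapsto> f1))) (Cyl (s(e \<mapsto> f2)))" by (rule swap_heads_bij[OF v e f])
      have "(\<Sum>w\<in>Cyl (s(e \<mapsto> f1)). \<Prod>e\<in>A. g e (u (w e))) \<le>
            (\<Sum>w\<in>Cyl (s(e \<mapsto> f1)). \<Prod>e\<in>A. g e (u (swap_heads f1 f2 w e)))"
      proof (intro sum_mono prod_mono conjI nn)
        fix w e' assume w: "w \<in> Cyl (s(e \<mapsto> f1))" and e': "e' \<in> A"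
        have wO: "w \<in> Om" and tweight: "w e = f1" using w by (auto simp: Cyl_def)
        \<comment> \<open>The head \<open>f1\<close> belongs to \<open>e\<close>, so the swap can
          change the head of \<open>e'\<close> only from \<open>f2\<close> to \<open>f1\<close>. Its
          weight can only drop, and \<open>g\<close> is antitone.\<close>
        have "w e' \<noteq> f1" using OmD(2)[OF wO] tweight e e' A insert(2) by (auto simp: inj_on_def)
        hence "u (swap_heads f1 f2 w e') \<le> u (w e')" using e' A le by (auto simp: swap_heads_def Transposition.transpose_def)
        thus "g e' (u (w e')) \<le> g e' (u (swap_heads f1 f2 w e'))" by (rule anti)
      qed
      also have "\<dots> = (\<Sum>w\<in>Cyl (s(e \<mapsto> f2)). \<Prod>e\<in>A. g e (u (w e)))"
        by (rule sum.reindex_bij_betw[OF b])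
      finally show ?thesis
        unfolding h_def avg_def bij_betw_same_card[OF b] by (intro divide_right_mono) auto
    qed
    have "avg s (\<lambda>w. \<Prod>e\<in>insert e A. g e (u (w e))) = (\<Sum>f\<in>H - ran s. avg (s(e \<mapsto> f)) (\<lambda>w. g e (u f) * (\<Prod>e\<in>A. g e (u (w e))))) / N"
      unfolding avg_branch(1)[OF v e] N_def
      by (intro arg_cong2[where f = "(/)"] sum.cong avg_cong refl)
         (use insert in \<open>auto simp: Cyl_def\<close>)
    also have "\<dots> = (\<Sum>f\<in>H - ran s. g e (u f) * h f) / N"
      by (simp add: avg_cmult h_def)
    also have "\<dots> \<le> ((\<Sum>f\<in>H - ran s. g e (u f)) / N) * ((\<Sum>f\<in>H - ran s. h f) / N)"
    proof -
      have "real (card (H - ran s)) * (\<Sum>f\<in>H - ran s. g e (u f) * h f) \<le> (\<Sum>f\<in>H - ran s. g e (u f)) * (\<Sum>f\<in>H - ran s. h f)"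
      proof (rule chebyshev_sum)
        fix i j assume ij: "i \<in> H - ran s" "j \<in> H - ran s"
        show "(g e (u i) - g e (u j)) * (h i - h j) \<le> 0"
        proof (cases "u i \<le> u j")
          case True
          thus ?thesis using h_mono[OF ij] anti[of "u i" "u j" e] by (simp add: mult_nonneg_nonpos)
        next
          case False
          thus ?thesis using h_mono[OF ij(2,1)] anti[of "u j" "u i" e] by (simp add: mult_nonpos_nonneg)
        qed
      qed
      thus ?thesis using N unfolding N_def[symmetric] by (simp add: field_simps)
    qed
    also have "(\<Sum>f\<in>H - ran s. h f) / N = avg s (\<lambda>w. \<Prod>e\<in>A. g e (u (w e)))"
      unfolding avg_branch(1)[OF v e, where F = "\<lambda>w. \<Prod>e\<in>A. g e (u (w e))"] N_def h_def ..
    also have "((\<Sum>f\<in>H - ran s. g e (u f)) / N) * \<dots> \<le> ((\<Sum>f\<in>H - ran s. g e (u f)) / N) * (\<Prod>e\<in>A. (\<Sum>f\<in>H - ran s. g e (u f)) / N)"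
      using insert N unfolding N_def[symmetric]
      by (intro mult_left_mono insert.IH[unfolded N_def[symmetric]] divide_nonneg_nonneg sum_nonneg nn) auto
    finally show ?case using insert by (simp add: N_def)
  qed
qed

subsection \<open>Explorations\<close>

text \<open>An adaptive exploration: the next tail depends on the state alone, and the environment
  is consulted only at that tail. The number \<open>k\<close> is fuel; by \<open>run_final\<close>,
  \<open>m\<close> units suffice.\<close>

primrec run :: "('s \<Rightarrow> 'a option) \<Rightarrow> ('s \<Rightarrow> 'a \<Rightarrow> 'b \<Rightarrow> 's) \<Rightarrow> nat \<Rightarrow> 's \<Rightarrow> ('a \<Rightarrow> 'b) \<Rightarrow> 's" where
  "run next_tail reveal 0 s w = s"
| "run next_tail reveal (Suc k) s w = (case next_tail s of None \<Rightarrow> s | Some e \<Rightarrow> run next_tail reveal k (reveal s e (w e)) w)"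

context
  fixes next_tail :: "'s \<Rightarrow> 'a option" and reveal :: "'s \<Rightarrow> 'a \<Rightarrow> 'b \<Rightarrow> 's" and matched :: "'s \<Rightarrow> 'a \<rightharpoonup> 'b"
    and Inv :: "'s \<Rightarrow> bool"
  assumes Inv_vld: "\<And>s. Inv s \<Longrightarrow> vld (matched s)"
    and next_tail_free: "\<And>s e. Inv s \<Longrightarrow> next_tail s = Some e \<Longrightarrow> e \<in> T - dom (matched s)"
    and Inv_reveal: "\<And>s e f. Inv s \<Longrightarrow> next_tail s = Some e \<Longrightarrow> f \<in> H - ran (matched s) \<Longrightarrow> Inv (reveal s e f)"
    and matched_reveal: "\<And>s e f. Inv s \<Longrightarrow> next_tail s = Some e \<Longrightarrow> matched (reveal s e f) = (matched s)(e \<mapsto> f)"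
begin

lemma reveal_Cyl:
  assumes "Inv s" "next_tail s = Some e" "w \<in> Cyl (matched s)"
  shows "w e \<in> H - ran (matched s)" "w \<in> Cyl (matched (reveal s e (w e)))"
proof -
  have "w \<in> (\<Union>f\<in>H - ran (matched s). Cyl ((matched s)(e \<mapsto> f)))"
    using Cyl_branch[OF Inv_vld next_tail_free] assms by blast
  then obtain f where f: "f \<in> H - ran (matched s)" "w \<in> Cyl ((matched s)(e \<mapsto> f))" by blast
  hence "w e = f" by (auto simp: Cyl_def)
  thus "w e \<in> H - ran (matched s)" "w \<in> Cyl (matched (reveal s e (w e)))" using f assms matched_reveal by auto
qed

lemma run_Inv:
  assumes "Inv s" "w \<in> Cyl (matched s)"
  shows "Inv (run next_tail reveal k s w) \<and> w \<in> Cyl (matched (run next_tail reveal k s w)) \<and> dom (matched s) \<subseteq> dom (matched (run next_tail reveal k s w))"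
  using assms
proof (induction k arbitrary: s)
  case (Suc k)
  show ?case
  proof (cases "next_tail s")
    case (Some e)
    have "Inv (reveal s e (w e))" "w \<in> Cyl (matched (reveal s e (w e)))"
      using Suc Some reveal_Cyl Inv_reveal by blast+
    moreover have "dom (matched s) \<subseteq> dom (matched (reveal s e (w e)))" using matched_reveal Suc.prems Some by auto
    ultimately show ?thesis using Suc.IH[of "reveal s e (w e)"] Some by auto
  qed (use Suc in auto)
qed auto

text \<open>The exploration has looked only at tails of its final domain, so it repeats itself in
  every environment that agrees there. This is the self-determination that
  \<open>avg_partition\<close> requires.\<close>

lemma run_det:
  assumes "Inv s" "w \<in> Cyl (matched s)" "w' \<in> Om" "\<forall>e\<in>dom (matched (run next_tail reveal k s w)). w' e = w e"
  shows "run next_tail reveal k s w' = run next_tail reveal k s w"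
  using assms
proof (induction k arbitrary: s)
  case (Suc k)
  show ?case
  proof (cases "next_tail s")
    case (Some e)
    have 1: "Inv (reveal s e (w e))" "w \<in> Cyl (matched (reveal s e (w e)))"
      using Suc Some reveal_Cyl Inv_reveal by blast+
    have "e \<in> dom (matched (reveal s e (w e)))" using matched_reveal Suc Some by auto
    hence "e \<in> dom (matched (run next_tail reveal k (reveal s e (w e)) w))" using run_Inv[OF 1] by blast
    hence "w' e = w e" using Suc Some by simp
    thus ?thesis using Suc.IH[OF 1 Suc.prems(3)] Suc.prems(4) Some by simp
  qed (use Suc in auto)
qed auto

text \<open>Each step adds one tail to the domain and only \<open>m\<close> tails exist, so with
  this much fuel the run ends because no tail is left to choose.\<close>

lemma run_final:
  assumes "Inv s" "w \<in> Cyl (matched s)" "m \<le> k + card (dom (matched s))"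
  shows "next_tail (run next_tail reveal k s w) = None"
  using assms
proof (induction k arbitrary: s)
  case 0
  have "dom (matched s) = T" using 0 Inv_vld[OF 0(1)]
    by (intro card_seteq) (auto simp: vld_def card_T)
  thus ?case using next_tail_free[OF 0(1)] by (cases "next_tail s") auto
next
  case (Suc k)
  show ?case
  proof (cases "next_tail s")
    case (Some e)
    have 1: "Inv (reveal s e (w e))" "w \<in> Cyl (matched (reveal s e (w e)))"
      using Suc Some reveal_Cyl Inv_reveal by blast+
    have "card (dom (matched (reveal s e (w e)))) = Suc (card (dom (matched s)))"
      using matched_reveal[OF Suc.prems(1) Some] next_tail_free[OF Suc.prems(1) Some] Inv_vld[OF Suc.prems(1)]
      by (auto simp: vld_def intro!: card_insert_disjoint intro: finite_subset[OF _ finite_T])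
    thus ?thesis using Suc.IH[OF 1] Suc.prems Some by simp
  qed auto
qed

text \<open>The hypothesis says that the mean of \<open>Phi\<close> over a uniform free head is at
  most its present value; \<open>avg_branch\<close> carries this through the adaptive run.\<close>

lemma run_supermartingale:
  assumes Phi: "\<And>s e. Inv s \<Longrightarrow> next_tail s = Some e \<Longrightarrow>
      (\<Sum>f\<in>H - ran (matched s). Phi (reveal s e f)) \<le> real (card (H - ran (matched s))) * Phi s"
    and "Inv s"
  shows "avg (matched s) (\<lambda>w. Phi (run next_tail reveal k s w)) \<le> Phi s"
  using \<open>Inv s\<close>
proof (induction k arbitrary: s)
  case 0 thus ?case using avg_const[OF Inv_vld] by simp
next
  case (Suc k)
  show ?case
  proof (cases "next_tail s")
    case None
    thus ?thesis using avg_const[OF Inv_vld] Suc by simp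
  next
    case (Some e)
    note v = Inv_vld[OF Suc.prems] and e = next_tail_free[OF Suc.prems Some]
    have "avg (matched s) (\<lambda>w. Phi (run next_tail reveal (Suc k) s w)) =
      (\<Sum>f\<in>H - ran (matched s). avg ((matched s)(e \<mapsto> f)) (\<lambda>w. Phi (run next_tail reveal k (reveal s e f) w))) / real (card (H - ran (matched s)))"
      unfolding avg_branch(1)[OF v e]
      by (intro arg_cong2[where f = "(/)"] sum.cong avg_cong refl) (auto simp: Cyl_def Some)
    also have "\<dots> \<le> (\<Sum>f\<in>H - ran (matched s). Phi (reveal s e f)) / real (card (H - ran (matched s)))"
    proof (intro divide_right_mono sum_mono)
      fix f assume "f \<in> H - ran (matched s)"
      from Suc.IH[OF Inv_reveal[OF Suc.prems Some this]]
      show "avg ((matched s)(e \<mapsto> f)) (\<lambda>w. Phi (run next_tail reveal k (reveal s e f) w)) \<le> Phi (reveal s e f)"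
        by (simp only: matched_reveal[OF Suc.prems Some])
    qed simp
    also have "\<dots> \<le> Phi s" using Phi[OF Suc.prems Some] avg_branch(2)[OF v e]
      by (simp add: divide_simps mult.commute)
    finally show ?thesis .
  qed
qed

end

lemma markov_avg:
  assumes "\<And>w. w \<in> Cyl s \<Longrightarrow> 0 \<le> G w" "\<And>w. w \<in> Cyl s \<Longrightarrow> Q w \<Longrightarrow> a \<le> G w" "a > 0" "avg s G \<le> c"
  shows "avg s (\<lambda>w. of_bool (Q w)) \<le> c / a"
proof -
  have "a * avg s (\<lambda>w. of_bool (Q w)) = avg s (\<lambda>w. a * of_bool (Q w))" by (simp add: avg_cmult)
  also have "\<dots> \<le> avg s G" by (rule avg_mono) (use assms in auto)
  finally show ?thesis using assms by (simp add: field_simps)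
qed

end

subsection \<open>The configuration model\<close>

type_synonym pt = "nat \<times> nat"

locale conf =
  fixes n :: nat and din dout :: "nat \<Rightarrow> nat" and D :: nat
  assumes n_pos: "0 < n"
    and deg: "\<And>i. i < n \<Longrightarrow> 2 \<le> din i \<and> din i \<le> D \<and> 2 \<le> dout i \<and> dout i \<le> D"
    and dsum: "(\<Sum>i<n. din i) = (\<Sum>i<n. dout i)"
begin

abbreviation "T \<equiv> tails dout n"
abbreviation "H \<equiv> heads din n"

lemma T_Sigma: "T = Sigma {..<n} (\<lambda>i. {..<dout i})"
  by (auto simp: tails_def)

lemma H_Sigma: "H = Sigma {..<n} (\<lambda>i. {..<din i})"
  by (auto simp: heads_def)

end

sublocale conf \<subseteq> matching "tails dout n" "heads din n"
  by standard (auto simp: T_Sigma H_Sigma dsum)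

context conf begin

lemma Om_envs: "envs din dout n = Om"
  by (simp add: envs_def Om_def)

lemma m_din: "m = (\<Sum>i<n. din i)"
  by (subst m_def) (simp add: T_Sigma dsum)

lemma sum_T: "(\<Sum>e\<in>T. F e) = (\<Sum>i<n. \<Sum>k<dout i. F (i,k))" for F :: "pt \<Rightarrow> real"
  unfolding T_Sigma by (simp add: sum.Sigma)

lemma sum_H: "(\<Sum>e\<in>H. F e) = (\<Sum>i<n. \<Sum>k<din i. F (i,k))" for F :: "pt \<Rightarrow> real"
  unfolding H_Sigma by (simp add: sum.Sigma)

lemma m_ge: "2 * n \<le> m"
proof -
  have "(\<Sum>i<n. 2) \<le> (\<Sum>i<n. din i)" by (rule sum_mono) (use deg in auto)
  thus ?thesis by (simp add: m_din)
qed

lemma D_ge: "2 \<le> D"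
  using deg[of 0] n_pos by linarith

lemma H_fst: "f \<in> H \<Longrightarrow> fst f < n" and T_fst: "e \<in> T \<Longrightarrow> fst e < n"
  by (auto simp: heads_def tails_def)

lemma T_iff: "(i,k) \<in> T \<longleftrightarrow> i < n \<and> k < dout i"
  by (auto simp: tails_def)

text \<open>The bridge from \<open>env_pmf\<close> to counting; all estimates are made for
  \<open>pr\<close>.\<close>

lemma pr_prob: "measure_pmf.prob (env_pmf din dout n) {w. Q w} = pr Q"
  using Om_nonempty finite_Om
  by (simp add: env_pmf_def Om_envs measure_pmf_of_set pr_def avg_def of_bool_def sum.If_cases Int_def)

subsection \<open>The chain in a fixed environment\<close>

abbreviation P :: "(pt \<Rightarrow> pt) \<Rightarrow> nat \<Rightarrow> nat \<Rightarrow> nat \<Rightarrow> real" where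
  "P w t i j \<equiv> trans_pow dout n w t i j"

abbreviation tgt :: "(pt \<Rightarrow> pt) \<Rightarrow> pt \<Rightarrow> nat" where
  "tgt w e \<equiv> fst (w e)"

lemma tgt_lt: "w \<in> Om \<Longrightarrow> e \<in> T \<Longrightarrow> tgt w e < n"
  using OmD(1) H_fst by blast

lemma trans_sum:
  assumes "w \<in> Om" "i < n"
  shows "(\<Sum>j<n. trans dout w i j * g j) = (\<Sum>k<dout i. g (tgt w (i,k))) / real (dout i)"
proof -
  have "(\<Sum>j<n. trans dout w i j * g j) = (\<Sum>j<n. \<Sum>k\<in>{k\<in>{..<dout i}. tgt w (i,k) = j}. g (tgt w (i,k))) / real (dout i)"
  proof (subst sum_divide_distrib, rule sum.cong[OF refl])
    fix j
    have "(\<Sum>k\<in>{k\<in>{..<dout i}. tgt w (i,k) = j}. g (tgt w (i,k))) = (\<Sum>k\<in>{k\<in>{..<dout i}. tgt w (i,k) = j}. g j)"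
      by (rule sum.cong) auto
    thus "trans dout w i j * g j = (\<Sum>k\<in>{k\<in>{..<dout i}. tgt w (i,k) = j}. g (tgt w (i,k))) / real (dout i)"
      by (simp add: trans_def)
  qed
  also have "(\<Sum>j<n. \<Sum>k\<in>{k\<in>{..<dout i}. tgt w (i,k) = j}. g (tgt w (i,k))) = (\<Sum>k<dout i. g (tgt w (i,k)))"
  proof (rule sum.group)
    show "(\<lambda>k. tgt w (i,k)) ` {..<dout i} \<subseteq> {..<n}"
      using tgt_lt[OF assms(1)] assms(2) by (simp add: T_iff image_subset_iff)
  qed auto
  finally show ?thesis .
qed

lemma trans_nonneg: "0 \<le> trans dout w i j"
  by (simp add: trans_def)

lemma P_nonneg: "0 \<le> P w t i j"
  by (induction t arbitrary: j) (auto intro!: sum_nonneg mult_nonneg_nonneg trans_nonneg)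

lemma P_row:
  assumes "w \<in> Om" "i < n" shows "(\<Sum>j<n. P w t i j) = 1"
proof (induction t)
  case 0 thus ?case using assms by (simp add: sum.delta)
next
  case (Suc t)
  have "(\<Sum>j<n. P w (Suc t) i j) = (\<Sum>k<n. P w t i k * (\<Sum>j<n. trans dout w k j * 1))"
    by (simp add: sum_distrib_left) (rule sum.swap)
  also have "\<dots> = (\<Sum>k<n. P w t i k)"
  proof (rule sum.cong[OF refl])
    fix k assume "k \<in> {..<n}"
    thus "P w t i k * (\<Sum>j<n. trans dout w k j * 1) = P w t i k"
      using trans_sum[OF assms(1), of k "\<lambda>_. 1"] deg[of k] by simp
  qed
  finally show ?case using Suc by simp
qed

lemma P_add:
  assumes "i < n" "j < n"
  shows "P w (a + b) i j = (\<Sum>k<n. P w a i k * P w b k j)"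
  using assms(2)
proof (induction b arbitrary: j)
  case 0
  have "(\<Sum>k<n. P w a i k * P w 0 k j) = (\<Sum>k<n. if k = j then P w a i k else 0)"
    by (rule sum.cong) auto
  thus ?case using 0 by (simp add: sum.delta)
next
  case (Suc b)
  have "P w (a + Suc b) i j = (\<Sum>l<n. (\<Sum>k<n. P w a i k * P w b k l) * trans dout w l j)"
    using Suc by simp
  also have "\<dots> = (\<Sum>k<n. \<Sum>l<n. P w a i k * P w b k l * trans dout w l j)"
    unfolding sum_distrib_right by (rule sum.swap)
  finally show ?case by (simp add: sum_distrib_left mult.assoc)
qed

lemma P_1: "i < n \<Longrightarrow> P w (Suc 0) i j = trans dout w i j"
proof -
  assume i: "i < n"
  have "P w (Suc 0) i j = (\<Sum>k<n. if i = k then trans dout w k j else 0)"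
    unfolding trans_pow.simps by (rule sum.cong) auto
  thus ?thesis using i by (simp add: sum.delta)
qed

text \<open>\<open>trans_pow\<close> peels off the last step, whereas inductions along paths and
  backward balls need the decomposition at the first one. Chapman-Kolmogorov supplies it.\<close>

lemma P_left:
  assumes "w \<in> Om" "i < n" "j < n"
  shows "P w (Suc t) i j = (\<Sum>k<dout i. P w t (tgt w (i,k)) j) / real (dout i)"
proof -
  have "P w (Suc t) i j = (\<Sum>k<n. P w (Suc 0) i k * P w t k j)"
    using P_add[of i j w "Suc 0" t] assms by simp
  also have "\<dots> = (\<Sum>k<n. trans dout w i k * P w t k j)"
    using P_1 assms by simp
  finally show ?thesis using trans_sum assms by simp
qed

lemma P_le_1: "w \<in> Om \<Longrightarrow> i < n \<Longrightarrow> j < n \<Longrightarrow> P w t i j \<le> 1"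
  using P_row[of w i t] member_le_sum[of j "{..<n}" "P w t i"] P_nonneg by force

section \<open>Contraction in l1 and the stationary law\<close>

definition l1norm :: "(nat \<Rightarrow> real) \<Rightarrow> real" where
  "l1norm z = (\<Sum>j<n. \<bar>z j\<bar>)"

definition push :: "(pt \<Rightarrow> pt) \<Rightarrow> nat \<Rightarrow> (nat \<Rightarrow> real) \<Rightarrow> nat \<Rightarrow> real" where
  "push w t z j = (\<Sum>i<n. z i * P w t i j)"

text \<open>Subtracting one fixed vector \<open>nu\<close> from every row does not change the image
  of a vector of total mass zero. The switch \<open>s\<close> merges two uses: \<open>s = 1\<close>
  demands zero mass and allows any \<open>nu\<close>, \<open>s = 0\<close> allows any
  \<open>z\<close> but forces \<open>nu\<close> to vanish.\<close>

lemma push_contract: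
  assumes nu: "\<And>i. i < n \<Longrightarrow> (\<Sum>j<n. \<bar>P w t i j - nu j\<bar>) \<le> r" and z: "(\<Sum>i<n. z i) * s = 0" and s: "s = 1 \<or> s = 0"
    and nu': "s = 0 \<Longrightarrow> nu = (\<lambda>_. 0)"
  shows "l1norm (push w t z) \<le> r * l1norm z"
proof -
  have "push w t z j = (\<Sum>i<n. z i * (P w t i j - nu j))" for j
  proof -
    have "(\<Sum>i<n. z i * (P w t i j - nu j)) = push w t z j - (\<Sum>i<n. z i) * nu j"
      by (simp add: push_def algebra_simps sum_subtractf sum_distrib_left sum_distrib_right)
    thus ?thesis using z s nu' by auto
  qed
  hence "l1norm (push w t z) \<le> (\<Sum>j<n. \<Sum>i<n. \<bar>z i * (P w t i j - nu j)\<bar>)"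
    unfolding l1norm_def by (intro sum_mono) (simp add: sum_abs)
  also have "\<dots> = (\<Sum>i<n. \<bar>z i\<bar> * (\<Sum>j<n. \<bar>P w t i j - nu j\<bar>))"
    by (subst sum.swap) (simp add: abs_mult sum_distrib_left)
  also have "\<dots> \<le> (\<Sum>i<n. \<bar>z i\<bar> * r)"
    by (intro sum_mono mult_left_mono nu) auto
  finally show ?thesis by (simp add: l1norm_def sum_distrib_left mult.commute)
qed

lemma push_nonexpansive:
  assumes "w \<in> Om" shows "l1norm (push w t z) \<le> l1norm z"
  using push_contract[where nu = "\<lambda>_. 0" and r = 1 and s = 0 and w = w and t = t and z = z] P_row[OF assms] P_nonneg by simp

lemma push_sum:
  assumes "w \<in> Om" shows "(\<Sum>j<n. push w t z j) = (\<Sum>i<n. z i)"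
proof -
  have "(\<Sum>j<n. push w t z j) = (\<Sum>i<n. z i * (\<Sum>j<n. P w t i j))"
    unfolding push_def sum_distrib_left by (rule sum.swap)
  thus ?thesis using P_row[OF assms] by simp
qed

lemma push_add: 
  assumes "j < n" shows "push w (a + b) z j = push w b (push w a z) j"
proof -
  have "push w (a + b) z j = (\<Sum>i<n. \<Sum>k<n. z i * P w a i k * P w b k j)"
    unfolding push_def using assms by (simp add: P_add sum_distrib_left mult.assoc)
  also have "\<dots> = push w b (push w a z) j"
    unfolding push_def sum_distrib_right by (rule sum.swap)
  finally show ?thesis .
qed

lemma push_cong: "(\<And>i. i < n \<Longrightarrow> z i = z' i) \<Longrightarrow> push w t z = push w t z'"
  by (simp add: push_def fun_eq_iff)

lemma push_diff: "push w t (\<lambda>i. y i - z i) j = push w t y j - push w t z j"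
  by (simp add: push_def sum_subtractf algebra_simps)

lemma push_row: "x < n \<Longrightarrow> j < n \<Longrightarrow> push w b (\<lambda>i. P w a x i) j = P w (a + b) x j"
  by (simp add: push_def P_add)

lemma stationary_push:
  assumes "stationary dout n w q" "j < n" shows "push w t q j = q j"
  using assms(2)
proof (induction t arbitrary: j)
  case 0
  have "push w 0 q j = (\<Sum>i<n. if i = j then q i else 0)" unfolding push_def by (rule sum.cong) auto
  thus ?case using 0 by simp
next
  case (Suc t)
  have "push w (Suc t) q j = push w (Suc 0) (push w t q) j" using push_add[of j w t "Suc 0" q] Suc by simp
  also have "\<dots> = push w (Suc 0) q j" using Suc by (simp add: push_cong[of "push w t q" q])
  also have "\<dots> = q j" using assms(1) Suc.prems P_1 by (simp add: push_def stationary_def)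
  finally show ?case .
qed

lemma push_limit:
  assumes "\<And>i. i < n \<Longrightarrow> (\<lambda>k. b k i) \<longlonglongrightarrow> q i"
  shows "(\<lambda>k. push w t (b k) j) \<longlonglongrightarrow> push w t q j"
  unfolding push_def by (intro tendsto_sum tendsto_mult tendsto_const assms) auto

text \<open>On vectors of mass zero, \<open>N\<close> steps contract the l1 norm by
  \<open>r\<close>. Hence the laws after \<open>k * N\<close> steps from vertex 0 have increments of
  size \<open>2 * r ^ k\<close> and converge, which yields existence without any appeal to
  irreducibility; contraction of the difference of two fixed vectors of equal mass yields
  uniqueness.\<close>

lemma unique_stationary:
  assumes w: "w \<in> Om" and nu: "\<And>i. i < n \<Longrightarrow> (\<Sum>j<n. \<bar>P w N i j - nu j\<bar>) \<le> r" and r: "r < 1"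
  shows "\<exists>!q. stationary dout n w q"
proof -
  have contr: "l1norm (push w N z) \<le> r * l1norm z" if "(\<Sum>i<n. z i) = 0" for z
    by (rule push_contract[where s = 1 and nu = nu]) (use nu that in auto)
  have r0: "0 \<le> r" using nu[OF n_pos] sum_nonneg[of "{..<n}" "\<lambda>j. \<bar>P w N 0 j - nu j\<bar>"] by (smt (verit) abs_ge_zero)
  have nrm0: "z i = 0" if "l1norm z \<le> r * l1norm z" "i < n" for z i
  proof -
    have "l1norm z \<ge> 0" by (auto simp: l1norm_def intro: sum_nonneg)
    moreover have "(1 - r) * l1norm z \<le> 0" using that by (simp add: algebra_simps)
    ultimately have "l1norm z = 0" using r by (smt (verit) mult_pos_pos)
    thus ?thesis using that by (auto simp: l1norm_def sum_nonneg_eq_0_iff)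
  qed
  define b where "b k j = P w (k * N) 0 j" for k j
  have b_step: "b (Suc k) j = push w N (b k) j" if "j < n" for k j
    using that n_pos push_row[of 0 j w N "k * N"] by (simp add: b_def[abs_def] add.commute)
  have b_sum: "(\<Sum>j<n. b k j) = 1" for k using P_row[OF w n_pos] by (simp add: b_def)
  have b_diff: "l1norm (\<lambda>j. b (Suc k) j - b k j) \<le> 2 * r ^ k" for k
  proof (induction k)
    case 0
    have "l1norm (\<lambda>j. b (Suc 0) j - b 0 j) \<le> (\<Sum>j<n. b (Suc 0) j + b 0 j)"
      unfolding l1norm_def using P_nonneg[of w] by (intro sum_mono) (smt (verit) b_def)
    thus ?case using b_sum by (simp add: sum.distrib)
  next
    case (Suc k)
    have "l1norm (\<lambda>j. b (Suc (Suc k)) j - b (Suc k) j) = l1norm (push w N (\<lambda>j. b (Suc k) j - b k j))"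
      unfolding l1norm_def by (rule sum.cong) (auto simp: b_step push_diff)
    also have "\<dots> \<le> r * l1norm (\<lambda>j. b (Suc k) j - b k j)"
      by (rule contr) (simp add: sum_subtractf b_sum)
    also have "\<dots> \<le> r * (2 * r ^ k)" by (rule mult_left_mono[OF Suc r0])
    finally show ?case by simp
  qed
  have "\<exists>l. (\<lambda>k. b k j) \<longlonglongrightarrow> l" if "j < n" for j
  proof -
    have "summable (\<lambda>k. b (Suc k) j - b k j)"
    proof (rule summable_comparison_test')
      show "summable (\<lambda>k. 2 * r ^ k)" using r r0 by (intro summable_mult summable_geometric) auto
      show "norm (b (Suc k) j - b k j) \<le> 2 * r ^ k" if "k \<ge> 0" for k
        using b_diff[of k] member_le_sum[of j "{..<n}" "\<lambda>j. \<bar>b (Suc k) j - b k j\<bar>"] \<open>j < n\<close>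
        by (simp add: l1norm_def)
    qed
    hence "(\<lambda>K. \<Sum>k<K. b (Suc k) j - b k j) \<longlonglongrightarrow> (\<Sum>k. b (Suc k) j - b k j)" by (rule summable_LIMSEQ)
    hence "(\<lambda>K. b K j - b 0 j) \<longlonglongrightarrow> (\<Sum>k. b (Suc k) j - b k j)" by (simp add: sum_lessThan_telescope[of "\<lambda>k. b k j"])
    from tendsto_add[OF this tendsto_const[of "b 0 j"]] show ?thesis by auto
  qed
  then obtain l where l: "\<And>j. j < n \<Longrightarrow> (\<lambda>k. b k j) \<longlonglongrightarrow> l j" by metis
  define q where "q j = (if j < n then l j else 0)" for j
  have q: "\<And>j. j < n \<Longrightarrow> (\<lambda>k. b k j) \<longlonglongrightarrow> q j" using l by (simp add: q_def)
  have q_sum: "(\<Sum>j<n. q j) = 1"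
  proof (rule LIMSEQ_unique)
    show "(\<lambda>k. \<Sum>j<n. b k j) \<longlonglongrightarrow> (\<Sum>j<n. q j)" by (intro tendsto_sum q) auto
    show "(\<lambda>k. \<Sum>j<n. b k j) \<longlonglongrightarrow> 1" by (simp add: b_sum)
  qed
  have q_N: "push w N q j = q j" if "j < n" for j
  proof (rule LIMSEQ_unique)
    show "(\<lambda>k. push w N (b k) j) \<longlonglongrightarrow> push w N q j" by (rule push_limit[OF q])
    show "(\<lambda>k. push w N (b k) j) \<longlonglongrightarrow> q j" using LIMSEQ_Suc[OF q[OF that]] b_step[OF that] by simp
  qed
  have fix_unique: "y j = z j" if "\<And>j. j < n \<Longrightarrow> push w N y j = y j" "\<And>j. j < n \<Longrightarrow> push w N z j = z j"
    "(\<Sum>j<n. y j) = (\<Sum>j<n. z j)" "j < n" for y z j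
  proof -
    have "l1norm (\<lambda>j. y j - z j) = l1norm (push w N (\<lambda>j. y j - z j))"
      unfolding l1norm_def by (rule sum.cong) (use that in \<open>auto simp: push_diff\<close>)
    also have "\<dots> \<le> r * l1norm (\<lambda>j. y j - z j)" by (rule contr) (simp add: sum_subtractf that)
    finally show ?thesis using nrm0 that(4) by fastforce
  qed
  \<comment> \<open>One step commutes with \<open>N\<close> steps, so its image of \<open>q\<close>
    is again fixed by \<open>N\<close> steps and has the same mass; \<open>fix_unique\<close>
    identifies it with \<open>q\<close>.\<close>
  have q_1: "push w (Suc 0) q j = q j" if "j < n" for j
  proof (rule fix_unique)
    fix i assume i: "i < n"
    have "push w N (push w (Suc 0) q) i = push w (Suc 0) (push w N q) i"
      using push_add[OF i, of w "Suc 0" N q] push_add[OF i, of w N "Suc 0" q] by simp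
    also have "\<dots> = push w (Suc 0) q i" using q_N push_cong by metis
    finally show "push w N (push w (Suc 0) q) i = push w (Suc 0) q i" .
  qed (use q_N that push_sum[OF w] in auto)
  have st: "stationary dout n w q"
    unfolding stationary_def
  proof (intro conjI allI impI)
    show "0 \<le> q j" for j
      using q[of j] by (cases "j < n") (auto simp: q_def b_def intro!: LIMSEQ_le_const P_nonneg)
    show "(\<Sum>i<n. q i * trans dout w i j) = q j" if "j < n" for j
      using q_1[OF that] P_1 by (simp add: push_def)
  qed (use q_sum in \<open>auto simp: q_def\<close>)
  show ?thesis
  proof (rule ex1I[of "stationary dout n w", OF st])
    fix y assume y: "stationary dout n w y"
    show "y = q"
    proof
      fix j show "y j = q j"
      proof (cases "j < n")
        case True
        show ?thesis
          by (rule fix_unique) (use True q_N stationary_push[OF y] y q_sum in \<open>auto simp: stationary_def\<close>)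
      next
        case False thus ?thesis using y by (simp add: q_def stationary_def)
      qed
    qed
  qed
qed

text \<open>Pushing fixes \<open>pi_star\<close> and does not increase the l1 norm. Therefore one
  well-chosen time on each side of \<open>t_star\<close> settles all earlier, respectively later,
  times.\<close>

lemma tv_dist_antimono:
  assumes w: "w \<in> Om" and st: "stationary dout n w (pi_star dout n w)" and "x < n" "s \<le> t"
  shows "tv_dist dout n w t x \<le> tv_dist dout n w s x"
proof -
  let ?q = "pi_star dout n w"
  have "l1norm (\<lambda>j. P w t x j - ?q j) = l1norm (push w (t - s) (\<lambda>j. P w s x j - ?q j))"
    unfolding l1norm_def
    by (rule sum.cong) (use assms in \<open>auto simp: push_diff push_row stationary_push[OF st]\<close>)
  also have "\<dots> \<le> l1norm (\<lambda>j. P w s x j - ?q j)" by (rule push_nonexpansive[OF w])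
  finally show ?thesis by (simp add: tv_dist_def l1norm_def)
qed

text \<open>The stationary law is an average of the rows of the \<open>N\<close>-step matrix, so it
  is also within \<open>r\<close> of \<open>nu\<close>. The factor 1/2 in \<open>tv_dist\<close>
  absorbs the two errors of the triangle inequality.\<close>

lemma tv_dist_upper:
  assumes w: "w \<in> Om" and nu: "\<And>i. i < n \<Longrightarrow> (\<Sum>j<n. \<bar>P w N i j - nu j\<bar>) \<le> r" and r: "r < 1"
  shows "stationary dout n w (pi_star dout n w)"
    and "(\<Sum>j<n. \<bar>pi_star dout n w j - nu j\<bar>) \<le> r"
    and "\<And>t x. N \<le> t \<Longrightarrow> x < n \<Longrightarrow> tv_dist dout n w t x \<le> r"
proof -
  let ?q = "pi_star dout n w"
  show st: "stationary dout n w ?q"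
    unfolding pi_star_def by (rule theI'[OF unique_stationary[OF assms]])
  hence q: "(\<Sum>j<n. ?q j) = 1" "\<And>j. ?q j \<ge> 0" by (auto simp: stationary_def)
  have "(\<Sum>j<n. \<bar>?q j - nu j\<bar>) = (\<Sum>j<n. \<bar>\<Sum>i<n. ?q i * (P w N i j - nu j)\<bar>)"
  proof (intro sum.cong refl arg_cong[where f = abs])
    fix j assume "j \<in> {..<n}"
    hence "?q j - nu j = push w N ?q j - (\<Sum>i<n. ?q i) * nu j" using stationary_push[OF st] q by simp
    thus "?q j - nu j = (\<Sum>i<n. ?q i * (P w N i j - nu j))"
      by (simp add: push_def algebra_simps sum_subtractf sum_distrib_left sum_distrib_right)
  qed
  also have "\<dots> \<le> (\<Sum>j<n. \<Sum>i<n. \<bar>?q i * (P w N i j - nu j)\<bar>)" by (intro sum_mono sum_abs)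
  also have "\<dots> = (\<Sum>i<n. ?q i * (\<Sum>j<n. \<bar>P w N i j - nu j\<bar>))"
    by (subst sum.swap) (simp add: abs_mult q sum_distrib_left)
  also have "\<dots> \<le> (\<Sum>i<n. ?q i * r)" by (intro sum_mono mult_left_mono nu q) auto
  also have "\<dots> = r" using q by (simp add: sum_distrib_right[symmetric])
  finally show qnu: "(\<Sum>j<n. \<bar>?q j - nu j\<bar>) \<le> r" .
  fix t x assume t: "N \<le> t" and x: "x < n"
  have "tv_dist dout n w t x \<le> tv_dist dout n w N x" by (rule tv_dist_antimono[OF w st x t])
  also have "\<dots> \<le> 1/2 * ((\<Sum>j<n. \<bar>P w N x j - nu j\<bar>) + (\<Sum>j<n. \<bar>?q j - nu j\<bar>))"
    unfolding tv_dist_def sum.distrib[symmetric] by (intro mult_left_mono sum_mono) auto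
  also have "\<dots> \<le> r" using nu[OF x] qnu by simp
  finally show "tv_dist dout n w t x \<le> r" .
qed

end

subsection \<open>Exploring the out-tree of a vertex\<close>

text \<open>The state of an exploration: the revealed part of the matching, the depth and the weight of every vertex
  reached so far, and the revealed tails that led to a vertex that had been reached before.\<close>
datatype exploration = Est (matched: "pt \<rightharpoonup> pt") (reached: "nat \<rightharpoonup> nat \<times> real") (collided: "pt set")

context conf begin

definition vdepth :: "exploration \<Rightarrow> nat \<Rightarrow> nat" where "vdepth s v = fst (the (reached s v))"
definition vweight :: "exploration \<Rightarrow> nat \<Rightarrow> real" where "vweight s v = snd (the (reached s v))"
definition tdepth :: "exploration \<Rightarrow> pt \<Rightarrow> nat" where "tdepth s e = vdepth s (fst e)"
text \<open>The probability that the walk follows the tree path to the vertex of \<open>e\<close>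
  and then leaves through \<open>e\<close>.\<close>

definition tweight :: "exploration \<Rightarrow> pt \<Rightarrow> real" where "tweight s e = vweight s (fst e) / real (dout (fst e))"
definition frontier :: "exploration \<Rightarrow> pt set" where "frontier s = {e \<in> T. fst e \<in> dom (reached s) \<and> e \<notin> dom (matched s)}"
definition hd_of :: "exploration \<Rightarrow> pt \<Rightarrow> nat" where "hd_of s e = fst (the (matched s e))"

text \<open>A vertex keeps the depth and weight of its first discovery. A tail that hits it again is
  not followed any further, so its mass stays parked in \<open>collided\<close> and the rest remains
  a tree.\<close>

definition reveal :: "exploration \<Rightarrow> pt \<Rightarrow> pt \<Rightarrow> exploration" where
  "reveal s e f = (if fst f \<in> dom (reached s) then Est ((matched s)(e \<mapsto> f)) (reached s) (insert e (collided s))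
     else Est ((matched s)(e \<mapsto> f)) ((reached s)(fst f \<mapsto> (Suc (tdepth s e), tweight s e))) (collided s))"

definition init :: "nat \<Rightarrow> exploration" where
  "init x = Est Map.empty [x \<mapsto> (0, 1)] {}"

definition eligible :: "nat \<Rightarrow> real \<Rightarrow> exploration \<Rightarrow> pt set" where
  "eligible S \<theta> s = {e \<in> frontier s. tdepth s e < S \<and> \<theta> \<le> tweight s e}"

text \<open>Taking a tail of least depth makes the exploration breadth-first, which is what the
  invariant \<open>bfs\<close> relies on.\<close>

definition next_tail :: "nat \<Rightarrow> real \<Rightarrow> exploration \<Rightarrow> pt option" where
  "next_tail S \<theta> s = (if eligible S \<theta> s = {} then None else Some (ARG_MIN (tdepth s) e. e \<in> eligible S \<theta> s))"

lemma next_tail_SomeD: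
  assumes "next_tail S \<theta> s = Some e"
  shows "e \<in> frontier s" "tdepth s e < S" "\<theta> \<le> tweight s e" "\<And>e'. e' \<in> eligible S \<theta> s \<Longrightarrow> tdepth s e \<le> tdepth s e'"
proof -
  have ne: "eligible S \<theta> s \<noteq> {}" and e: "e = (ARG_MIN (tdepth s) e. e \<in> eligible S \<theta> s)"
    using assms by (auto simp: next_tail_def split: if_splits)
  obtain a where a: "a \<in> eligible S \<theta> s" using ne by blast
  have "e \<in> eligible S \<theta> s" unfolding e by (rule arg_min_natI[of "\<lambda>e. e \<in> eligible S \<theta> s", OF a])
  thus "e \<in> frontier s" "tdepth s e < S" "\<theta> \<le> tweight s e" by (auto simp: eligible_def)
  show "tdepth s e \<le> tdepth s e'" if "e' \<in> eligible S \<theta> s" for e'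
    unfolding e by (rule arg_min_nat_le[of "\<lambda>e. e \<in> eligible S \<theta> s", OF that])
qed

lemma next_tail_None: "next_tail S \<theta> s = None \<longleftrightarrow> eligible S \<theta> s = {}"
  by (simp add: next_tail_def)

lemma finite_frontier [simp]: "finite (frontier s)"
  by (simp add: frontier_def)

text \<open>The tree is encoded through its edges: the heads of the revealed tails outside
  \<open>collided\<close> are distinct, miss the root and exhaust the other reached vertices. The
  weight bounds are the degree bounds 2 and \<open>D\<close> multiplied along a path.\<close>

definition tree_state :: "nat \<Rightarrow> exploration \<Rightarrow> bool" where
  "tree_state x s \<longleftrightarrow> vld (matched s) \<and> dom (reached s) \<subseteq> {..<n} \<and> reached s x = Some (0, 1) \<and>
    (\<forall>e\<in>dom (matched s). fst e \<in> dom (reached s) \<and> hd_of s e \<in> dom (reached s)) \<and> collided s \<subseteq> dom (matched s) \<and>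
    (\<forall>e\<in>dom (matched s) - collided s. reached s (hd_of s e) = Some (Suc (tdepth s e), tweight s e)) \<and>
    inj_on (hd_of s) (dom (matched s) - collided s) \<and> x \<notin> hd_of s ` (dom (matched s) - collided s) \<and>
    dom (reached s) \<subseteq> insert x (hd_of s ` (dom (matched s) - collided s)) \<and>
    (\<forall>v\<in>dom (reached s). 0 < vweight s v \<and> vweight s v \<le> (1/2) ^ vdepth s v \<and> (1 / real D) ^ vdepth s v \<le> vweight s v)"

lemma tree_stateD:
  assumes "tree_state x s"
  shows "vld (matched s)" "dom (reached s) \<subseteq> {..<n}" "reached s x = Some (0, 1)"
    "\<And>e. e \<in> dom (matched s) \<Longrightarrow> fst e \<in> dom (reached s)" "\<And>e. e \<in> dom (matched s) \<Longrightarrow> hd_of s e \<in> dom (reached s)"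
    "collided s \<subseteq> dom (matched s)"
    "\<And>e. e \<in> dom (matched s) \<Longrightarrow> e \<notin> collided s \<Longrightarrow> reached s (hd_of s e) = Some (Suc (tdepth s e), tweight s e)"
    "inj_on (hd_of s) (dom (matched s) - collided s)" "x \<notin> hd_of s ` (dom (matched s) - collided s)"
    "dom (reached s) \<subseteq> insert x (hd_of s ` (dom (matched s) - collided s))"
    "\<And>v. v \<in> dom (reached s) \<Longrightarrow> 0 < vweight s v" "\<And>v. v \<in> dom (reached s) \<Longrightarrow> vweight s v \<le> (1/2) ^ vdepth s v"
    "\<And>v. v \<in> dom (reached s) \<Longrightarrow> (1 / real D) ^ vdepth s v \<le> vweight s v"
  using assms unfolding tree_state_def by blast+

lemma tree_state_finite:
  assumes "tree_state x s" shows "finite (dom (matched s))" "finite (dom (reached s))" "finite (collided s)"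
proof -
  show 1: "finite (dom (matched s))" using tree_stateD(1)[OF assms] finite_subset[OF _ finite_T] by (auto simp: vld_def)
  show "finite (dom (reached s))" using tree_stateD(2)[OF assms] finite_subset by blast
  show "finite (collided s)" using 1 tree_stateD(6)[OF assms] finite_subset by blast
qed

lemma tweight_bounds:
  assumes "tree_state x s" "e \<in> T" "fst e \<in> dom (reached s)"
  shows "0 < tweight s e" "tweight s e \<le> (1/2) ^ Suc (tdepth s e)" "(1 / real D) ^ Suc (tdepth s e) \<le> tweight s e"
proof -
  have d: "2 \<le> dout (fst e)" "dout (fst e) \<le> D" using deg T_fst assms by auto
  note b = tree_stateD(11-13)[OF assms(1,3)]
  show "0 < tweight s e" using b d by (simp add: tweight_def)
  have "tweight s e \<le> (1/2) ^ vdepth s (fst e) / 2"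
    unfolding tweight_def using b d by (intro frac_le) auto
  thus "tweight s e \<le> (1/2) ^ Suc (tdepth s e)" by (simp add: tdepth_def)
  have "(1 / real D) ^ vdepth s (fst e) / real D \<le> tweight s e"
    unfolding tweight_def using b d by (intro frac_le) auto
  thus "(1 / real D) ^ Suc (tdepth s e) \<le> tweight s e" by (simp add: tdepth_def)
qed

lemma frontierD: "e \<in> frontier s \<Longrightarrow> e \<in> T" "e \<in> frontier s \<Longrightarrow> fst e \<in> dom (reached s)" "e \<in> frontier s \<Longrightarrow> e \<notin> dom (matched s)"
  by (auto simp: frontier_def)

lemma matched_reveal: "matched (reveal s e f) = (matched s)(e \<mapsto> f)"
  by (simp add: reveal_def)

lemma reached_reveal:
  "fst f \<in> dom (reached s) \<Longrightarrow> reached (reveal s e f) = reached s"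
  "fst f \<notin> dom (reached s) \<Longrightarrow> reached (reveal s e f) = (reached s)(fst f \<mapsto> (Suc (tdepth s e), tweight s e))"
  by (simp_all add: reveal_def)

lemma collided_reveal:
  "fst f \<in> dom (reached s) \<Longrightarrow> collided (reveal s e f) = insert e (collided s)"
  "fst f \<notin> dom (reached s) \<Longrightarrow> collided (reveal s e f) = collided s"
  by (simp_all add: reveal_def)

lemma reached_reveal_old: "v \<in> dom (reached s) \<Longrightarrow> reached (reveal s e f) v = reached s v"
  by (cases "fst f \<in> dom (reached s)") (auto simp: reached_reveal)

lemma vdepth_reveal_old: "v \<in> dom (reached s) \<Longrightarrow> vdepth (reveal s e f) v = vdepth s v"
  and vweight_reveal_old: "v \<in> dom (reached s) \<Longrightarrow> vweight (reveal s e f) v = vweight s v"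
  and tdepth_reveal_old: "fst e' \<in> dom (reached s) \<Longrightarrow> tdepth (reveal s e f) e' = tdepth s e'"
  and tweight_reveal_old: "fst e' \<in> dom (reached s) \<Longrightarrow> tweight (reveal s e f) e' = tweight s e'"
  by (simp_all add: vdepth_def vweight_def tdepth_def tweight_def reached_reveal_old)

lemma tdepth_reveal_new: "fst f \<notin> dom (reached s) \<Longrightarrow> fst e' = fst f \<Longrightarrow> tdepth (reveal s e f) e' = Suc (tdepth s e)"
  and tweight_reveal_new: "fst f \<notin> dom (reached s) \<Longrightarrow> fst e' = fst f \<Longrightarrow> tweight (reveal s e f) e' = tweight s e / real (dout (fst f))"
  by (simp_all add: vdepth_def vweight_def tdepth_def tweight_def reached_reveal)

lemma dom_reached_reveal: "dom (reached (reveal s e f)) = insert (fst f) (dom (reached s))"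
  by (auto simp: reveal_def)

lemma frontier_reveal:
  assumes b: "tree_state x s" and e: "e \<in> frontier s" and f: "f \<in> H"
  shows "fst f \<in> dom (reached s) \<Longrightarrow> frontier (reveal s e f) = frontier s - {e}"
    and "fst f \<notin> dom (reached s) \<Longrightarrow> frontier (reveal s e f) = (frontier s - {e}) \<union> {fst f} \<times> {..<dout (fst f)}"
    and "fst f \<notin> dom (reached s) \<Longrightarrow> (frontier s - {e}) \<inter> {fst f} \<times> {..<dout (fst f)} = {}"
proof -
  show "fst f \<in> dom (reached s) \<Longrightarrow> frontier (reveal s e f) = frontier s - {e}"
    by (auto simp: frontier_def matched_reveal reached_reveal)
  assume nf: "fst f \<notin> dom (reached s)"
  have "\<And>k. (fst f, k) \<notin> dom (matched s)" using tree_stateD(4)[OF b] nf by fastforce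
  moreover have "fst e \<noteq> fst f" using frontierD(2)[OF e] nf by auto
  moreover have "fst f < n" by (rule H_fst[OF f])
  ultimately show "frontier (reveal s e f) = (frontier s - {e}) \<union> {fst f} \<times> {..<dout (fst f)}"
    using nf unfolding frontier_def matched_reveal dom_reached_reveal by (auto simp: tails_def)
  show "(frontier s - {e}) \<inter> {fst f} \<times> {..<dout (fst f)} = {}" using nf by (auto simp: frontier_def)
qed

text \<open>The cost \<open>c\<close> is arbitrary because the same bookkeeping serves three sums:
  the total mass, the depth-weighted mass that counts steps, and the potential
  \<open>Psi\<close>.\<close>

lemma sum_frontier_reveal:
  fixes c :: "nat \<Rightarrow> real \<Rightarrow> real"
  assumes b: "tree_state x s" and e: "e \<in> frontier s" and f: "f \<in> H"
  defines "Q \<equiv> \<lambda>s. \<Sum>e\<in>frontier s. c (tdepth s e) (tweight s e)"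
  shows "fst f \<in> dom (reached s) \<Longrightarrow> Q (reveal s e f) = Q s - c (tdepth s e) (tweight s e)"
    and "fst f \<notin> dom (reached s) \<Longrightarrow> Q (reveal s e f) = Q s - c (tdepth s e) (tweight s e)
      + real (dout (fst f)) * c (Suc (tdepth s e)) (tweight s e / real (dout (fst f)))"
proof -
  have old: "(\<Sum>e'\<in>frontier s - {e}. c (tdepth (reveal s e f) e') (tweight (reveal s e f) e')) = Q s - c (tdepth s e) (tweight s e)"
  proof -
    have "(\<Sum>e'\<in>frontier s - {e}. c (tdepth (reveal s e f) e') (tweight (reveal s e f) e')) = (\<Sum>e'\<in>frontier s - {e}. c (tdepth s e') (tweight s e'))"
      by (rule sum.cong[OF refl]) (simp add: tdepth_reveal_old tweight_reveal_old frontierD(2))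
    thus ?thesis using e by (simp add: Q_def sum_diff1)
  qed
  show "fst f \<in> dom (reached s) \<Longrightarrow> Q (reveal s e f) = Q s - c (tdepth s e) (tweight s e)"
    using old frontier_reveal(1)[OF b e f] by (simp add: Q_def)
  assume nf: "fst f \<notin> dom (reached s)"
  have "(\<Sum>e'\<in>{fst f} \<times> {..<dout (fst f)}. c (tdepth (reveal s e f) e') (tweight (reveal s e f) e'))
     = (\<Sum>e'\<in>{fst f} \<times> {..<dout (fst f)}. c (Suc (tdepth s e)) (tweight s e / real (dout (fst f))))"
    by (rule sum.cong) (use nf tdepth_reveal_new tweight_reveal_new in \<open>auto simp: mem_Times_iff\<close>)
  hence new: "(\<Sum>e'\<in>{fst f} \<times> {..<dout (fst f)}. c (tdepth (reveal s e f) e') (tweight (reveal s e f) e'))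
     = real (dout (fst f)) * c (Suc (tdepth s e)) (tweight s e / real (dout (fst f)))"
    by (simp add: card_cartesian_product)
  show "Q (reveal s e f) = Q s - c (tdepth s e) (tweight s e)
      + real (dout (fst f)) * c (Suc (tdepth s e)) (tweight s e / real (dout (fst f)))"
    unfolding Q_def frontier_reveal(2)[OF b e f nf]
    by (subst sum.union_disjoint) (use frontier_reveal(3)[OF b e f nf] old new in \<open>auto simp: Q_def\<close>)
qed

lemma sum_collided_reveal:
  fixes c :: "nat \<Rightarrow> real \<Rightarrow> real"
  assumes b: "tree_state x s" and e: "e \<in> frontier s"
  defines "Q \<equiv> \<lambda>s. \<Sum>e\<in>collided s. c (tdepth s e) (tweight s e)"
  shows "fst f \<in> dom (reached s) \<Longrightarrow> Q (reveal s e f) = Q s + c (tdepth s e) (tweight s e)"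
    and "fst f \<notin> dom (reached s) \<Longrightarrow> Q (reveal s e f) = Q s"
proof -
  have collided: "e' \<in> collided s \<Longrightarrow> fst e' \<in> dom (reached s)" for e' using tree_stateD(4,6)[OF b] by blast
  have old: "(\<Sum>e'\<in>collided s. c (tdepth (reveal s e f) e') (tweight (reveal s e f) e')) = Q s"
    unfolding Q_def by (rule sum.cong[OF refl]) (simp add: tdepth_reveal_old tweight_reveal_old collided)
  have "e \<notin> collided s" using tree_stateD(6)[OF b] frontierD(3)[OF e] by auto
  thus "fst f \<in> dom (reached s) \<Longrightarrow> Q (reveal s e f) = Q s + c (tdepth s e) (tweight s e)"
    using old tree_state_finite(3)[OF b] frontierD(2)[OF e] by (simp add: Q_def collided_reveal tdepth_reveal_old tweight_reveal_old)
  show "fst f \<notin> dom (reached s) \<Longrightarrow> Q (reveal s e f) = Q s"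
    using old by (simp add: Q_def collided_reveal)
qed

lemma hd_of_reveal_old: "e' \<noteq> e \<Longrightarrow> hd_of (reveal s e f) e' = hd_of s e'"
  and hd_of_reveal_new: "hd_of (reveal s e f) e = fst f"
  by (simp_all add: hd_of_def matched_reveal)

lemma tree_state_reveal:
  assumes b: "tree_state x s" and e: "e \<in> frontier s" and f: "f \<in> H - ran (matched s)"
  shows "tree_state x (reveal s e f)"
proof -
  let ?s = "reveal s e f"
  note B = tree_stateD[OF b]
  have eT: "e \<in> T - dom (matched s)" and es: "fst e \<in> dom (reached s)" using frontierD e by auto
  have fH: "f \<in> H" using f by auto
  have ecl: "e \<notin> collided s" using B(6) eT by auto
  have dmt: "dom (matched ?s) = insert e (dom (matched s))" by (simp add: matched_reveal)
  have hold: "hd_of ?s e' = hd_of s e'" if "e' \<in> dom (matched s)" for e'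
    using that eT by (intro hd_of_reveal_old) auto
  have vs: "vld (matched ?s)" unfolding matched_reveal by (rule vld_upd[OF B(1) eT f])
  have wb: "0 < tweight s e" "tweight s e \<le> (1/2) ^ Suc (tdepth s e)" "(1 / real D) ^ Suc (tdepth s e) \<le> tweight s e"
    using tweight_bounds[OF b _ es] eT by auto
  have wvs: "0 < vweight ?s v \<and> vweight ?s v \<le> (1/2) ^ vdepth ?s v \<and> (1 / real D) ^ vdepth ?s v \<le> vweight ?s v"
    if "v \<in> dom (reached ?s)" for v
  proof (cases "v \<in> dom (reached s)")
    case True thus ?thesis using B(11-13) by (simp add: vweight_reveal_old vdepth_reveal_old)
  next
    case False
    hence v: "v = fst f" "fst f \<notin> dom (reached s)" using that by (auto simp: dom_reached_reveal)
    show ?thesis using wb v by (simp add: vdepth_def vweight_def reached_reveal)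
  qed
  have oldsn: "reached ?s (hd_of ?s e') = Some (Suc (tdepth ?s e'), tweight ?s e')" if "e' \<in> dom (matched s)" "e' \<notin> collided s" for e'
    using B(7)[OF that] B(4,5)[OF that(1)] hold[OF that(1)]
    by (simp add: reached_reveal_old tdepth_reveal_old tweight_reveal_old)
  have img: "hd_of ?s ` (dom (matched s) - collided s) = hd_of s ` (dom (matched s) - collided s)"
    by (rule image_cong) (auto simp: hold)
  have injo: "inj_on (hd_of ?s) (dom (matched s) - collided s)"
    using B(8) hold by (auto simp: inj_on_def)
  have sub: "hd_of s ` (dom (matched s) - collided s) \<subseteq> dom (reached s)" using B(5) by auto
  have dmt': "dom (matched ?s) - collided ?s = (if fst f \<in> dom (reached s) then dom (matched s) - collided s else insert e (dom (matched s) - collided s))"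
    using eT ecl by (auto simp: collided_reveal matched_reveal)
  show ?thesis
    unfolding tree_state_def
  proof (intro conjI)
    show "dom (reached ?s) \<subseteq> {..<n}" using B(2) H_fst[OF fH] by (auto simp: dom_reached_reveal)
    show "reached ?s x = Some (0, 1)" using B(3) reached_reveal_old[of x s e f] by auto
    show "\<forall>e'\<in>dom (matched ?s). fst e' \<in> dom (reached ?s) \<and> hd_of ?s e' \<in> dom (reached ?s)"
      using B(4,5) hold es by (auto simp: dmt dom_reached_reveal hd_of_reveal_new)
    show "collided ?s \<subseteq> dom (matched ?s)" using B(6) by (auto simp: reveal_def)
    show "\<forall>e'\<in>dom (matched ?s) - collided ?s. reached ?s (hd_of ?s e') = Some (Suc (tdepth ?s e'), tweight ?s e')"
    proof
      fix e' assume e': "e' \<in> dom (matched ?s) - collided ?s"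
      show "reached ?s (hd_of ?s e') = Some (Suc (tdepth ?s e'), tweight ?s e')"
      proof (cases "e' = e")
        case True
        hence nf: "fst f \<notin> dom (reached s)" using e' by (auto simp: dmt' split: if_splits intro: ccontr) (use eT in auto)
        thus ?thesis using True es by (simp add: hd_of_reveal_new reached_reveal tdepth_reveal_old tweight_reveal_old)
      next
        case False
        thus ?thesis using e' oldsn by (auto simp: dmt' split: if_splits)
      qed
    qed
    show "inj_on (hd_of ?s) (dom (matched ?s) - collided ?s)"
    proof (cases "fst f \<in> dom (reached s)")
      case True thus ?thesis using injo by (simp add: dmt')
    next
      case False
      hence "hd_of ?s e \<notin> hd_of ?s ` (dom (matched s) - collided s)" using sub by (simp only: hd_of_reveal_new img) blast
      thus ?thesis using injo False unfolding dmt' by (simp add: inj_on_insert) blast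
    qed
    show "x \<notin> hd_of ?s ` (dom (matched ?s) - collided ?s)"
      unfolding dmt' using B(3,9) img by (auto simp: hd_of_reveal_new)
    show "dom (reached ?s) \<subseteq> insert x (hd_of ?s ` (dom (matched ?s) - collided ?s))"
      unfolding dmt' dom_reached_reveal using B(10) img by (auto simp: hd_of_reveal_new)
    show "\<forall>v\<in>dom (reached ?s). 0 < vweight ?s v \<and> vweight ?s v \<le> (1/2) ^ vdepth ?s v \<and> (1 / real D) ^ vdepth ?s v \<le> vweight ?s v"
      using wvs by blast
  qed (rule vs)
qed

lemma tree_state_init: "x < n \<Longrightarrow> tree_state x (init x)"
  by (auto simp: tree_state_def init_def vweight_def vdepth_def)

text \<open>Mass is conserved: it sits on the frontier or on collided tails. The last clause counts
  steps, because revealing a tail moves its weight, which is at least \<theta>, one level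
  deeper.\<close>

definition explored :: "nat \<Rightarrow> nat \<Rightarrow> real \<Rightarrow> exploration \<Rightarrow> bool" where
  "explored x S \<theta> s \<longleftrightarrow> tree_state x s \<and> (\<Sum>e\<in>frontier s. tweight s e) + (\<Sum>e\<in>collided s. tweight s e) = 1 \<and>
    (\<forall>v\<in>dom (reached s). vdepth s v \<le> S) \<and> (\<forall>e\<in>collided s. tdepth s e < S) \<and>
    \<theta> * real (card (dom (matched s))) \<le> (\<Sum>e\<in>frontier s. tweight s e * real (tdepth s e)) + (\<Sum>e\<in>collided s. tweight s e * real (Suc (tdepth s e)))"

lemma explored_reveal:
  assumes i: "explored x S \<theta> s" and nxe: "next_tail S \<theta> s = Some e" and f: "f \<in> H - ran (matched s)"
  shows "explored x S \<theta> (reveal s e f)"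
proof -
  let ?s = "reveal s e f"
  have b: "tree_state x s" using i by (simp add: explored_def)
  note B = tree_stateD[OF b] and N = next_tail_SomeD[OF nxe]
  have fH: "f \<in> H" using f by auto
  have es: "fst e \<in> dom (reached s)" using frontierD(2)[OF N(1)] .
  have eT: "e \<in> T - dom (matched s)" using frontierD N(1) by blast
  have do: "fst f \<notin> dom (reached s) \<Longrightarrow> real (dout (fst f)) > 0" using deg[OF H_fst[OF fH]] by simp
  note F = sum_frontier_reveal[OF b N(1) fH] and G = sum_collided_reveal[OF b N(1), of f]
  have w: "(\<Sum>e\<in>frontier ?s. tweight ?s e) + (\<Sum>e\<in>collided ?s. tweight ?s e) = 1"
    using F[of "\<lambda>d w. w"] G[of "\<lambda>d w. w"] i do by (cases "fst f \<in> dom (reached s)") (auto simp: explored_def)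
  have d: "\<forall>v\<in>dom (reached ?s). vdepth ?s v \<le> S"
  proof
    fix v assume "v \<in> dom (reached ?s)"
    show "vdepth ?s v \<le> S"
    proof (cases "v \<in> dom (reached s)")
      case True thus ?thesis using i by (auto simp: vdepth_reveal_old explored_def)
    next
      case False
      hence v: "v = fst f" "fst f \<notin> dom (reached s)" using \<open>v \<in> dom (reached ?s)\<close> by (auto simp: dom_reached_reveal)
      thus ?thesis using N(2) by (simp add: vdepth_def reached_reveal)
    qed
  qed
  have c: "\<forall>e'\<in>collided ?s. tdepth ?s e' < S"
  proof
    fix e' assume e': "e' \<in> collided ?s"
    hence "e' = e \<or> e' \<in> collided s" by (auto simp: reveal_def split: if_splits)
    moreover have "e' \<in> collided s \<Longrightarrow> fst e' \<in> dom (reached s)" using B(4,6) by blast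
    ultimately show "tdepth ?s e' < S" using N(2) tdepth_reveal_old[OF es, of e f] tdepth_reveal_old[of e' s e f] i
      unfolding explored_def by metis
  qed
  have cd: "card (dom (matched ?s)) = Suc (card (dom (matched s)))"
    using eT tree_state_finite(1)[OF b] by (simp add: matched_reveal)
  have "\<theta> * real (card (dom (matched ?s))) = \<theta> * real (card (dom (matched s))) + \<theta>" unfolding cd by (simp add: algebra_simps)
  also have "\<dots> \<le> (\<Sum>e\<in>frontier s. tweight s e * real (tdepth s e)) + (\<Sum>e\<in>collided s. tweight s e * real (Suc (tdepth s e))) + tweight s e"
    using i N(3) by (auto simp: explored_def)
  \<comment> \<open>Both cases gain exactly \<open>tweight s e\<close>. A fresh vertex spreads this
    weight over its tails one level deeper; a collision keeps it on \<open>e\<close>, and for this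
    reason collided tails are counted with \<open>Suc\<close> of their depth.\<close>
  also have "\<dots> = (\<Sum>e\<in>frontier ?s. tweight ?s e * real (tdepth ?s e)) + (\<Sum>e\<in>collided ?s. tweight ?s e * real (Suc (tdepth ?s e)))"
  proof (cases "fst f \<in> dom (reached s)")
    case True
    show ?thesis unfolding F(1)[OF True, of "\<lambda>d w. w * real d"] G(1)[OF True, of "\<lambda>d w. w * real (Suc d)"]
      by (simp add: algebra_simps)
  next
    case False
    have "real (dout (fst f)) * (tweight s e / real (dout (fst f)) * real (Suc (tdepth s e))) = tweight s e * real (Suc (tdepth s e))"
      using do[OF False] by simp
    thus ?thesis unfolding F(2)[OF False, of "\<lambda>d w. w * real d"] G(2)[OF False, of "\<lambda>d w. w * real (Suc d)"]
      by (simp add: algebra_simps)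
  qed
  finally show ?thesis using tree_state_reveal[OF b N(1) f] w d c by (simp add: explored_def)
qed

lemma explored_init:
  assumes "x < n" "0 \<le> \<theta>"
  shows "explored x S \<theta> (init x)"
proof -
  have "frontier (init x) = {x} \<times> {..<dout x}" using assms by (auto simp: frontier_def init_def tails_def)
  moreover have "dout x > 0" using deg[OF assms(1)] by simp
  moreover have "(\<Sum>e\<in>{x} \<times> {..<dout x}. tweight (init x) e) = (\<Sum>e\<in>{x} \<times> {..<dout x}. 1 / real (dout x))"
    by (rule sum.cong) (auto simp: tweight_def init_def vweight_def)
  ultimately have "(\<Sum>e\<in>frontier (init x). tweight (init x) e) = 1"
    by (simp add: card_cartesian_product)
  moreover have "0 \<le> (\<Sum>e\<in>frontier (init x). tweight (init x) e * real (tdepth (init x) e))"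
    using tweight_bounds(1)[OF tree_state_init[OF assms(1)]] frontierD by (intro sum_nonneg mult_nonneg_nonneg) (auto simp: less_imp_le)
  ultimately show ?thesis using tree_state_init[OF assms(1)]
    by (simp add: explored_def) (simp add: init_def vdepth_def)
qed

text \<open>This lets the state reached by the complete ball of radius \<open>h\<close> serve as the
  start of the deeper, pruned exploration.\<close>

lemma explored_weaken:
  assumes "explored x S \<theta> s" "S \<le> S'" "\<theta>' \<le> \<theta>"
  shows "explored x S' \<theta>' s"
proof -
  have "\<theta>' * real (card (dom (matched s))) \<le> \<theta> * real (card (dom (matched s)))" using assms by (intro mult_right_mono) auto
  moreover have "vdepth s v \<le> S'" if "v \<in> dom (reached s)" for v using that assms unfolding explored_def by (meson le_trans)
  moreover have "tdepth s e < S'" if "e \<in> collided s" for e using that assms unfolding explored_def by (meson less_le_trans)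
  ultimately show ?thesis using assms unfolding explored_def by (meson order_trans)
qed

text \<open>A total mass of 1 at levels up to \<open>S\<close> has depth-weighted mass at most
  \<open>S\<close>, so at most \<open>S / \<theta>\<close> steps are made.\<close>

lemma explored_card:
  assumes "explored x S \<theta> s" shows "\<theta> * real (card (dom (matched s))) \<le> real S"
proof -
  have b: "tree_state x s" using assms by (simp add: explored_def)
  have w: "e \<in> frontier s \<Longrightarrow> 0 \<le> tweight s e" "e \<in> collided s \<Longrightarrow> 0 \<le> tweight s e" for e
  proof -
    show "e \<in> frontier s \<Longrightarrow> 0 \<le> tweight s e" using tweight_bounds(1)[OF b] frontierD by (auto simp: less_imp_le)
    assume "e \<in> collided s"
    hence "e \<in> dom (matched s)" using tree_stateD(6)[OF b] by auto
    moreover from this have "e \<in> T" using tree_stateD(1)[OF b] by (auto simp: vld_def)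
    ultimately show "0 \<le> tweight s e" using tweight_bounds(1)[OF b] tree_stateD(4)[OF b] by (simp add: less_imp_le)
  qed
  have "\<theta> * real (card (dom (matched s))) \<le> (\<Sum>e\<in>frontier s. tweight s e * real (tdepth s e)) + (\<Sum>e\<in>collided s. tweight s e * real (Suc (tdepth s e)))"
    using assms by (simp add: explored_def)
  also have "\<dots> \<le> (\<Sum>e\<in>frontier s. tweight s e * real S) + (\<Sum>e\<in>collided s. tweight s e * real S)"
  proof (rule add_mono; rule sum_mono; rule mult_left_mono)
    fix e assume e: "e \<in> frontier s"
    thus "real (tdepth s e) \<le> real S" using assms frontierD(2)[OF e] by (simp add: explored_def tdepth_def)
    show "0 \<le> tweight s e" by (rule w(1)[OF e])
  next
    fix e assume e: "e \<in> collided s"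
    thus "real (Suc (tdepth s e)) \<le> real S" using assms unfolding explored_def by (metis Suc_leI of_nat_le_iff)
    show "0 \<le> tweight s e" by (rule w(2)[OF e])
  qed
  also have "\<dots> = real S * ((\<Sum>e\<in>frontier s. tweight s e) + (\<Sum>e\<in>collided s. tweight s e))"
    by (simp add: sum_distrib_left algebra_simps)
  also have "\<dots> = real S" using assms by (simp add: explored_def)
  finally show ?thesis .
qed

lemma card_reached: "tree_state x s \<Longrightarrow> card (dom (reached s)) \<le> Suc (card (dom (matched s)))"
proof -
  assume b: "tree_state x s"
  note fin = tree_state_finite[OF b]
  have "card (dom (reached s)) \<le> card (insert x (hd_of s ` (dom (matched s) - collided s)))"
    using tree_stateD(10)[OF b] fin by (intro card_mono) auto
  also have "\<dots> \<le> Suc (card (hd_of s ` (dom (matched s) - collided s)))" by (rule card_insert_le_m1) auto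
  also have "\<dots> \<le> Suc (card (dom (matched s) - collided s))" using fin by (simp add: card_image_le)
  also have "\<dots> \<le> Suc (card (dom (matched s)))" using fin by (simp add: card_mono)
  finally show ?thesis .
qed

lemma card_coll:
  assumes b: "tree_state x s"
  shows "card {f\<in>H. fst f \<in> dom (reached s)} \<le> D * Suc (card (dom (matched s)))"
proof -
  have "{f\<in>H. fst f \<in> dom (reached s)} \<subseteq> Sigma (dom (reached s)) (\<lambda>i. {..<din i})" by (auto simp: heads_def)
  hence "card {f\<in>H. fst f \<in> dom (reached s)} \<le> card (Sigma (dom (reached s)) (\<lambda>i. {..<din i}))"
    using tree_state_finite[OF b] by (intro card_mono) auto
  also have "\<dots> = (\<Sum>i\<in>dom (reached s). din i)" using tree_state_finite[OF b] by simp
  also have "\<dots> \<le> (\<Sum>i\<in>dom (reached s). D)" by (rule sum_mono) (use deg tree_stateD(2)[OF b] in auto)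
  also have "\<dots> = D * card (dom (reached s))" by simp
  also have "\<dots> \<le> D * Suc (card (dom (matched s)))" by (intro mult_le_mono2 card_reached[OF b])
  finally show ?thesis .
qed

definition explore :: "nat \<Rightarrow> real \<Rightarrow> exploration \<Rightarrow> (pt \<Rightarrow> pt) \<Rightarrow> exploration" where
  "explore S \<theta> s w = run (next_tail S \<theta>) reveal m s w"

lemma next_tail_free: "next_tail S \<theta> s = Some e \<Longrightarrow> e \<in> T - dom (matched s)"
  using next_tail_SomeD(1) frontierD by blast

lemma explored_vld: "explored x S \<theta> s \<Longrightarrow> vld (matched s)"
  by (simp add: explored_def tree_state_def)

text \<open>The invariant is left open since three are used: \<open>explored\<close>,
  \<open>explored\<close> together with \<open>bfs\<close>, and
  \<open>explored_light\<close>.\<close>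

context
  fixes x S :: nat and \<theta> :: real and Inv :: "exploration \<Rightarrow> bool"
  assumes Inv_explored: "\<And>s. Inv s \<Longrightarrow> explored x S \<theta> s"
    and Inv_reveal: "\<And>s e f. Inv s \<Longrightarrow> next_tail S \<theta> s = Some e \<Longrightarrow> f \<in> H - ran (matched s) \<Longrightarrow> Inv (reveal s e f)"
begin

lemma Inv_vld': "Inv s \<Longrightarrow> vld (matched s)"
  using Inv_explored explored_vld by blast

lemma explore_Inv:
  assumes "Inv s" "w \<in> Cyl (matched s)"
  shows "Inv (explore S \<theta> s w)" "w \<in> Cyl (matched (explore S \<theta> s w))" "dom (matched s) \<subseteq> dom (matched (explore S \<theta> s w))"
proof -
  have "Inv (explore S \<theta> s w) \<and> w \<in> Cyl (matched (explore S \<theta> s w)) \<and> dom (matched s) \<subseteq> dom (matched (explore S \<theta> s w))"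
    unfolding explore_def
    by (rule run_Inv[of Inv matched "next_tail S \<theta>" reveal]) (use Inv_vld' next_tail_free Inv_reveal matched_reveal assms in blast)+
  thus "Inv (explore S \<theta> s w)" "w \<in> Cyl (matched (explore S \<theta> s w))" "dom (matched s) \<subseteq> dom (matched (explore S \<theta> s w))"
    by blast+
qed

lemma explore_det:
  assumes "Inv s" "w \<in> Cyl (matched s)" "w' \<in> Om" "\<forall>e\<in>dom (matched (explore S \<theta> s w)). w' e = w e"
  shows "explore S \<theta> s w' = explore S \<theta> s w"
  unfolding explore_def
  by (rule run_det[of Inv matched "next_tail S \<theta>" reveal]) (use Inv_vld' next_tail_free Inv_reveal matched_reveal assms[unfolded explore_def] in blast)+

lemma explore_final:
  assumes "Inv s" "w \<in> Cyl (matched s)"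
  shows "eligible S \<theta> (explore S \<theta> s w) = {}"
  unfolding explore_def next_tail_None[symmetric]
  by (rule run_final[of Inv matched "next_tail S \<theta>" reveal]) (use Inv_vld' next_tail_free Inv_reveal matched_reveal assms le_add1 in blast)+

lemma explore_supermartingale:
  assumes Phi: "\<And>s e. Inv s \<Longrightarrow> next_tail S \<theta> s = Some e \<Longrightarrow>
      (\<Sum>f\<in>H - ran (matched s). Phi (reveal s e f)) \<le> real (card (H - ran (matched s))) * Phi s"
    and "Inv s"
  shows "avg (matched s) (\<lambda>w. Phi (explore S \<theta> s w)) \<le> Phi s"
  unfolding explore_def
  by (rule run_supermartingale[of Inv matched "next_tail S \<theta>" reveal]) (use Inv_vld' next_tail_free Inv_reveal matched_reveal assms in blast)+

end

subsection \<open>Coinciding paths\<close>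

primrec path_from :: "(pt \<Rightarrow> pt) \<Rightarrow> nat \<Rightarrow> pt list \<Rightarrow> bool" where
  "path_from w v [] \<longleftrightarrow> True"
| "path_from w v (e # es) \<longleftrightarrow> e \<in> T \<and> fst e = v \<and> path_from w (tgt w e) es"

primrec path_end :: "(pt \<Rightarrow> pt) \<Rightarrow> nat \<Rightarrow> pt list \<Rightarrow> nat" where
  "path_end w v [] = v"
| "path_end w v (e # es) = path_end w (tgt w e) es"

lemma path_from_append: "path_from w v (as @ bs) \<longleftrightarrow> path_from w v as \<and> path_from w (path_end w v as) bs"
  by (induction as arbitrary: v) auto

lemma path_end_append: "path_end w v (as @ bs) = path_end w (path_end w v as) bs"
  by (induction as arbitrary: v) auto

text \<open>A path inside \<open>A\<close> can be read backwards from its end: injectivity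
  determines the last tail, and since no tail of \<open>A\<close> leads to \<open>x\<close>, both
  paths are exhausted simultaneously.\<close>

lemma paths_unique:
  assumes "inj_on (tgt w) A" "x \<notin> tgt w ` A"
    and "path_from w x as" "path_from w x bs" "set as \<subseteq> A" "set bs \<subseteq> A" "path_end w x as = path_end w x bs"
  shows "as = bs"
  using assms(3-)
proof (induction as arbitrary: bs rule: rev_induct)
  case Nil
  show ?case
  proof (cases bs rule: rev_cases)
    case (snoc cs b)
    hence "x = tgt w b" "b \<in> A" using Nil by (auto simp: path_end_append)
    thus ?thesis using assms(2) by blast
  qed simp
next
  case (snoc a as)
  show ?case
  proof (cases bs rule: rev_cases)
    case Nil
    hence "x = tgt w a" "a \<in> A" using snoc.prems by (auto simp: path_end_append)
    thus ?thesis using assms(2) by blast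
  next
    case (snoc cs b)
    have "tgt w a = tgt w b" "a \<in> A" "b \<in> A" using snoc.prems snoc by (auto simp: path_end_append)
    hence ab: "a = b" using assms(1) by (simp add: inj_on_def)
    have "as = cs" using snoc.prems snoc ab by (intro snoc.IH) (auto simp: path_from_append)
    thus ?thesis using ab snoc by simp
  qed
qed

text \<open>The two paths may differ in length and one may be empty, so a short cycle through
  \<open>v\<close> counts as well. The comparison of different lengths is used in
  \<open>not_Bad_back_heads\<close>.\<close>

definition Bad :: "(pt \<Rightarrow> pt) \<Rightarrow> nat \<Rightarrow> nat \<Rightarrow> bool" where
  "Bad w h v \<longleftrightarrow> (\<exists>as bs. path_from w v as \<and> path_from w v bs \<and> as \<noteq> bs \<and> length as \<le> h \<and> length bs \<le> h \<and> path_end w v as = path_end w v bs)"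

lemma Bad_mono: "Bad w h v \<Longrightarrow> h \<le> h' \<Longrightarrow> Bad w h' v"
  unfolding Bad_def by (meson le_trans)

lemma Bad_Cons: "e \<in> T \<Longrightarrow> Bad w h (tgt w e) \<Longrightarrow> Bad w (Suc h) (fst e)"
  unfolding Bad_def
proof (elim exE conjE)
  fix as bs
  assume "e \<in> T" "path_from w (tgt w e) as" "path_from w (tgt w e) bs" "as \<noteq> bs" "length as \<le> h" "length bs \<le> h"
    "path_end w (tgt w e) as = path_end w (tgt w e) bs"
  thus "\<exists>as bs. path_from w (fst e) as \<and> path_from w (fst e) bs \<and> as \<noteq> bs \<and> length as \<le> Suc h \<and> length bs \<le> Suc h \<and>
      path_end w (fst e) as = path_end w (fst e) bs"
    by (intro exI[of _ "e # as"] exI[of _ "e # bs"]) simp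
qed

lemma hd_of_Cyl: "w \<in> Cyl (matched s) \<Longrightarrow> e \<in> dom (matched s) \<Longrightarrow> hd_of s e = tgt w e"
  unfolding hd_of_def by (metis CylD domD option.sel)

lemma tree_state_inj:
  assumes "tree_state x s" "w \<in> Cyl (matched s)"
  shows "inj_on (tgt w) (dom (matched s) - collided s)" "x \<notin> tgt w ` (dom (matched s) - collided s)"
proof -
  have eq: "\<And>e. e \<in> dom (matched s) - collided s \<Longrightarrow> hd_of s e = tgt w e" using hd_of_Cyl[OF assms(2)] by blast
  show "inj_on (tgt w) (dom (matched s) - collided s)" 
  proof (rule inj_onI)
    fix a b assume ab: "a \<in> dom (matched s) - collided s" "b \<in> dom (matched s) - collided s" "tgt w a = tgt w b"
    hence "hd_of s a = hd_of s b" using eq by simp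
    thus "a = b" using tree_stateD(8)[OF assms(1)] ab(1,2) by (simp only: inj_on_def)
  qed
  show "x \<notin> tgt w ` (dom (matched s) - collided s)" 
  proof
    assume "x \<in> tgt w ` (dom (matched s) - collided s)"
    then obtain a where a: "a \<in> dom (matched s) - collided s" "x = tgt w a" by blast
    hence "x = hd_of s a" using eq by simp
    thus False using tree_stateD(9)[OF assms(1)] a(1) by blast
  qed
qed

text \<open>The weight is the probability of one particular path of length
  \<open>vdepth s v\<close>, hence a lower bound for the transition probability. The induction goes
  up the tree edge by which \<open>v\<close> was discovered.\<close>

lemma seen_path_aux:
  assumes b: "tree_state x s" and w: "w \<in> Cyl (matched s)" and v: "v \<in> dom (reached s)"
  shows "(\<exists>as. path_from w x as \<and> set as \<subseteq> dom (matched s) - collided s \<and> path_end w x as = v \<and> length as = vdepth s v)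
    \<and> vweight s v \<le> P w (vdepth s v) x v"
  using v
proof (induction "vdepth s v" arbitrary: v)
  case 0
  have "v = x"
  proof (rule ccontr)
    assume "v \<noteq> x"
    then obtain e where e: "e \<in> dom (matched s)" "e \<notin> collided s" "v = hd_of s e" using tree_stateD(10)[OF b] 0(2) by blast
    hence "vdepth s v = Suc (tdepth s e)" using tree_stateD(7)[OF b, of e] by (simp add: vdepth_def)
    thus False using 0 by simp
  qed
  moreover have "vdepth s x = 0" "vweight s x = 1" using tree_stateD(3)[OF b] by (auto simp: vdepth_def vweight_def)
  ultimately show ?case by (auto intro: exI[of _ "[]"])
next
  case (Suc d)
  have "vdepth s x = 0" using tree_stateD(3)[OF b] by (auto simp: vdepth_def)
  hence "v \<noteq> x" using Suc by auto
  then obtain e where e: "e \<in> dom (matched s)" "e \<notin> collided s" "v = hd_of s e" using tree_stateD(10)[OF b] Suc.prems by blast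
  have sv: "vdepth s v = Suc (vdepth s (fst e))" "vweight s v = tweight s e" using tree_stateD(7)[OF b e(1,2)] e(3) by (simp_all add: vdepth_def vweight_def tdepth_def)
  have d: "d = vdepth s (fst e)" using sv Suc by simp
  have fe: "fst e \<in> dom (reached s)" using tree_stateD(4)[OF b e(1)] .
  have te: "tgt w e = v" using hd_of_Cyl[OF w e(1)] e(3) by simp
  have eT: "e \<in> T" using tree_stateD(1)[OF b] e(1) by (auto simp: vld_def)
  obtain as where as: "path_from w x as" "set as \<subseteq> dom (matched s) - collided s" "path_end w x as = fst e" "length as = vdepth s (fst e)"
    using Suc.hyps(1)[OF d fe] by blast
  have A: "\<exists>as. path_from w x as \<and> set as \<subseteq> dom (matched s) - collided s \<and> path_end w x as = v \<and> length as = vdepth s v"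
    by (rule exI[of _ "as @ [e]"]) (use as e eT te sv in \<open>auto simp: path_from_append path_end_append\<close>)
  have wO: "w \<in> Om" using w by (simp add: Cyl_def)
  have n: "fst e < n" using T_fst[OF eT] .
  have dp: "dout (fst e) > 0" using deg[OF n] by simp
  have "1 / real (dout (fst e)) \<le> trans dout w (fst e) v"
  proof -
    have "snd e \<in> {k. k < dout (fst e) \<and> fst (w (fst e, k)) = v}" using eT te by (cases e) (auto simp: tails_def)
    hence "0 < card {k. k < dout (fst e) \<and> fst (w (fst e, k)) = v}" by (subst card_gt_0_iff) auto
    thus ?thesis unfolding trans_def by (intro divide_right_mono) auto
  qed
  hence "vweight s (fst e) * (1 / real (dout (fst e))) \<le> P w (vdepth s (fst e)) x (fst e) * trans dout w (fst e) v"
    using Suc.hyps(1)[OF d fe] tree_stateD(11)[OF b fe] by (intro mult_mono P_nonneg) auto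
  also have "\<dots> \<le> (\<Sum>k<n. P w (vdepth s (fst e)) x k * trans dout w k v)"
    by (rule member_le_sum) (auto simp: n P_nonneg trans_nonneg)
  finally have "vweight s v \<le> P w (vdepth s v) x v" by (simp add: sv tweight_def)
  thus ?case using A by blast
qed

lemmas seen_path = seen_path_aux[THEN conjunct1] seen_path_aux[THEN conjunct2]

text \<open>The tree path to the vertex of a collided tail, prolonged by that tail, ends where
  another tree path ends. The two differ because tree paths avoid collided tails.\<close>

lemma coll_Bad:
  assumes i: "explored x S \<theta> s" and w: "w \<in> Cyl (matched s)" and c: "collided s \<noteq> {}"
  shows "Bad w S x"
proof -
  have b: "tree_state x s" using i by (simp add: explored_def)
  obtain e where e: "e \<in> collided s" using c by blast
  have em: "e \<in> dom (matched s)" using tree_stateD(6)[OF b] e by blast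
  have fe: "fst e \<in> dom (reached s)" and he: "tgt w e \<in> dom (reached s)" using tree_stateD(4,5)[OF b em] hd_of_Cyl[OF w em] by auto
  have eT: "e \<in> T" using tree_stateD(1)[OF b] em by (auto simp: vld_def)
  obtain as where as: "path_from w x as" "path_end w x as = fst e" "length as = vdepth s (fst e)"
    using seen_path(1)[OF b w fe] by blast
  obtain bs where bs: "path_from w x bs" "set bs \<subseteq> dom (matched s) - collided s" "path_end w x bs = tgt w e" "length bs = vdepth s (tgt w e)"
    using seen_path(1)[OF b w he] by blast
  have "as @ [e] \<noteq> bs" using bs(2) e by auto
  moreover have "Suc (vdepth s (fst e)) \<le> S" "vdepth s (tgt w e) \<le> S" using i e he by (auto simp: explored_def tdepth_def)
  ultimately show ?thesis unfolding Bad_def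
    by (intro exI[of _ "as @ [e]"] exI[of _ bs]) (use as bs eT in \<open>auto simp: path_from_append path_end_append\<close>)
qed

text \<open>Recorded depths must not exceed the length of other paths. The second clause says so for
  collided tails too; it is preserved because of the first, by which reached vertices lie at most
  one level below any frontier vertex.\<close>

definition bfs :: "exploration \<Rightarrow> bool" where
  "bfs s \<longleftrightarrow> (\<forall>v\<in>dom (reached s). \<forall>e\<in>frontier s. vdepth s v \<le> Suc (tdepth s e)) \<and> (\<forall>e\<in>dom (matched s). vdepth s (hd_of s e) \<le> Suc (tdepth s e))"

lemma bfs_init: "bfs (init x)"
  by (auto simp: bfs_def init_def vdepth_def)

text \<open>Weights at depth below \<open>S\<close> are at least \<open>(1 / real D) ^ S\<close>, so
  with such a threshold only the depth cutoff is effective and a complete ball is explored.\<close>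

lemma eligible_all:
  assumes "tree_state x s" "\<theta> \<le> (1 / real D) ^ S" "e \<in> frontier s" "tdepth s e < S"
  shows "e \<in> eligible S \<theta> s"
proof -
  have "(1 / real D) ^ S \<le> (1 / real D) ^ Suc (tdepth s e)"
    using assms(4) D_ge by (intro power_decreasing) auto
  also have "\<dots> \<le> tweight s e" using tweight_bounds(3)[OF assms(1)] frontierD assms(3) by blast
  finally show ?thesis using assms by (simp add: eligible_def)
qed

lemma bfs_reveal:
  assumes i: "explored x S \<theta> s" and bf: "bfs s" and th: "\<theta> \<le> (1 / real D) ^ S"
    and nxe: "next_tail S \<theta> s = Some e" and f: "f \<in> H - ran (matched s)"
  shows "bfs (reveal s e f)"
proof -
  let ?s = "reveal s e f"
  have b: "tree_state x s" using i by (simp add: explored_def)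
  note N = next_tail_SomeD[OF nxe]
  have fH: "f \<in> H" using f by auto
  have es: "fst e \<in> dom (reached s)" using frontierD(2)[OF N(1)] .
  have min: "tdepth s e \<le> tdepth s e'" if "e' \<in> frontier s" for e'
    using N(4)[OF eligible_all[OF b th that]] N(2) by (cases "tdepth s e' < S") auto
  have seen: "vdepth s v \<le> Suc (tdepth s e)" if "v \<in> dom (reached s)" for v using bf N(1) that by (auto simp: bfs_def)
  have seen': "vdepth ?s v \<le> Suc (tdepth s e)" if "v \<in> dom (reached ?s)" for v
  proof (cases "v \<in> dom (reached s)")
    case True thus ?thesis using seen by (simp add: vdepth_reveal_old)
  next
    case False
    hence "v = fst f" "fst f \<notin> dom (reached s)" using that by (auto simp: dom_reached_reveal)
    thus ?thesis by (simp add: vdepth_def reached_reveal)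
  qed
  have fr: "tdepth s e \<le> tdepth ?s e'" if e': "e' \<in> frontier ?s" for e'
  proof (cases "fst e' \<in> dom (reached s)")
    case True
    hence "e' \<in> frontier s" using e' by (auto simp: frontier_def matched_reveal)
    thus ?thesis using min True by (simp add: tdepth_reveal_old)
  next
    case False
    hence "fst e' = fst f" "fst f \<notin> dom (reached s)" using frontierD(2)[OF e'] by (auto simp: dom_reached_reveal)
    thus ?thesis by (simp add: tdepth_reveal_new)
  qed
  show ?thesis unfolding bfs_def
  proof (intro conjI ballI)
    fix v e' assume "v \<in> dom (reached ?s)" "e' \<in> frontier ?s"
    thus "vdepth ?s v \<le> Suc (tdepth ?s e')" using seen' fr by (meson Suc_le_mono le_trans)
  next
    fix e' assume e': "e' \<in> dom (matched ?s)"
    show "vdepth ?s (hd_of ?s e') \<le> Suc (tdepth ?s e')"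
    proof (cases "e' = e")
      case True
      thus ?thesis using seen'[of "fst f"] es by (simp add: hd_of_reveal_new dom_reached_reveal tdepth_reveal_old)
    next
      case False
      hence em: "e' \<in> dom (matched s)" using e' by (simp add: matched_reveal)
      show ?thesis using bf em tree_stateD(4,5)[OF b em] False by (simp add: hd_of_reveal_old vdepth_reveal_old tdepth_reveal_old bfs_def)
    qed
  qed
qed

text \<open>Along a path the recorded depth never exceeds the number of steps made, so each further
  tail of the path lies at depth below \<open>S\<close> and would still be eligible if it were not
  revealed.\<close>

lemma cover:
  assumes i: "explored x S \<theta> s" and bf: "bfs s" and th: "\<theta> \<le> (1 / real D) ^ S" and fin: "eligible S \<theta> s = {}"
    and w: "w \<in> Cyl (matched s)" and "path_from w x as" "length as \<le> S"
  shows "set as \<subseteq> dom (matched s) \<and> path_end w x as \<in> dom (reached s) \<and> vdepth s (path_end w x as) \<le> length as"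
  using assms(6-)
proof (induction as rule: rev_induct)
  case Nil
  thus ?case using i by (auto simp: explored_def tree_state_def vdepth_def)
next
  case (snoc e as)
  have b: "tree_state x s" using i by (simp add: explored_def)
  have IH: "set as \<subseteq> dom (matched s)" "path_end w x as \<in> dom (reached s)" "vdepth s (path_end w x as) \<le> length as"
    using snoc by (auto simp: path_from_append)
  have e: "e \<in> T" "fst e = path_end w x as" using snoc.prems by (auto simp: path_from_append)
  have tdepth: "tdepth s e \<le> length as" using IH e by (simp add: tdepth_def)
  have em: "e \<in> dom (matched s)"
  proof (rule ccontr)
    assume "e \<notin> dom (matched s)"
    hence "e \<in> frontier s" using e IH by (simp add: frontier_def)
    hence "e \<in> eligible S \<theta> s" using eligible_all[OF b th] tdepth snoc.prems by simp
    thus False using fin by simp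
  qed
  have "hd_of s e \<in> dom (reached s)" "vdepth s (hd_of s e) \<le> Suc (tdepth s e)" using em tree_stateD(5)[OF b em] bf by (auto simp: bfs_def)
  thus ?case using hd_of_Cyl[OF w em] IH em tdepth by (auto simp: path_end_append)
qed

text \<open>Converse of \<open>coll_Bad\<close> for complete balls: without collisions all short
  paths run inside the tree, where the end determines the path.\<close>

lemma Bad_coll:
  assumes i: "explored x S \<theta> s" and bf: "bfs s" and th: "\<theta> \<le> (1 / real D) ^ S" and fin: "eligible S \<theta> s = {}"
    and w: "w \<in> Cyl (matched s)" and bad: "Bad w S x"
  shows "1 \<le> card (collided s)"
proof (rule ccontr)
  have b: "tree_state x s" using i by (simp add: explored_def)
  assume "\<not> 1 \<le> card (collided s)"
  hence c: "collided s = {}" using tree_state_finite(3)[OF b] by (auto simp: Suc_le_eq card_gt_0_iff)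
  obtain as bs where ab: "path_from w x as" "path_from w x bs" "as \<noteq> bs" "length as \<le> S" "length bs \<le> S" "path_end w x as = path_end w x bs"
    using bad unfolding Bad_def by blast
  have "as = bs"
    using paths_unique[OF tree_state_inj[OF b w] ab(1,2) _ _ ab(6)] cover[OF i bf th fin w ab(1,4)] cover[OF i bf th fin w ab(2,5)] c by simp
  thus False using ab by simp
qed

text \<open>Removing a single tail cannot destroy two pairs of coinciding paths whose first tails differ: both
  pairs would have to use that tail, and the initial segments before it would be two different paths to its vertex.\<close>
lemma two_Bad_coll:
  assumes i: "explored x (Suc h) \<theta> s" and bf: "bfs s" and th: "\<theta> \<le> (1 / real D) ^ Suc h" and fin: "eligible (Suc h) \<theta> s = {}"
    and w: "w \<in> Cyl (matched s)"
    and e1: "e1 \<in> T" "fst e1 = x" "Bad w h (tgt w e1)" and e2: "e2 \<in> T" "fst e2 = x" "Bad w h (tgt w e2)" and ne: "e1 \<noteq> e2"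
  shows "2 \<le> card (collided s)"
proof (rule ccontr)
  have b: "tree_state x s" using i by (simp add: explored_def)
  assume "\<not> 2 \<le> card (collided s)"
  hence "card (collided s) \<le> Suc 0" by simp
  then obtain a where a: "collided s \<subseteq> {a}" using tree_state_finite(3)[OF b] by (metis card_le_Suc0_iff_eq singletonI subsetI insert_subset empty_subsetI)
  let ?A = "dom (matched s) - {a}"
  have A: "inj_on (tgt w) ?A" "x \<notin> tgt w ` ?A"
    using tree_state_inj[OF b w] a by (auto elim: inj_on_subset)
  have split: "\<exists>ps. path_from w x ps \<and> set ps \<subseteq> ?A \<and> path_end w x ps = fst a \<and> (ps = [] \<longrightarrow> e = a) \<and> (ps \<noteq> [] \<longrightarrow> hd ps = e)"
    if e: "e \<in> T" "fst e = x" "Bad w h (tgt w e)" for e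
  proof -
    obtain as bs where ab: "path_from w (tgt w e) as" "path_from w (tgt w e) bs" "as \<noteq> bs" "length as \<le> h" "length bs \<le> h"
        "path_end w (tgt w e) as = path_end w (tgt w e) bs"
      using e(3) unfolding Bad_def by blast
    have p: "path_from w x (e # as)" "path_from w x (e # bs)" "length (e # as) \<le> Suc h" "length (e # bs) \<le> Suc h"
      "path_end w x (e # as) = path_end w x (e # bs)" using ab e by auto
    have c: "set (e # as) \<subseteq> dom (matched s)" "set (e # bs) \<subseteq> dom (matched s)"
      using cover[OF i bf th fin w p(1,3)] cover[OF i bf th fin w p(2,4)] by blast+
    have "a \<in> set (e # as) \<or> a \<in> set (e # bs)"
    proof (rule ccontr)
      assume "\<not> ?thesis"
      hence "set (e # as) \<subseteq> ?A" "set (e # bs) \<subseteq> ?A" using c by auto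
      from paths_unique[OF A p(1,2) this p(5)] ab(3) show False by simp
    qed
    then obtain cs where cs: "a \<in> set (e # cs)" "path_from w x (e # cs)" "set (e # cs) \<subseteq> dom (matched s)" using p c by blast
    obtain ps qs where pq: "e # cs = ps @ a # qs" "a \<notin> set ps" using split_list_first[OF cs(1)] by blast
    have "path_from w x (ps @ a # qs)" using cs pq by simp
    hence "path_from w x ps" "path_end w x ps = fst a" by (auto simp: path_from_append)
    moreover have "set ps \<subseteq> ?A" using cs(3) pq by auto
    moreover have "ps = [] \<longrightarrow> e = a" "ps \<noteq> [] \<longrightarrow> hd ps = e" using pq(1) by (cases ps; auto)+
    ultimately show ?thesis by blast
  qed
  obtain ps where ps: "path_from w x ps" "set ps \<subseteq> ?A" "path_end w x ps = fst a" "ps = [] \<longrightarrow> e1 = a" "ps \<noteq> [] \<longrightarrow> hd ps = e1"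
    using split[OF e1] by blast
  obtain qs where qs: "path_from w x qs" "set qs \<subseteq> ?A" "path_end w x qs = fst a" "qs = [] \<longrightarrow> e2 = a" "qs \<noteq> [] \<longrightarrow> hd qs = e2"
    using split[OF e2] by blast
  have "ps = qs" by (rule paths_unique[OF A ps(1) qs(1) ps(2) qs(2)]) (simp add: ps qs)
  \<comment> \<open>If the common initial segment is empty, both \<open>e1\<close> and
    \<open>e2\<close> equal the removed tail; otherwise both are its first tail.\<close>
  thus False using ps qs ne by (cases "ps = []") auto
qed

section \<open>Probability of one and of two collisions\<close>

lemma explored_bound:
  assumes "explored x S \<theta> s" "0 < \<theta>" shows "real (card (dom (matched s))) \<le> real S / \<theta>"
  using explored_card[OF assms(1)] assms(2) by (simp add: field_simps)

text \<open>Here \<open>q\<close> bounds the conditional collision probability at every step: at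
  most \<open>S / \<theta> + 1\<close> vertices are reached, each has at most \<open>D\<close>
  heads, and at least \<open>m - S / \<theta>\<close> heads are free.\<close>

lemma coll_le:
  assumes i: "explored x S \<theta> s" and th: "0 < \<theta>" and K: "real S / \<theta> < real m"
    and q: "real D * (real S / \<theta> + 1) \<le> q * (real m - real S / \<theta>)" "0 \<le> q"
  shows "real (card {f \<in> H - ran (matched s). fst f \<in> dom (reached s)}) \<le> q * real (card (H - ran (matched s)))"
    and "real (card {f \<in> H. fst f \<in> dom (reached s)}) \<le> real D * (real S / \<theta> + 1)"
    and "real m - real S / \<theta> \<le> real (card (H - ran (matched s)))"
proof -
  have b: "tree_state x s" using i by (simp add: explored_def)
  have k: "real (card (dom (matched s))) \<le> real S / \<theta>" by (rule explored_bound[OF i th])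
  have "real (card {f \<in> H. fst f \<in> dom (reached s)}) \<le> real (D * Suc (card (dom (matched s))))"
    using card_coll[OF b] by (simp only: of_nat_le_iff)
  also have "\<dots> \<le> real D * (real S / \<theta> + 1)" using mult_left_mono[of "real (card (dom (matched s))) + 1" "real S / \<theta> + 1" "real D"] k by (simp add: algebra_simps)
  finally show c: "real (card {f \<in> H. fst f \<in> dom (reached s)}) \<le> real D * (real S / \<theta> + 1)" .
  have v: "vld (matched s)" by (rule tree_stateD(1)[OF b])
  show U: "real m - real S / \<theta> \<le> real (card (H - ran (matched s)))"
    using k card_free(1,3)[OF v] by (simp add: of_nat_diff)
  have "card {f \<in> H - ran (matched s). fst f \<in> dom (reached s)} \<le> card {f \<in> H. fst f \<in> dom (reached s)}"
    by (intro card_mono) auto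
  hence "real (card {f \<in> H - ran (matched s). fst f \<in> dom (reached s)}) \<le> real D * (real S / \<theta> + 1)" using c by linarith
  also have "\<dots> \<le> q * real (card (H - ran (matched s)))"
    using q U by (meson mult_left_mono order_trans)
  finally show "real (card {f \<in> H - ran (matched s). fst f \<in> dom (reached s)}) \<le> q * real (card (H - ran (matched s)))" .
qed

text \<open>With at most \<open>K\<close> steps and chance \<open>q\<close> each, the number of
  collisions has the tail of a binomial count. The supermartingale is \<open>z\<close> to the number
  of collisions times an exponential factor that pays \<open>z * q\<close> per remaining step; the
  choice \<open>z = 1 / \<kappa>\<close> and \<open>q * K \<le> \<kappa>\<close> leave the constant
  \<open>exp 1\<close>.\<close>

lemma coll_prob:
  assumes x: "x < n" and th: "0 < \<theta>" and K: "real S / \<theta> < real m"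
    and \<kappa>: "real D * (real S / \<theta> + 1) * (real S / \<theta>) \<le> \<kappa> * (real m - real S / \<theta>)" "0 < \<kappa>" "\<kappa> \<le> 1"
  shows "pr (\<lambda>w. j \<le> card (collided (explore S \<theta> (init x) w))) \<le> exp 1 * \<kappa> ^ j"
proof -
  define K where "K = real S / \<theta>"
  define q where "q = real D * (K + 1) / (real m - K)"
  define z where "z = 1 / \<kappa>"
  have mK: "real m - K > 0" using assms(3) by (simp add: K_def)
  have K0: "0 \<le> K" using th by (simp add: K_def)
  have q0: "0 \<le> q" using mK K0 by (simp add: q_def)
  have qK: "q * K \<le> \<kappa>" using \<kappa>(1) mK by (simp add: q_def K_def[symmetric] divide_simps)
  have z1: "1 \<le> z" using \<kappa> by (simp add: z_def)
  define Phi where "Phi s = z ^ card (collided s) * exp (z * q * (K - real (card (dom (matched s)))))" for s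
  have step: "(\<Sum>f\<in>H - ran (matched s). Phi (reveal s e f)) \<le> real (card (H - ran (matched s))) * Phi s"
    if i: "explored x S \<theta> s" and nxe: "next_tail S \<theta> s = Some e" for s e
  proof -
    have b: "tree_state x s" using i by (simp add: explored_def)
    let ?F = "H - ran (matched s)"
    let ?c = "card {f \<in> ?F. fst f \<in> dom (reached s)}"
    have e: "e \<in> T - dom (matched s)" by (rule next_tail_free[OF nxe])
    have ecl: "e \<notin> collided s" using e tree_stateD(6)[OF b] by auto
    have cd: "card (dom (matched (reveal s e f))) = Suc (card (dom (matched s)))" for f
      using e tree_state_finite(1)[OF b] by (simp add: matched_reveal)
    define B where "B = z ^ card (collided s) * exp (z * q * (K - real (Suc (card (dom (matched s))))))"
    have B0: "0 \<le> B" using z1 by (simp add: B_def)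
    have ph: "Phi (reveal s e f) = B * (if fst f \<in> dom (reached s) then z else 1)" for f
      using ecl tree_state_finite(3)[OF b] unfolding Phi_def cd B_def by (simp add: collided_reveal)
    have "(\<Sum>f\<in>?F. Phi (reveal s e f)) = B * (\<Sum>f\<in>?F. if fst f \<in> dom (reached s) then z else 1)"
      by (simp add: ph sum_distrib_left)
    also have "(\<Sum>f\<in>?F. if fst f \<in> dom (reached s) then z else 1) \<le> (\<Sum>f\<in>?F. 1 + (if fst f \<in> dom (reached s) then z else 0))"
      by (rule sum_mono) auto
    also have "\<dots> = real (card ?F) + z * real ?c"
      by (simp add: sum.distrib sum.If_cases Int_def conj_commute)
    also have "\<dots> \<le> real (card ?F) + z * (q * real (card ?F))"
      using z1 coll_le(1)[OF i th assms(3), of q] q0 mK by (intro add_left_mono mult_left_mono) (auto simp: q_def K_def)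
    also have "\<dots> = real (card ?F) * (1 + z * q)" by (simp add: algebra_simps)
    also have "\<dots> \<le> real (card ?F) * exp (z * q)" by (intro mult_left_mono exp_ge_add_one_self) auto
    finally have "(\<Sum>f\<in>?F. Phi (reveal s e f)) \<le> B * (real (card ?F) * exp (z * q))" using B0 by (simp add: mult_left_mono)
    also have "\<dots> = real (card ?F) * Phi s"
      unfolding B_def Phi_def by (simp add: exp_add[symmetric] algebra_simps)
    finally show ?thesis .
  qed
  have i0: "explored x S \<theta> (init x)" using x th by (intro explored_init) auto
  have m0: "matched (init x) = Map.empty" "collided (init x) = {}" by (auto simp: init_def)
  have "avg (matched (init x)) (\<lambda>w. Phi (explore S \<theta> (init x) w)) \<le> Phi (init x)"
    by (rule explore_supermartingale[of "explored x S \<theta>" x S \<theta>]) (use explored_reveal step i0 in blast)+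
  also have "\<dots> = exp (z * (q * K))" by (simp add: Phi_def m0)
  also have "\<dots> \<le> exp 1" using qK \<kappa> by (simp add: z_def)
  finally have E: "avg Map.empty (\<lambda>w. Phi (explore S \<theta> (init x) w)) \<le> exp 1" by (simp add: m0)
  have "pr (\<lambda>w. j \<le> card (collided (explore S \<theta> (init x) w))) \<le> exp 1 / z ^ j"
    unfolding pr_def
  proof (rule markov_avg[OF _ _ _ E])
    fix w assume w: "w \<in> Cyl Map.empty"
    let ?s = "explore S \<theta> (init x) w"
    have "explored x S \<theta> ?s"
      by (rule explore_Inv(1)[of "explored x S \<theta>" x S \<theta>]) (use explored_reveal i0 w m0 in \<open>metis | blast\<close>)+
    hence "real (card (dom (matched ?s))) \<le> K" unfolding K_def using explored_bound th by blast
    hence ge: "1 \<le> exp (z * q * (K - real (card (dom (matched ?s)))))" using z1 q0 by simp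
    show "0 \<le> Phi ?s" using z1 by (simp add: Phi_def)
    assume j: "j \<le> card (collided ?s)"
    have "z ^ j * 1 \<le> Phi ?s" unfolding Phi_def using z1 j ge
      by (intro mult_mono power_increasing) auto
    thus "z ^ j \<le> Phi ?s" by simp
  qed (use z1 in auto)
  thus ?thesis by (simp add: z_def power_one_over)
qed

lemma explore_ball:
  assumes x: "x < n" and th: "0 < \<theta>" "\<theta> \<le> (1 / real D) ^ S" and w: "w \<in> Om"
  defines "s \<equiv> explore S \<theta> (init x) w"
  shows "explored x S \<theta> s" "bfs s" "eligible S \<theta> s = {}" "w \<in> Cyl (matched s)"
proof -
  have i0: "explored x S \<theta> (init x) \<and> bfs (init x)" using x th explored_init bfs_init by auto
  have w0: "w \<in> Cyl (matched (init x))" using w by (simp add: init_def)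
  have st: "\<And>s e f. explored x S \<theta> s \<and> bfs s \<Longrightarrow> next_tail S \<theta> s = Some e \<Longrightarrow> f \<in> H - ran (matched s) \<Longrightarrow> explored x S \<theta> (reveal s e f) \<and> bfs (reveal s e f)"
    using explored_reveal bfs_reveal th(2) by blast
  have "explored x S \<theta> s \<and> bfs s" unfolding s_def
    by (rule explore_Inv(1)[of "\<lambda>s. explored x S \<theta> s \<and> bfs s" x S \<theta>]) (use st i0 w0 in blast)+
  thus "explored x S \<theta> s" "bfs s" by auto
  show "eligible S \<theta> s = {}" unfolding s_def
    by (rule explore_final[of "\<lambda>s. explored x S \<theta> s \<and> bfs s" x S \<theta>]) (use st i0 w0 in blast)+
  show "w \<in> Cyl (matched s)" unfolding s_def
    by (rule explore_Inv(2)[of "\<lambda>s. explored x S \<theta> s \<and> bfs s" x S \<theta>]) (use st i0 w0 in blast)+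
qed

text \<open>The hypotheses of \<open>coll_prob\<close> for the threshold
  \<open>(1 / real D) ^ S\<close>, for which the step bound \<open>S / \<theta>\<close> becomes
  \<open>S * D ^ S\<close>.\<close>

definition ball_cond :: "nat \<Rightarrow> real \<Rightarrow> bool" where
  "ball_cond S \<kappa> \<longleftrightarrow> real S * real D ^ S < real m \<and>
    real D * (real S * real D ^ S + 1) * (real S * real D ^ S) \<le> \<kappa> * (real m - real S * real D ^ S) \<and> 0 < \<kappa> \<and> \<kappa> \<le> 1"

lemma ball_coll_prob:
  assumes "x < n" "ball_cond S \<kappa>"
  shows "pr (\<lambda>w. j \<le> card (collided (explore S ((1 / real D) ^ S) (init x) w))) \<le> exp 1 * \<kappa> ^ j"
  by (rule coll_prob) (use assms D_ge in \<open>auto simp: ball_cond_def power_one_over\<close>)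

lemma Bad_prob:
  assumes "x < n" "ball_cond S \<kappa>"
  shows "pr (\<lambda>w. Bad w S x) \<le> exp 1 * \<kappa>"
proof -
  let ?t = "(1 / real D) ^ S"
  have t: "0 < ?t" "?t \<le> ?t" using D_ge by auto
  have "pr (\<lambda>w. Bad w S x) \<le> pr (\<lambda>w. 1 \<le> card (collided (explore S ?t (init x) w)))"
    by (rule pr_mono) (use Bad_coll explore_ball[OF assms(1) t] in blast)
  also have "\<dots> \<le> exp 1 * \<kappa> ^ 1" by (rule ball_coll_prob[OF assms])
  finally show ?thesis by simp
qed

text \<open>Two bad neighbours force two collisions in the ball of radius \<open>Suc h\<close>. The
  square of \<kappa> is what makes a union bound over all vertices possible.\<close>

lemma two_Bad_prob:
  assumes "x < n" "ball_cond (Suc h) \<kappa>"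
  shows "pr (\<lambda>w. Bad w h (tgt w (x, 0)) \<and> Bad w h (tgt w (x, 1))) \<le> exp 1 * \<kappa>\<^sup>2"
proof -
  let ?t = "(1 / real D) ^ Suc h"
  have t: "0 < ?t" "?t \<le> ?t" using D_ge by auto
  have T: "(x, 0) \<in> T" "(x, 1) \<in> T" using assms(1) deg[OF assms(1)] by (auto simp: T_iff)
  have "pr (\<lambda>w. Bad w h (tgt w (x, 0)) \<and> Bad w h (tgt w (x, 1))) \<le> pr (\<lambda>w. 2 \<le> card (collided (explore (Suc h) ?t (init x) w)))"
  proof (rule pr_mono)
    fix w assume w: "w \<in> Om" and B: "Bad w h (tgt w (x, 0)) \<and> Bad w h (tgt w (x, 1))"
    note E = explore_ball[OF assms(1) t w]
    show "2 \<le> card (collided (explore (Suc h) ?t (init x) w))"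
      by (rule two_Bad_coll[OF E(1,2) t(2) E(3,4) T(1) _ _ T(2)]) (use B in auto)
  qed
  also have "\<dots> \<le> exp 1 * \<kappa> ^ 2" by (rule ball_coll_prob[OF assms])
  finally show ?thesis .
qed

text \<open>If no vertex has its first two tails both leading into bad vertices, then at every step the walk leaves the
  bad set with probability at least $1/D$.\<close>
lemma Bad_mass:
  assumes w: "w \<in> Om" and two: "\<And>v. v < n \<Longrightarrow> \<not> (Bad w H0 (tgt w (v, 0)) \<and> Bad w H0 (tgt w (v, 1)))"
    and "t + h \<le> Suc H0" "x < n"
  shows "(\<Sum>v<n. P w t x v * of_bool (Bad w h v)) \<le> (1 - 1 / real D) ^ t"
  using assms(3,4)
proof (induction t arbitrary: x)
  case 0
  have "(\<Sum>v<n. P w 0 x v * of_bool (Bad w h v)) \<le> (\<Sum>v<n. P w 0 x v)" by (rule sum_mono) auto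
  thus ?case using P_row[OF w 0(2), of 0] by simp
next
  case (Suc t)
  have d: "2 \<le> dout x" "dout x \<le> D" using deg Suc.prems by auto
  let ?g = "\<lambda>k. (\<Sum>v<n. P w t (tgt w (x,k)) v * of_bool (Bad w h v))"
  have "(\<Sum>v<n. P w (Suc t) x v * of_bool (Bad w h v)) = (\<Sum>v<n. (\<Sum>k<dout x. P w t (tgt w (x,k)) v * of_bool (Bad w h v))) / real (dout x)"
  proof (subst sum_divide_distrib, rule sum.cong[OF refl])
    fix v assume "v \<in> {..<n}"
    hence "P w (Suc t) x v = (\<Sum>k<dout x. P w t (tgt w (x,k)) v) / real (dout x)" using P_left[OF w Suc.prems(2)] by blast
    thus "P w (Suc t) x v * of_bool (Bad w h v) = (\<Sum>k<dout x. P w t (tgt w (x,k)) v * of_bool (Bad w h v)) / real (dout x)"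
      by (simp add: sum_distrib_right[symmetric] del: trans_pow.simps)
  qed
  also have "\<dots> = (\<Sum>k<dout x. ?g k) / real (dout x)" by (subst sum.swap) simp
  finally have eq: "(\<Sum>v<n. P w (Suc t) x v * of_bool (Bad w h v)) = (\<Sum>k<dout x. ?g k) / real (dout x)" .
  have lt: "tgt w (x,k) < n" if "k < dout x" for k using tgt_lt[OF w] that Suc.prems by (simp add: T_iff)
  have ub: "?g k \<le> (1 - 1 / real D) ^ t" if "k < dout x" for k
    using Suc.IH[OF _ lt[OF that]] Suc.prems by simp
  have zero: "?g k = 0" if k: "k < dout x" and nb: "\<not> Bad w H0 (tgt w (x,k))" for k
  proof (rule sum.neutral, rule ballI)
    fix v assume v: "v \<in> {..<n}"
    \<comment> \<open>Badness propagates backwards: a vertex that can reach a bad one in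
      \<open>r\<close> steps is bad at a radius larger by \<open>r\<close>. Read contrapositively, a
      start that is not bad at radius \<open>H0\<close> contributes nothing.\<close>
    have reach: "Bad w (r + h) u" if "P w r u v \<noteq> 0" "Bad w h v" "u < n" for r u
      using that
    proof (induction r arbitrary: u)
      case 0 thus ?case by (auto split: if_splits)
    next
      case (Suc r)
      have "(\<Sum>k<dout u. P w r (tgt w (u,k)) v) \<noteq> 0" using Suc.prems P_left[OF w Suc.prems(3), of v r] v by auto
      then obtain k where k: "k < dout u" "P w r (tgt w (u,k)) v \<noteq> 0"
        by (meson lessThan_iff sum.neutral)
      have uT: "(u,k) \<in> T" using Suc.prems k by (simp add: T_iff)
      have "Bad w (r + h) (tgt w (u,k))" by (rule Suc.IH[OF k(2) Suc.prems(2) tgt_lt[OF w uT]])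
      from Bad_Cons[OF uT this] show ?case by simp
    qed
    show "P w t (tgt w (x,k)) v * of_bool (Bad w h v) = 0"
    proof (rule ccontr)
      assume "\<not> ?thesis"
      hence "Bad w (t + h) (tgt w (x,k))" using lt[OF k] by (intro reach) auto
      hence "Bad w H0 (tgt w (x,k))" using Suc.prems(1) by (elim Bad_mono) simp
      thus False using nb by simp
    qed
  qed
  \<comment> \<open>One of the tails 0 and 1, which exist as out-degrees are at least 2, leads to a
    vertex that is not bad at radius \<open>H0\<close>. This branch drops out and leaves a share of
    at most \<open>1 - 1 / D\<close>.\<close>
  obtain k0 where k0: "k0 < dout x" "?g k0 = 0"
    using two[OF Suc.prems(2)] zero[of 0] zero[of 1] d by (metis less_le_trans one_less_numeral_iff semiring_norm(76) zero_less_numeral)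
  have p0: "0 \<le> (1 - 1 / real D) ^ t" using D_ge by simp
  have "(\<Sum>k<dout x. ?g k) = (\<Sum>k\<in>{..<dout x} - {k0}. ?g k)" using k0 by (subst sum.remove[of _ k0]) auto
  also have "\<dots> \<le> (\<Sum>k\<in>{..<dout x} - {k0}. (1 - 1 / real D) ^ t)" by (rule sum_mono) (use ub in auto)
  also have "\<dots> = (real (dout x) - 1) * (1 - 1 / real D) ^ t" using k0 d by (simp add: of_nat_diff)
  finally have "(\<Sum>k<dout x. ?g k) / real (dout x) \<le> (1 - 1 / real (dout x)) * (1 - 1 / real D) ^ t"
    using d by (simp add: field_simps)
  also have "\<dots> \<le> (1 - 1 / real D) * (1 - 1 / real D) ^ t"
    using d p0 by (intro mult_right_mono) (auto simp: field_simps)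
  finally show ?case using eq by simp
qed

end

subsection \<open>Concentration along the exploration\<close>

text \<open>For negative \<open>y = -x\<close> the product of \<open>1 - x + x^2\<close> with the
  lower bound \<open>1 + x + x^2/2\<close> of \<open>exp x\<close> equals
  \<open>1 + x^2/2 + x^3/2 + x^4/2\<close>, which is at least 1.\<close>

lemma exp_le_quadratic:
  fixes y :: real assumes "y \<le> 1" shows "exp y \<le> 1 + y + y\<^sup>2"
proof (cases "0 \<le> y")
  case True thus ?thesis using assms exp_bound by blast
next
  case False
  define x where "x = - y"
  have x: "0 \<le> x" using False by (simp add: x_def)
  have e: "1 + x + x\<^sup>2 / 2 \<le> exp x" using exp_lower_Taylor_quadratic[OF x] by simp
  have "1 \<le> 1 + x\<^sup>2 / 2 + x ^ 3 / 2 + x ^ 4 / 2" using x by simp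
  also have "\<dots> = (1 - x + x\<^sup>2) * (1 + x + x\<^sup>2 / 2)" by (simp add: power_numeral_reduce algebra_simps add_divide_distrib diff_divide_distrib)
  also have "\<dots> \<le> (1 - x + x\<^sup>2) * exp x"
  proof (rule mult_left_mono[OF e])
    have "0 \<le> (x - 1/2)\<^sup>2 + 3/4" by simp
    thus "0 \<le> 1 - x + x\<^sup>2" by (simp add: power2_eq_square algebra_simps)
  qed
  finally have "exp (- x) \<le> 1 - x + x\<^sup>2" by (simp add: exp_minus field_simps)
  thus ?thesis by (simp add: x_def)
qed

context conf begin

definition mu' :: real where "mu' = mu din dout n"
definition lnD :: real where "lnD = ln (real D)"
definition log_step :: "nat \<Rightarrow> real" where "log_step v = ln (real (dout v)) - mu'"

lemma m_pos: "0 < m" using m_ge n_pos by linarith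

lemma lnD_pos: "0 < lnD" using D_ge by (simp add: lnD_def)

lemma ln_dout: "v < n \<Longrightarrow> ln 2 \<le> ln (real (dout v)) \<and> ln (real (dout v)) \<le> lnD"
  using deg[of v] by (auto simp: lnD_def)

lemma sum_din_real: "(\<Sum>i<n. real (din i)) = real m"
  by (simp add: m_din)

lemma mu_bounds: "ln 2 \<le> mu'" "mu' \<le> lnD"
proof -
  have eq: "mu' = (\<Sum>i<n. real (din i) * ln (real (dout i))) / real m"
    by (simp add: mu'_def mu_def m_din)
  have "(\<Sum>i<n. real (din i) * ln 2) \<le> (\<Sum>i<n. real (din i) * ln (real (dout i)))"
    by (intro sum_mono mult_left_mono) (use ln_dout in auto)
  hence "real m * ln 2 \<le> (\<Sum>i<n. real (din i) * ln (real (dout i)))"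
    unfolding sum_distrib_right[symmetric] sum_din_real .
  thus "ln 2 \<le> mu'" using m_pos by (simp add: eq field_simps)
  have "(\<Sum>i<n. real (din i) * ln (real (dout i))) \<le> (\<Sum>i<n. real (din i) * lnD)"
    by (intro sum_mono mult_left_mono) (use ln_dout in auto)
  hence "(\<Sum>i<n. real (din i) * ln (real (dout i))) \<le> real m * lnD"
    unfolding sum_distrib_right[symmetric] sum_din_real .
  thus "mu' \<le> lnD" using m_pos by (simp add: eq field_simps)
qed

lemma mu_pos: "0 < mu'" using mu_bounds(1) by (smt (verit) ln_gt_zero)

lemma log_step_bound: "v < n \<Longrightarrow> \<bar>log_step v\<bar> \<le> lnD"
proof -
  assume "v < n"
  from ln_dout[OF this] mu_bounds ln_gt_zero[of "2::real"] show ?thesis unfolding log_step_def by linarith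
qed

text \<open>The constant \<open>mu'\<close> is the mean of \<open>ln (dout v)\<close> when
  \<open>v\<close> carries a uniformly chosen head, so the logarithmic steps are centred under
  uniform matching.\<close>

lemma log_step_sum: "(\<Sum>f\<in>H. log_step (fst f)) = 0"
proof -
  have "(\<Sum>f\<in>H. log_step (fst f)) = (\<Sum>i<n. real (din i) * ln (real (dout i)) - mu' * real (din i))"
    by (simp add: sum_H log_step_def algebra_simps)
  also have "\<dots> = (\<Sum>i<n. real (din i) * ln (real (dout i))) - mu' * (\<Sum>i<n. real (din i))"
    unfolding sum_subtractf sum_distrib_left[symmetric] ..
  also have "\<dots> = 0" using m_pos unfolding sum_din_real mu'_def mu_def m_din[symmetric] by simp
  finally show ?thesis .
qed

definition log_dev :: "nat \<Rightarrow> real \<Rightarrow> real" where "log_dev d w = - ln w - mu' * real d"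

definition tail_cost :: "nat \<Rightarrow> real \<Rightarrow> real \<Rightarrow> nat \<Rightarrow> real \<Rightarrow> real" where
  "tail_cost S b L d w = w * ((log_dev d w)\<^sup>2 / L\<^sup>2 + b * (real S - real d))"

text \<open>The potential of the second phase: the mean square deviation of the logarithmic weight of the walk from its drift,
  corrected by an allowance b for every remaining step, plus the mass lost in collisions.\<close>
definition Psi :: "nat \<Rightarrow> real \<Rightarrow> real \<Rightarrow> exploration \<Rightarrow> real" where
  "Psi S b L s = (\<Sum>e\<in>frontier s. tail_cost S b L (tdepth s e) (tweight s e)) + (\<Sum>e\<in>collided s. tweight s e)"

text \<open>Here \<open>h\<close> is the radius of the complete ball, \<open>S\<close> the final
  depth, \<theta> the pruning threshold, \<open>L\<close> the scale of logarithms and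
  \<open>lam\<close> the exponential parameter. The difference in the last two clauses is what
  remains of the allowance \<open>b\<close> after the variance of a step and the second-order term
  of the exponential; the last clause says that it also pays for collisions.\<close>

definition phase_cond :: "nat \<Rightarrow> nat \<Rightarrow> real \<Rightarrow> real \<Rightarrow> real \<Rightarrow> real \<Rightarrow> bool" where
  "phase_cond h S \<theta> L b lam \<longleftrightarrow> 0 < L \<and> 0 < \<theta> \<and> \<theta> \<le> (1 / real D) ^ h \<and> h \<le> S \<and> - ln \<theta> \<le> L \<and> mu' * real S \<le> L \<and>
    2 * lnD \<le> L \<and> 0 \<le> b \<and> b \<le> 1/2 \<and> 0 < lam \<and> 2 * lam * (1/2) ^ h \<le> 1 \<and> real S / \<theta> < real m \<and>
    0 \<le> b - lnD\<^sup>2 / L\<^sup>2 - 4 * lam * (1/2) ^ h \<and>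
    4 * real D * (real S / \<theta> + 1) \<le> (real m - real S / \<theta>) * (b - lnD\<^sup>2 / L\<^sup>2 - 4 * lam * (1/2) ^ h)"

text \<open>To first order a reveal changes \<open>Psi\<close> by the weight \<open>w\<close> of the
  tail times the increment of the squared deviation minus \<open>b\<close>. The cross term of that
  increment is nearly centred, its square is at most \<open>lnD^2 / L^2\<close>, and smallness of
  \<open>lam * w\<close> makes the quadratic bound for \<open>exp\<close> available.\<close>

lemma Psi_step:
  assumes pc: "phase_cond h S \<theta> L b lam" and i: "explored x S \<theta> s" and small: "\<And>e. e \<in> frontier s \<Longrightarrow> tweight s e \<le> (1/2) ^ h"
    and nxe: "next_tail S \<theta> s = Some e"
  shows "(\<Sum>f\<in>H - ran (matched s). exp (lam * Psi S b L (reveal s e f))) \<le> real (card (H - ran (matched s))) * exp (lam * Psi S b L s)"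
proof -
  note pc' = pc[unfolded phase_cond_def]
  have L: "0 < L" and th: "0 < \<theta>" and lam: "0 < lam" using pc' by auto
  have b: "tree_state x s" using i by (simp add: explored_def)
  note N = next_tail_SomeD[OF nxe]
  have eT: "e \<in> T" and es: "fst e \<in> dom (reached s)" using frontierD N(1) by blast+
  let ?F = "H - ran (matched s)"
  let ?cF = "{f \<in> ?F. fst f \<in> dom (reached s)}"
  let ?nF = "{f \<in> ?F. fst f \<notin> dom (reached s)}"
  define w where "w = tweight s e"
  define d where "d = tdepth s e"
  define g where "g = log_dev d w"
  have w0: "0 < w" and wle: "w \<le> (1/2) ^ h" and wth: "\<theta> \<le> w" and dS: "d < S"
    using tweight_bounds(1)[OF b eT es] small[OF N(1)] N by (auto simp: w_def d_def)
  have "(1/2::real) ^ h \<le> 1" by (simp add: power_le_one)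
  hence w1: "w \<le> 1" using wle by linarith
  have g_abs: "\<bar>g\<bar> \<le> L"
  proof -
    have "0 \<le> - ln w" using w0 w1 by simp
    moreover have "- ln w \<le> L" using w0 wth th pc' by (smt (verit) ln_le_cancel_iff)
    moreover have "mu' * real d \<le> mu' * real S" using mu_pos dS by simp
    moreover have "0 \<le> mu' * real d" using mu_pos by simp
    ultimately show ?thesis using pc' unfolding g_def log_dev_def by linarith
  qed
  \<comment> \<open>Increment per unit of weight for a fresh vertex: the deviation changes from
    \<open>g\<close> to \<open>g + log_step (fst f)\<close> and one step's allowance
    \<open>b\<close> is released.\<close>
  define Y where "Y f = (2 * g * log_step (fst f) + (log_step (fst f))\<^sup>2) / L\<^sup>2 - b" for f :: pt
  have CL: "lnD / L \<le> 1/2" "0 < lnD / L" using pc' lnD_pos L by (auto simp: field_simps)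
  have Y_new: "Psi S b L (reveal s e f) = Psi S b L s + w * Y f" if f: "f \<in> ?nF" for f
  proof -
    have fH: "f \<in> H" and nf: "fst f \<notin> dom (reached s)" using f by auto
    let ?d = "real (dout (fst f))"
    have dp: "?d > 0" using deg[OF H_fst[OF fH]] by simp
    have gn: "log_dev (Suc d) (w / ?d) = g + log_step (fst f)"
      using w0 dp by (simp add: log_dev_def g_def log_step_def ln_div algebra_simps)
    have "?d * tail_cost S b L (Suc d) (w / ?d) = w * ((g + log_step (fst f))\<^sup>2 / L\<^sup>2 + b * (real S - real (Suc d)))"
      using dp unfolding tail_cost_def gn by simp
    hence "Psi S b L (reveal s e f) = Psi S b L s - w * (g\<^sup>2 / L\<^sup>2 + b * (real S - real d)) + w * ((g + log_step (fst f))\<^sup>2 / L\<^sup>2 + b * (real S - real (Suc d)))"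
      unfolding Psi_def sum_frontier_reveal(2)[OF b N(1) fH nf, of "tail_cost S b L"] sum_collided_reveal(2)[OF b N(1) nf, of "\<lambda>d w. w"]
      by (simp add: tail_cost_def w_def[symmetric] d_def[symmetric] g_def[symmetric])
    also have "\<dots> = Psi S b L s + w * Y f"
      by (simp add: Y_def power2_sum add_divide_distrib algebra_simps)
    finally show ?thesis .
  qed
  have Y_coll: "Psi S b L (reveal s e f) \<le> Psi S b L s + w" if f: "f \<in> ?cF" for f
  proof -
    have fH: "f \<in> H" and nf: "fst f \<in> dom (reached s)" using f by auto
    have "0 \<le> tail_cost S b L d w" unfolding tail_cost_def using w0 pc' dS by (intro mult_nonneg_nonneg add_nonneg_nonneg) auto
    thus ?thesis
      unfolding Psi_def sum_frontier_reveal(1)[OF b N(1) fH nf, of "tail_cost S b L"] sum_collided_reveal(1)[OF b N(1) nf, of "\<lambda>d w. w"]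
      by (simp add: w_def[symmetric] d_def[symmetric])
  qed
  have xb: "\<bar>log_step (fst f)\<bar> \<le> lnD" if "f \<in> H" for f by (rule log_step_bound[OF H_fst[OF that]])
  have xsq: "(log_step (fst f))\<^sup>2 \<le> lnD\<^sup>2" if "f \<in> H" for f using xb[OF that] by (simp add: abs_le_square_iff[symmetric])
  have gx: "\<bar>2 * g * log_step (fst f)\<bar> / L\<^sup>2 \<le> 1" if "f \<in> H" for f
  proof -
    have "\<bar>2 * g * log_step (fst f)\<bar> \<le> 2 * L * lnD" unfolding abs_mult using g_abs xb[OF that] by (intro mult_mono) auto
    hence "\<bar>2 * g * log_step (fst f)\<bar> / L\<^sup>2 \<le> 2 * L * lnD / L\<^sup>2" by (rule divide_right_mono) simp
    also have "\<dots> = 2 * (lnD / L)" using L by (simp add: power2_eq_square)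
    finally show ?thesis using CL by linarith
  qed
  have CL2: "lnD\<^sup>2 / L\<^sup>2 \<le> 1/4"
    using power_mono[OF CL(1), of 2] CL(2) by (simp add: power_divide)
  have Yabs: "\<bar>Y f\<bar> \<le> 2" if "f \<in> H" for f
  proof -
    have "(log_step (fst f))\<^sup>2 / L\<^sup>2 \<le> lnD\<^sup>2 / L\<^sup>2" using xsq[OF that] by (rule divide_right_mono) simp
    moreover have "0 \<le> (log_step (fst f))\<^sup>2 / L\<^sup>2" by simp
    moreover have "\<bar>2 * g * log_step (fst f) / L\<^sup>2\<bar> \<le> 1" using gx[OF that] by simp
    ultimately show ?thesis using CL2 pc' unfolding Y_def add_divide_distrib by linarith
  qed
  have lw: "lam * w \<le> lam * (1/2) ^ h" using wle lam by simp
  have "2 * lam * (1/2) ^ h \<le> 1" using pc' by blast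
  hence lw2: "2 * (lam * w) \<le> 1" using lw by linarith
  have lw0: "0 \<le> lam * w" using lam w0 by simp
  define Phi where "Phi = exp (lam * Psi S b L s)"
  have nF: "exp (lam * Psi S b L (reveal s e f)) \<le> Phi * (1 + lam * w * Y f + 4 * (lam * w)\<^sup>2)" if f: "f \<in> ?nF" for f
  proof -
    have Yf: "\<bar>Y f\<bar> \<le> 2" using Yabs f by auto
    have ab: "\<bar>lam * w * Y f\<bar> \<le> lam * w * 2" unfolding abs_mult[of "lam * w"] using Yf lw0 by (simp add: mult_left_mono)
    have "exp (lam * Psi S b L (reveal s e f)) = Phi * exp (lam * w * Y f)"
      unfolding Y_new[OF f] Phi_def by (simp add: exp_add[symmetric] algebra_simps)
    also have "\<dots> \<le> Phi * (1 + lam * w * Y f + (lam * w * Y f)\<^sup>2)"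
      using ab lw2 by (intro mult_left_mono exp_le_quadratic) (auto simp: Phi_def)
    also have "\<dots> \<le> Phi * (1 + lam * w * Y f + 4 * (lam * w)\<^sup>2)"
    proof -
      have "(lam * w * Y f)\<^sup>2 \<le> (lam * w * 2)\<^sup>2" using power_mono[OF ab, of 2] by simp
      thus ?thesis by (simp add: Phi_def power_mult_distrib)
    qed
    finally show ?thesis .
  qed
  have cF: "exp (lam * Psi S b L (reveal s e f)) \<le> Phi * (1 + lam * w + 4 * (lam * w)\<^sup>2)" if f: "f \<in> ?cF" for f
  proof -
    have "lam * Psi S b L (reveal s e f) \<le> lam * (Psi S b L s + w)" using Y_coll[OF f] lam by simp
    hence "exp (lam * Psi S b L (reveal s e f)) \<le> Phi * exp (lam * w)"
      unfolding Phi_def by (simp add: exp_add[symmetric] algebra_simps)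
    also have "\<dots> \<le> Phi * (1 + lam * w + (lam * w)\<^sup>2)"
      using lw2 lw0 by (intro mult_left_mono exp_le_quadratic) (auto simp: Phi_def)
    also have "\<dots> \<le> Phi * (1 + lam * w + 4 * (lam * w)\<^sup>2)" by (simp add: Phi_def)
    finally show ?thesis .
  qed
  define U where "U = real (card ?F)"
  define c where "c = real (card ?cF)"
  define B where "B = real D * (real S / \<theta> + 1)"
  define q where "q = B / (real m - real S / \<theta>)"
  have Bq: "B \<le> q * (real m - real S / \<theta>)" "0 \<le> q" using pc' th by (auto simp: q_def B_def)
  note cb = coll_le[OF i th _ Bq[unfolded B_def]]
  have mU: "real m - real S / \<theta> \<le> U" unfolding U_def using cb pc' by blast
  have hH: "real (card {f \<in> H. fst f \<in> dom (reached s)}) \<le> B" unfolding B_def using cb pc' by blast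
  have cB: "c \<le> B"
  proof -
    have "card ?cF \<le> card {f \<in> H. fst f \<in> dom (reached s)}" by (intro card_mono) auto
    thus ?thesis using hH by (simp add: c_def)
  qed
  have c0: "0 \<le> c" by (simp add: c_def)
  have part: "?F = ?nF \<union> ?cF" "?nF \<inter> ?cF = {}" by auto
  have card_nF: "real (card ?nF) = U - c"
  proof -
    have "card ?F = card ?nF + card ?cF" using part by (metis (no_types, lifting) card_Un_disjoint finite_Diff finite_H finite_Un)
    thus ?thesis by (simp add: U_def c_def)
  qed
  \<comment> \<open>The steps sum to zero over all heads, so the sum over the available ones is
    minus the sum over the used or colliding heads, of which there are at most
    \<open>2 * B\<close>.\<close>
  have xs: "\<bar>\<Sum>f\<in>?nF. log_step (fst f)\<bar> \<le> lnD * (2 * B)"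
  proof -
    have "(\<Sum>f\<in>?nF. log_step (fst f)) + (\<Sum>f\<in>H - ?nF. log_step (fst f)) = 0"
      using log_step_sum sum.subset_diff[of ?nF H "\<lambda>f. log_step (fst f)"] by auto
    hence "\<bar>\<Sum>f\<in>?nF. log_step (fst f)\<bar> = \<bar>\<Sum>f\<in>H - ?nF. log_step (fst f)\<bar>" by linarith
    also have "\<dots> \<le> (\<Sum>f\<in>H - ?nF. lnD)" by (rule sum_abs[THEN order_trans]) (intro sum_mono, use xb in auto)
    also have "\<dots> = lnD * real (card (H - ?nF))" by simp
    also have "\<dots> \<le> lnD * (2 * B)"
    proof (rule mult_left_mono)
      have "card (H - ?nF) \<le> card (ran (matched s) \<union> {f \<in> H. fst f \<in> dom (reached s)})"
        using tree_stateD(1)[OF b] by (intro card_mono) (auto simp: vld_def intro: finite_subset[OF _ finite_H])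
      also have "\<dots> \<le> card (ran (matched s)) + card {f \<in> H. fst f \<in> dom (reached s)}" by (rule card_Un_le)
      finally have "real (card (H - ?nF)) \<le> real (card (dom (matched s))) + real (card {f \<in> H. fst f \<in> dom (reached s)})"
        using card_ran[OF tree_stateD(1)[OF b]] by simp
      also have "\<dots> \<le> real S / \<theta> + B" using explored_bound[OF i th] hH by linarith
      also have "\<dots> \<le> 2 * B"
      proof -
        have "1 * (real S / \<theta>) \<le> real D * (real S / \<theta>)" using D_ge th by (intro mult_right_mono) auto
        moreover have "B = real D * (real S / \<theta>) + real D" unfolding B_def by (simp only: distrib_left mult_1_right)
        ultimately show ?thesis by linarith
      qed
      finally show "real (card (H - ?nF)) \<le> 2 * B" .
    qed (use lnD_pos in auto)
    finally show ?thesis .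
  qed
  have Ysum: "(\<Sum>f\<in>?nF. Y f) \<le> 2 * B + U * (lnD\<^sup>2 / L\<^sup>2) - b * (U - c)"
  proof -
    have "(\<Sum>f\<in>?nF. Y f) = (2 * g / L\<^sup>2) * (\<Sum>f\<in>?nF. log_step (fst f)) + (\<Sum>f\<in>?nF. (log_step (fst f))\<^sup>2 / L\<^sup>2) - b * (U - c)"
      by (simp add: Y_def sum.distrib sum_subtractf add_divide_distrib sum_distrib_left card_nF[symmetric] mult_ac)
    moreover have "(2 * g / L\<^sup>2) * (\<Sum>f\<in>?nF. log_step (fst f)) \<le> 2 * B"
    proof -
      have "(2 * g / L\<^sup>2) * (\<Sum>f\<in>?nF. log_step (fst f)) \<le> \<bar>2 * g / L\<^sup>2\<bar> * \<bar>\<Sum>f\<in>?nF. log_step (fst f)\<bar>"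
        unfolding abs_mult[symmetric] by (rule abs_ge_self)
      also have "\<dots> \<le> (2 * L / L\<^sup>2) * (lnD * (2 * B))"
        using g_abs xs L by (intro mult_mono) (auto simp: abs_mult intro!: divide_right_mono)
      also have "\<dots> = (lnD / L) * (4 * B)" using L by (simp add: power2_eq_square)
      also have "\<dots> \<le> (1/2) * (4 * B)" using CL cB c0 by (intro mult_right_mono) auto
      finally show ?thesis by simp
    qed
    moreover have "(\<Sum>f\<in>?nF. (log_step (fst f))\<^sup>2 / L\<^sup>2) \<le> U * (lnD\<^sup>2 / L\<^sup>2)"
    proof -
      have "(\<Sum>f\<in>?nF. (log_step (fst f))\<^sup>2 / L\<^sup>2) \<le> (\<Sum>f\<in>?nF. lnD\<^sup>2 / L\<^sup>2)" by (intro sum_mono divide_right_mono) (use xsq in auto)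
      also have "\<dots> = (U - c) * (lnD\<^sup>2 / L\<^sup>2)" unfolding sum_constant card_nF ..
      also have "\<dots> \<le> U * (lnD\<^sup>2 / L\<^sup>2)" using c0 by (intro mult_right_mono) auto
      finally show ?thesis .
    qed
    ultimately show ?thesis by linarith
  qed
  define R where "R = b - lnD\<^sup>2 / L\<^sup>2 - 4 * lam * (1/2) ^ h"
  have R: "0 \<le> R" "4 * B \<le> (real m - real S / \<theta>) * R" using pc' by (auto simp: R_def B_def)
  have "4 * B \<le> U * R" using R mU by (meson mult_right_mono order_trans)
  moreover have "(1 + b) * c \<le> 2 * B"
  proof -
    have "(1 + b) * c \<le> 2 * c" using pc' c0 by (intro mult_right_mono) auto
    thus ?thesis using cB by linarith
  qed
  moreover have "4 * (lam * w) * U \<le> 4 * lam * (1/2) ^ h * U"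
    using lw by (intro mult_right_mono) (auto simp: U_def)
  \<comment> \<open>The bias of the cross term costs \<open>2 * B\<close>, the collisions another
    \<open>2 * B\<close>; the margin \<open>R\<close> collected from \<open>U\<close> free heads
    covers both.\<close>
  ultimately have drift: "(\<Sum>f\<in>?nF. Y f) + c + 4 * (lam * w) * U \<le> 0"
    using Ysum unfolding R_def by (simp add: algebra_simps)
  have "(\<Sum>f\<in>?F. exp (lam * Psi S b L (reveal s e f))) = (\<Sum>f\<in>?nF. exp (lam * Psi S b L (reveal s e f))) + (\<Sum>f\<in>?cF. exp (lam * Psi S b L (reveal s e f)))"
    by (subst part(1), rule sum.union_disjoint) (use part(2) in auto)
  also have "\<dots> \<le> (\<Sum>f\<in>?nF. Phi * (1 + lam * w * Y f + 4 * (lam * w)\<^sup>2)) + (\<Sum>f\<in>?cF. Phi * (1 + lam * w + 4 * (lam * w)\<^sup>2))"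
    by (intro add_mono sum_mono nF cF)
  also have "\<dots> = Phi * (U + (lam * w) * ((\<Sum>f\<in>?nF. Y f) + c + 4 * (lam * w) * U))"
    unfolding sum_distrib_left[symmetric] sum.distrib sum_constant card_nF c_def[symmetric]
    by (simp add: power2_eq_square algebra_simps)
  also have "\<dots> \<le> Phi * (U + 0)"
    using drift lw0 by (intro mult_left_mono add_left_mono) (auto simp: Phi_def mult_nonneg_nonpos)
  finally show ?thesis by (simp add: U_def Phi_def mult.commute)
qed

section \<open>The forward exploration in two phases\<close>

definition fst_phase :: "nat \<Rightarrow> nat \<Rightarrow> (pt \<Rightarrow> pt) \<Rightarrow> exploration" where
  "fst_phase h x w = explore h ((1 / real D) ^ h) (init x) w"

text \<open>The second phase resumes from the complete ball. From there on every frontier weight is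
  at most \<open>(1/2) ^ h\<close>, as recorded in \<open>explored_light\<close>, so the increments
  of \<open>lam * Psi\<close> stay bounded.\<close>

definition forward :: "nat \<Rightarrow> nat \<Rightarrow> real \<Rightarrow> nat \<Rightarrow> (pt \<Rightarrow> pt) \<Rightarrow> exploration" where
  "forward h S \<theta> x w = explore S \<theta> (fst_phase h x w) w"

definition explored_light :: "nat \<Rightarrow> nat \<Rightarrow> nat \<Rightarrow> real \<Rightarrow> exploration \<Rightarrow> bool" where
  "explored_light x h S \<theta> s \<longleftrightarrow> explored x S \<theta> s \<and> (\<forall>e\<in>frontier s. tweight s e \<le> (1/2) ^ h)"

lemma explored_light_reveal:
  assumes "explored_light x h S \<theta> s" "next_tail S \<theta> s = Some e" "f \<in> H - ran (matched s)"
  shows "explored_light x h S \<theta> (reveal s e f)"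
  unfolding explored_light_def
proof (intro conjI ballI)
  show "explored x S \<theta> (reveal s e f)" using explored_reveal assms by (auto simp: explored_light_def)
  fix e' assume e': "e' \<in> frontier (reveal s e f)"
  have b: "tree_state x s" using assms by (simp add: explored_light_def explored_def)
  note N = next_tail_SomeD[OF assms(2)]
  have fH: "f \<in> H" using assms by auto
  show "tweight (reveal s e f) e' \<le> (1/2) ^ h"
  proof (cases "fst e' \<in> dom (reached s)")
    case True
    hence "e' \<in> frontier s" using e' by (auto simp: frontier_def matched_reveal)
    thus ?thesis using assms(1) True by (simp add: tweight_reveal_old explored_light_def)
  next
    case False
    hence nf: "fst e' = fst f" "fst f \<notin> dom (reached s)" using frontierD(2)[OF e'] by (auto simp: dom_reached_reveal)
    have w: "0 < tweight s e" "tweight s e \<le> (1/2) ^ h" using tweight_bounds(1)[OF b] frontierD N(1) assms(1) by (auto simp: explored_light_def)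
    have "tweight s e / real (dout (fst f)) \<le> tweight s e / 1" using w deg[OF H_fst[OF fH]] by (intro divide_left_mono) auto
    thus ?thesis using w nf by (simp add: tweight_reveal_new)
  qed
qed

lemma fst_phase:
  assumes "x < n" "w \<in> Om"
  shows "explored x h ((1 / real D) ^ h) (fst_phase h x w)" "w \<in> Cyl (matched (fst_phase h x w))"
    "\<And>e. e \<in> frontier (fst_phase h x w) \<Longrightarrow> tdepth (fst_phase h x w) e = h"
    "\<And>w'. w' \<in> Om \<Longrightarrow> \<forall>e\<in>dom (matched (fst_phase h x w)). w' e = w e \<Longrightarrow> fst_phase h x w' = fst_phase h x w"
proof -
  let ?t = "(1 / real D) ^ h"
  have t: "0 < ?t" "?t \<le> ?t" using D_ge by auto
  note E = explore_ball[OF assms(1) t assms(2), folded fst_phase_def]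
  show i: "explored x h ?t (fst_phase h x w)" and "w \<in> Cyl (matched (fst_phase h x w))" using E by auto
  show "tdepth (fst_phase h x w) e = h" if e: "e \<in> frontier (fst_phase h x w)" for e
  proof -
    have "tdepth (fst_phase h x w) e \<le> h" using i frontierD(2)[OF e] by (simp add: explored_def tdepth_def)
    moreover have "\<not> tdepth (fst_phase h x w) e < h"
      using eligible_all[OF _ t(2) e] E(3) i by (auto simp: explored_def)
    ultimately show ?thesis by simp
  qed
  show "fst_phase h x w' = fst_phase h x w" if "w' \<in> Om" "\<forall>e\<in>dom (matched (fst_phase h x w)). w' e = w e" for w'
    unfolding fst_phase_def
    by (rule explore_det[of "explored x h ?t" x h ?t])
       (use explored_reveal explored_init[OF assms(1)] t assms that in \<open>auto simp: init_def fst_phase_def\<close>)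
qed

context
  fixes h S :: nat and \<theta> L b lam :: real
  assumes pc: "phase_cond h S \<theta> L b lam"
begin

lemma explored_light_fst_phase:
  assumes "x < n" "w \<in> Om" shows "explored_light x h S \<theta> (fst_phase h x w)"
  unfolding explored_light_def
proof (intro conjI ballI)
  show "explored x S \<theta> (fst_phase h x w)" using explored_weaken[OF fst_phase(1)[OF assms]] pc by (simp add: phase_cond_def)
  fix e assume e: "e \<in> frontier (fst_phase h x w)"
  have b: "tree_state x (fst_phase h x w)" using fst_phase(1)[OF assms] by (simp add: explored_def)
  have "tweight (fst_phase h x w) e \<le> (1/2) ^ Suc h" using tweight_bounds(2)[OF b] frontierD e fst_phase(3)[OF assms e] by metis
  also have "\<dots> \<le> (1/2) ^ h" by simp
  finally show "tweight (fst_phase h x w) e \<le> (1/2) ^ h" .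
qed

lemma forward_props:
  assumes "x < n" "w \<in> Om"
  shows "explored x S \<theta> (forward h S \<theta> x w)" "w \<in> Cyl (matched (forward h S \<theta> x w))" "eligible S \<theta> (forward h S \<theta> x w) = {}"
    "\<And>w'. w' \<in> Om \<Longrightarrow> \<forall>e\<in>dom (matched (forward h S \<theta> x w)). w' e = w e \<Longrightarrow> forward h S \<theta> x w' = forward h S \<theta> x w"
proof -
  let ?s = "fst_phase h x w"
  have i: "\<And>s. explored_light x h S \<theta> s \<Longrightarrow> explored x S \<theta> s" by (simp add: explored_light_def)
  note I = explored_light_fst_phase[OF assms] and w = fst_phase(2)[OF assms]
  note EI = explore_Inv[of "explored_light x h S \<theta>" x S \<theta>, OF i explored_light_reveal I w]
  show "explored x S \<theta> (forward h S \<theta> x w)" unfolding forward_def using EI(1) i by blast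
  show "w \<in> Cyl (matched (forward h S \<theta> x w))" unfolding forward_def using EI(2) by blast
  show "eligible S \<theta> (forward h S \<theta> x w) = {}" unfolding forward_def
    by (rule explore_final[of "explored_light x h S \<theta>" x S \<theta>]) (use i explored_light_reveal I w in blast)+
  show "forward h S \<theta> x w' = forward h S \<theta> x w" if w': "w' \<in> Om" "\<forall>e\<in>dom (matched (forward h S \<theta> x w)). w' e = w e" for w'
  proof -
    have "dom (matched ?s) \<subseteq> dom (matched (forward h S \<theta> x w))" unfolding forward_def using EI(3) by blast
    hence eq: "fst_phase h x w' = ?s" using fst_phase(4)[OF assms w'(1)] w'(2) by blast
    show ?thesis unfolding forward_def eq
      by (rule explore_det[of "explored_light x h S \<theta>" x S \<theta>]) (use i explored_light_reveal I w w'[unfolded forward_def] in blast)+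
  qed
qed

definition Psi0 :: real where "Psi0 = (real (Suc h) * lnD / L)\<^sup>2 + b * real S"

text \<open>Without collisions the frontier carries mass 1, all of it at depth \<open>h\<close>.
  There \<open>- ln\<close> of a weight and \<open>mu' * h\<close> both lie between 0 and
  \<open>(h + 1) * lnD\<close>, which bounds the deviation.\<close>

lemma Psi_fst_phase:
  assumes "x < n" "w \<in> Om" "collided (fst_phase h x w) = {}"
  shows "Psi S b L (fst_phase h x w) \<le> Psi0"
proof -
  let ?s = "fst_phase h x w"
  have i: "explored x h ((1 / real D) ^ h) ?s" using fst_phase(1) assms by blast
  have b: "tree_state x ?s" using i by (simp add: explored_def)
  have L: "0 < L" "0 \<le> b" "h \<le> S" using pc by (auto simp: phase_cond_def)
  have "Psi S b L ?s = (\<Sum>e\<in>frontier ?s. tail_cost S b L (tdepth ?s e) (tweight ?s e))" by (simp add: Psi_def assms)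
  also have "\<dots> \<le> (\<Sum>e\<in>frontier ?s. tweight ?s e * Psi0)"
  proof (rule sum_mono)
    fix e assume e: "e \<in> frontier ?s"
    have d: "tdepth ?s e = h" by (rule fst_phase(3)[OF assms(1,2) e])
    note W = tweight_bounds[OF b frontierD(1)[OF e] frontierD(2)[OF e]]
    have "ln ((1 / real D) ^ Suc h) \<le> ln (tweight ?s e)" using W(1,3) D_ge unfolding d by (subst ln_le_cancel_iff) auto
    hence l1: "- ln (tweight ?s e) \<le> real (Suc h) * lnD" using D_ge
      by (simp add: ln_realpow ln_div lnD_def algebra_simps del: power_Suc)
    have "tweight ?s e \<le> 1" using W(2) power_le_one[of "1/2::real" "Suc (tdepth ?s e)"] by simp
    hence l2: "0 \<le> - ln (tweight ?s e)" using W(1) by simp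
    have "mu' * real h \<le> lnD * real (Suc h)" using mu_bounds(2) lnD_pos by (intro mult_mono) auto
    moreover have "0 \<le> mu' * real h" using mu_pos by simp
    ultimately have "\<bar>log_dev h (tweight ?s e)\<bar> \<le> real (Suc h) * lnD"
      using l1 l2 unfolding log_dev_def by (simp add: mult.commute)
    hence "(log_dev h (tweight ?s e))\<^sup>2 \<le> (real (Suc h) * lnD)\<^sup>2"
      using lnD_pos by (simp add: abs_le_square_iff[symmetric])
    hence "(log_dev h (tweight ?s e))\<^sup>2 / L\<^sup>2 \<le> (real (Suc h) * lnD)\<^sup>2 / L\<^sup>2" by (rule divide_right_mono) simp
    moreover have "b * (real S - real h) \<le> b * real S" using L by (intro mult_left_mono) auto
    ultimately have "(log_dev h (tweight ?s e))\<^sup>2 / L\<^sup>2 + b * (real S - real h) \<le> Psi0"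
      unfolding Psi0_def power_divide[symmetric] by linarith
    thus "tail_cost S b L (tdepth ?s e) (tweight ?s e) \<le> tweight ?s e * Psi0"
      unfolding tail_cost_def d using W(1) by (intro mult_left_mono) auto
  qed
  also have "\<dots> = Psi0" using i assms(3) by (simp add: explored_def sum_distrib_right[symmetric])
  finally show ?thesis .
qed

text \<open>Conditioning on the ball of radius \<open>h\<close> leaves two cases. If it contains a
  collision, \<open>x\<close> is bad and the event is void; otherwise the second phase starts from
  potential at most \<open>Psi0\<close>, and Markov's inequality applies to the exponential
  supermartingale.\<close>

lemma forward_prob:
  assumes x: "x < n"
  shows "pr (\<lambda>w. \<not> Bad w h x \<and> Psi0 + \<delta> \<le> Psi S b L (forward h S \<theta> x w)) \<le> exp (- lam * \<delta>)"
  unfolding pr_def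
proof (rule avg_partition[where S = "\<lambda>w. dom (matched (fst_phase h x w))"])
  fix w assume w: "w \<in> Om"
  let ?s = "fst_phase h x w"
  note fp = fst_phase[OF x w, where h = h]
  have i: "explored x h ((1 / real D) ^ h) ?s" by (rule fp(1))
  have b: "tree_state x ?s" using i by (simp add: explored_def)
  have lam: "0 < lam" using pc by (simp add: phase_cond_def)
  show "dom (matched ?s) \<subseteq> T" using tree_stateD(1)[OF b] by (simp add: vld_def)
  show "dom (matched (fst_phase h x w')) = dom (matched ?s)" if "w' \<in> Om" "\<forall>e\<in>dom (matched ?s). w' e = w e" for w'
    using fp(4)[OF that] by simp
  have "(\<lambda>e. if e \<in> dom (matched ?s) then Some (w e) else None) = matched ?s"
  proof
    fix e show "(if e \<in> dom (matched ?s) then Some (w e) else None) = matched ?s e"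
      using fp(2) CylD by (cases "matched ?s e") auto
  qed
  moreover have "avg (matched ?s) (\<lambda>w. of_bool (\<not> Bad w h x \<and> Psi0 + \<delta> \<le> Psi S b L (forward h S \<theta> x w))) \<le> exp (- lam * \<delta>)"
  proof (cases "collided ?s = {}")
    case False
    have "avg (matched ?s) (\<lambda>w. of_bool (\<not> Bad w h x \<and> Psi0 + \<delta> \<le> Psi S b L (forward h S \<theta> x w))) \<le> avg (matched ?s) (\<lambda>w. 0)"
      by (rule avg_mono) (use coll_Bad[OF i _ False] in auto)
    also have "\<dots> = 0" by (rule avg_const[OF tree_stateD(1)[OF b]])
    finally show ?thesis by (smt (verit) exp_gt_zero)
  next
    case True
    have same: "fst_phase h x w' = ?s" if "w' \<in> Cyl (matched ?s)" for w'
    proof (rule fp(4))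
      show "w' \<in> Om" using that by (simp add: Cyl_def)
      show "\<forall>e\<in>dom (matched ?s). w' e = w e" using that fp(2) CylD by (metis domD)
    qed
    have "avg (matched ?s) (\<lambda>w. exp (lam * Psi S b L (explore S \<theta> ?s w))) \<le> exp (lam * Psi S b L ?s)"
      by (rule explore_supermartingale[of "explored_light x h S \<theta>" x S \<theta> "\<lambda>s. exp (lam * Psi S b L s)"])
         (use explored_light_reveal Psi_step[OF pc] explored_light_fst_phase[OF x w] in \<open>(force simp: explored_light_def)+\<close>)
    also have "\<dots> \<le> exp (lam * Psi0)" using Psi_fst_phase[OF x w True] lam by simp
    finally have E: "avg (matched ?s) (\<lambda>w. exp (lam * Psi S b L (explore S \<theta> ?s w))) \<le> exp (lam * Psi0)" .
    have "avg (matched ?s) (\<lambda>w. of_bool (\<not> Bad w h x \<and> Psi0 + \<delta> \<le> Psi S b L (forward h S \<theta> x w))) \<le> exp (lam * Psi0) / exp (lam * (Psi0 + \<delta>))"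
      by (rule markov_avg[OF _ _ _ E]) (use lam same in \<open>auto simp: forward_def\<close>)
    also have "\<dots> = exp (- lam * \<delta>)" by (simp add: exp_diff[symmetric] algebra_simps)
    finally show ?thesis .
  qed
  ultimately show "avg (\<lambda>e. if e \<in> dom (matched ?s) then Some (w e) else None)
      (\<lambda>w. of_bool (\<not> Bad w h x \<and> Psi0 + \<delta> \<le> Psi S b L (forward h S \<theta> x w))) \<le> exp (- lam * \<delta>)" by simp
qed

definition good_tails :: "real \<Rightarrow> exploration \<Rightarrow> pt set" where
  "good_tails cap s = {e \<in> frontier s. tdepth s e = S \<and> \<theta> \<le> tweight s e \<and> tweight s e \<le> cap}"

text \<open>A Chebyshev argument: a frontier tail that is not good either became lighter than
  \<theta> at depth at most \<open>S\<close> or is heavier than \<open>cap\<close> at depth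
  \<open>S\<close>. In both cases its deviation is at least \<open>\<eta> * L\<close>, so its weight
  enters \<open>Psi\<close> with factor at least \<eta> squared; collided weight enters with factor
  1.\<close>

lemma good_tails_mass:
  assumes i: "explored x S \<theta> s" and fin: "eligible S \<theta> s = {}"
    and eta: "0 < \<eta>" "\<eta> \<le> 1" "\<eta> * L \<le> - ln \<theta> - mu' * real S" "- ln cap - mu' * real S \<le> - \<eta> * L" "0 < cap"
  shows "1 - Psi S b L s / \<eta>\<^sup>2 \<le> (\<Sum>e\<in>good_tails cap s. tweight s e)"
proof -
  have L: "0 < L" "0 < \<theta>" "0 \<le> b" using pc by (auto simp: phase_cond_def)
  have b': "tree_state x s" using i by (simp add: explored_def)
  have wpos: "0 < tweight s e" if "e \<in> frontier s" for e using tweight_bounds(1)[OF b'] frontierD that by blast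
  have dS: "tdepth s e \<le> S" if "e \<in> frontier s" for e using i frontierD(2)[OF that] by (simp add: explored_def tdepth_def)
  have wcl: "0 \<le> tweight s e" if "e \<in> collided s" for e
  proof -
    have "e \<in> dom (matched s)" using tree_stateD(6)[OF b'] that by auto
    moreover have "dom (matched s) \<subseteq> T" using tree_stateD(1)[OF b'] by (simp add: vld_def)
    ultimately have "e \<in> T" "fst e \<in> dom (reached s)" using tree_stateD(4)[OF b'] by blast+
    thus ?thesis using tweight_bounds(1)[OF b'] by (simp add: less_imp_le)
  qed
  have bad: "\<eta>\<^sup>2 * tweight s e \<le> tail_cost S b L (tdepth s e) (tweight s e)" if e: "e \<in> frontier s - good_tails cap s" for e
  proof -
    have eF: "e \<in> frontier s" using e by auto
    have w: "0 < tweight s e" by (rule wpos[OF eF])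
    have "\<eta> * L \<le> \<bar>log_dev (tdepth s e) (tweight s e)\<bar>"
    proof (cases "\<theta> \<le> tweight s e")
      case False
      hence "ln (tweight s e) \<le> ln \<theta>" using w L by simp
      moreover have "mu' * real (tdepth s e) \<le> mu' * real S" using dS[OF eF] mu_pos by simp
      ultimately show ?thesis using eta(3) unfolding log_dev_def by linarith
    next
      case True
      have "e \<notin> eligible S \<theta> s" using fin by simp
      hence d: "tdepth s e = S" using True eF dS[OF eF] by (simp add: eligible_def)
      hence "cap < tweight s e" using e True by (auto simp: good_tails_def)
      hence "ln cap \<le> ln (tweight s e)" using eta(5) by simp
      thus ?thesis using eta(4) unfolding log_dev_def d by linarith
    qed
    hence "(\<eta> * L)\<^sup>2 \<le> (log_dev (tdepth s e) (tweight s e))\<^sup>2" using eta L by (simp add: abs_le_square_iff[symmetric])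
    hence "\<eta>\<^sup>2 \<le> (log_dev (tdepth s e) (tweight s e))\<^sup>2 / L\<^sup>2" using L by (simp add: power_mult_distrib field_simps)
    moreover have "0 \<le> b * (real S - real (tdepth s e))" using L dS[OF eF] by simp
    ultimately have "\<eta>\<^sup>2 \<le> (log_dev (tdepth s e) (tweight s e))\<^sup>2 / L\<^sup>2 + b * (real S - real (tdepth s e))" by linarith
    thus ?thesis unfolding tail_cost_def using w by (simp add: mult.commute)
  qed
  have ccpos: "0 \<le> tail_cost S b L (tdepth s e) (tweight s e)" if "e \<in> frontier s" for e
    unfolding tail_cost_def using wpos[OF that] dS[OF that] L by (intro mult_nonneg_nonneg add_nonneg_nonneg) auto
  have sub: "good_tails cap s \<subseteq> frontier s" by (auto simp: good_tails_def)
  have e2: "\<eta>\<^sup>2 \<le> 1" using eta by (simp add: power_le_one)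
  have "\<eta>\<^sup>2 * ((\<Sum>e\<in>frontier s - good_tails cap s. tweight s e) + (\<Sum>e\<in>collided s. tweight s e)) \<le> (\<Sum>e\<in>frontier s - good_tails cap s. tail_cost S b L (tdepth s e) (tweight s e)) + (\<Sum>e\<in>collided s. tweight s e)"
  proof -
    have "\<eta>\<^sup>2 * (\<Sum>e\<in>frontier s - good_tails cap s. tweight s e) \<le> (\<Sum>e\<in>frontier s - good_tails cap s. tail_cost S b L (tdepth s e) (tweight s e))"
      unfolding sum_distrib_left by (intro sum_mono bad)
    moreover have "\<eta>\<^sup>2 * (\<Sum>e\<in>collided s. tweight s e) \<le> 1 * (\<Sum>e\<in>collided s. tweight s e)"
      using e2 wcl by (intro mult_right_mono sum_nonneg) auto
    ultimately show ?thesis by (simp add: algebra_simps)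
  qed
  also have "\<dots> \<le> Psi S b L s"
    unfolding Psi_def using ccpos by (intro add_right_mono sum_mono2) auto
  finally have "(\<Sum>e\<in>frontier s - good_tails cap s. tweight s e) + (\<Sum>e\<in>collided s. tweight s e) \<le> Psi S b L s / \<eta>\<^sup>2"
    using eta by (simp add: field_simps)
  moreover have "(\<Sum>e\<in>frontier s. tweight s e) = (\<Sum>e\<in>frontier s - good_tails cap s. tweight s e) + (\<Sum>e\<in>good_tails cap s. tweight s e)"
    using sum.subset_diff[OF sub] by simp
  moreover have "(\<Sum>e\<in>frontier s. tweight s e) + (\<Sum>e\<in>collided s. tweight s e) = 1" using i by (simp add: explored_def)
  ultimately show ?thesis by linarith
qed

end

end

lemma dom_ran_restr:
  "dom (\<lambda>e. if e \<in> S then Some (w e) else None) = S"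
  "ran (\<lambda>e. if e \<in> S then Some (w e) else None) = w ` S"
  by (auto simp: dom_def ran_def)

context conf begin

subsection \<open>Backward neighbourhoods\<close>

text \<open>The bound \<open>j < h\<close> is strict because crossing the tail matched to such a
  head takes one step: revealing these tails determines transitions to \<open>y\<close> in up to
  \<open>h\<close> steps.\<close>

definition back_heads :: "(pt \<Rightarrow> pt) \<Rightarrow> nat \<Rightarrow> nat \<Rightarrow> pt set" where
  "back_heads w h y = {f \<in> H. \<exists>j<h. 0 < P w j (fst f) y}"

definition back_tails :: "(pt \<Rightarrow> pt) \<Rightarrow> nat \<Rightarrow> nat \<Rightarrow> pt set" where
  "back_tails w h y = {e \<in> T. w e \<in> back_heads w h y}"

text \<open>By bijectivity the backward heads are all used up by the revealed tails, so in both
  environments every other tail leads to a vertex that cannot reach \<open>y\<close> in fewer than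
  \<open>h\<close> steps. Such tails contribute zero to the first-step decomposition on either
  side.\<close>

lemma back_tails_det:
  assumes w: "w \<in> Om" and w': "w' \<in> Om" and eq: "\<forall>e\<in>back_tails w h y. w' e = w e" and y: "y < n"
  shows "\<And>j v. j \<le> h \<Longrightarrow> v < n \<Longrightarrow> P w' j v y = P w j v y" and "back_tails w' h y = back_tails w h y"
proof -
  have out: "w' e \<notin> back_heads w h y" if e: "e \<in> T" "e \<notin> back_tails w h y" for e
  proof
    assume B: "w' e \<in> back_heads w h y"
    have "w' e \<in> w ` T" using OmD(1)[OF w' e(1)] OmD(3)[OF w] by simp
    then obtain e1 where e1: "e1 \<in> T" "w' e = w e1" by blast
    hence s: "e1 \<in> back_tails w h y" using B by (simp add: back_tails_def)
    hence "w' e1 = w' e" using eq e1 by simp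
    hence "e1 = e" using OmD(2)[OF w'] e1 e by (simp only: inj_on_def)
    thus False using s e by simp
  qed
  have zero: "P w j (fst f) y = 0" if "f \<in> H" "f \<notin> back_heads w h y" "j < h" for f j
  proof (rule ccontr)
    assume "P w j (fst f) y \<noteq> 0"
    hence "0 < P w j (fst f) y" using P_nonneg[of w j "fst f" y] by simp
    thus False using that by (auto simp: back_heads_def)
  qed
  show Peq: "P w' j v y = P w j v y" if "j \<le> h" "v < n" for j v
    using that
  proof (induction j arbitrary: v)
    case (Suc j)
    have "P w' j (tgt w' (v,k)) y = P w j (tgt w (v,k)) y" if k: "k < dout v" for k
    proof -
      have eT: "(v,k) \<in> T" using Suc.prems k by (simp add: T_iff)
      have IH: "P w' j (tgt w' (v,k)) y = P w j (tgt w' (v,k)) y"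
        using Suc.IH Suc.prems tgt_lt[OF w' eT] by simp
      show ?thesis
      proof (cases "(v,k) \<in> back_tails w h y")
        case True thus ?thesis using IH eq by simp
      next
        case False
        have "w (v,k) \<notin> back_heads w h y" using False eT by (simp add: back_tails_def)
        hence "P w j (tgt w (v,k)) y = 0" using zero OmD(1)[OF w eT] Suc.prems by simp
        moreover have "P w j (tgt w' (v,k)) y = 0" using zero OmD(1)[OF w' eT] out[OF eT False] Suc.prems by simp
        ultimately show ?thesis using IH by simp
      qed
    qed
    thus ?case using P_left[OF w Suc.prems(2) y] P_left[OF w' Suc.prems(2) y] by simp
  qed simp
  have "back_heads w' h y = back_heads w h y"
  proof -
    have "(\<exists>j<h. 0 < P w' j (fst f) y) \<longleftrightarrow> (\<exists>j<h. 0 < P w j (fst f) y)" if "f \<in> H" for f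
      using Peq[OF less_imp_le H_fst[OF that]] by metis
    thus ?thesis unfolding back_heads_def by blast
  qed
  thus "back_tails w' h y = back_tails w h y" using out eq unfolding back_tails_def by (intro Collect_cong) (metis (mono_tags, lifting) mem_Collect_eq)
qed

lemma card_heads:
  assumes "R \<subseteq> {..<n}" shows "card {f \<in> H. fst f \<in> R} \<le> D * card R"
proof -
  have fin: "finite R" using assms finite_subset by blast
  have "{f\<in>H. fst f \<in> R} \<subseteq> Sigma R (\<lambda>i. {..<din i})" by (auto simp: heads_def)
  hence "card {f\<in>H. fst f \<in> R} \<le> card (Sigma R (\<lambda>i. {..<din i}))" using fin by (intro card_mono) auto
  also have "\<dots> = (\<Sum>i\<in>R. din i)" using fin by simp
  also have "\<dots> \<le> (\<Sum>i\<in>R. D)" by (rule sum_mono) (use deg assms in auto)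
  finally show ?thesis by (simp add: mult.commute)
qed

lemma card_preimage:
  assumes "w \<in> Om" shows "card {e \<in> T. w e \<in> B} \<le> card (H \<inter> B)"
proof (rule card_inj_on_le[of w])
  show "inj_on w {e \<in> T. w e \<in> B}" using OmD(2)[OF assms] by (rule inj_on_subset) auto
qed (use OmD(1)[OF assms] in auto)

lemma P_pos_pred:
  assumes "w \<in> Om" "v < n" "y < n" "0 < P w (Suc j) v y"
  obtains k where "k < dout v" "0 < P w j (tgt w (v,k)) y"
proof -
  have "(\<Sum>k<dout v. P w j (tgt w (v,k)) y) \<noteq> 0" using P_left[OF assms(1-3), of j] assms(4) by auto
  then obtain k where "k < dout v" "P w j (tgt w (v,k)) y \<noteq> 0" by (meson lessThan_iff sum.neutral)
  thus ?thesis using that P_nonneg[of w j "tgt w (v,k)" y] by simp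
qed

lemma card_reach_back:
  assumes w: "w \<in> Om" and y: "y < n"
  shows "card {v \<in> {..<n}. 0 < P w j v y} \<le> D ^ j"
proof (induction j)
  case 0
  have "{v \<in> {..<n}. 0 < P w 0 v y} \<subseteq> {y}" by (auto split: if_splits)
  from card_mono[OF _ this] show ?case by simp
next
  case (Suc j)
  let ?R = "{v \<in> {..<n}. 0 < P w j v y}"
  have "{v \<in> {..<n}. 0 < P w (Suc j) v y} \<subseteq> fst ` {e \<in> T. w e \<in> {f \<in> H. fst f \<in> ?R}}"
  proof
    fix v assume "v \<in> {v \<in> {..<n}. 0 < P w (Suc j) v y}"
    hence v: "v < n" "0 < P w (Suc j) v y" by auto
    obtain k where k: "k < dout v" "0 < P w j (tgt w (v,k)) y" using P_pos_pred[OF w v(1) y v(2)] by blast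
    have eT: "(v,k) \<in> T" using v k by (simp add: T_iff)
    have "(v,k) \<in> {e \<in> T. w e \<in> {f \<in> H. fst f \<in> ?R}}" using eT OmD(1)[OF w eT] tgt_lt[OF w eT] k by simp
    thus "v \<in> fst ` {e \<in> T. w e \<in> {f \<in> H. fst f \<in> ?R}}" by (rule rev_image_eqI) simp
  qed
  hence "card {v \<in> {..<n}. 0 < P w (Suc j) v y} \<le> card (fst ` {e \<in> T. w e \<in> {f \<in> H. fst f \<in> ?R}})" by (intro card_mono) auto
  also have "\<dots> \<le> card {e \<in> T. w e \<in> {f \<in> H. fst f \<in> ?R}}" by (rule card_image_le) simp
  also have "\<dots> \<le> card (H \<inter> {f \<in> H. fst f \<in> ?R})" by (rule card_preimage[OF w])
  also have "H \<inter> {f \<in> H. fst f \<in> ?R} = {f \<in> H. fst f \<in> ?R}" by auto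
  also have "card \<dots> \<le> D * card ?R" by (rule card_heads) auto
  also have "\<dots> \<le> D * D ^ j" using Suc by (rule mult_le_mono2)
  finally show ?case by simp
qed

lemma card_reach_forward:
  assumes w: "w \<in> Om" and x: "x < n"
  shows "card {v \<in> {..<n}. 0 < P w j x v} \<le> D ^ j"
  using x
proof (induction j arbitrary: x)
  case 0
  have "{v \<in> {..<n}. 0 < P w 0 x v} \<subseteq> {x}" by (auto split: if_splits)
  from card_mono[OF _ this] show ?case by simp
next
  case (Suc j)
  let ?R = "\<lambda>k. {v \<in> {..<n}. 0 < P w j (tgt w (x,k)) v}"
  have d: "dout x \<le> D" using deg Suc.prems by auto
  have "{v \<in> {..<n}. 0 < P w (Suc j) x v} \<subseteq> (\<Union>k<dout x. ?R k)"
  proof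
    fix v assume "v \<in> {v \<in> {..<n}. 0 < P w (Suc j) x v}"
    hence v: "v < n" "0 < P w (Suc j) x v" by auto
    obtain k where "k < dout x" "0 < P w j (tgt w (x,k)) v" using P_pos_pred[OF w Suc.prems v] by blast
    thus "v \<in> (\<Union>k<dout x. ?R k)" using v by auto
  qed
  hence "card {v \<in> {..<n}. 0 < P w (Suc j) x v} \<le> card (\<Union>k<dout x. ?R k)" by (intro card_mono) auto
  also have "\<dots> \<le> (\<Sum>k<dout x. card (?R k))" by (rule card_UN_le) simp
  also have "\<dots> \<le> (\<Sum>k<dout x. D ^ j)"
    by (intro sum_mono Suc.IH) (use tgt_lt[OF w] Suc.prems T_iff in auto)
  also have "\<dots> \<le> D * D ^ j" using d by simp
  finally show ?case by simp
qed

lemma card_back_tails: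
  assumes w: "w \<in> Om" and y: "y < n"
  shows "card (back_tails w h y) \<le> h * D ^ h"
proof -
  have "card (back_tails w h y) \<le> card (H \<inter> back_heads w h y)" unfolding back_tails_def by (rule card_preimage[OF w])
  also have "H \<inter> back_heads w h y = (\<Union>j<h. {f \<in> H. fst f \<in> {v \<in> {..<n}. 0 < P w j v y}})"
    unfolding back_heads_def using H_fst by blast
  also have "card \<dots> \<le> (\<Sum>j<h. card {f \<in> H. fst f \<in> {v \<in> {..<n}. 0 < P w j v y}})" by (rule card_UN_le) simp
  also have "\<dots> \<le> (\<Sum>j<h. D ^ h)"
  proof (rule sum_mono)
    fix j assume "j \<in> {..<h}"
    have "card {f \<in> H. fst f \<in> {v \<in> {..<n}. 0 < P w j v y}} \<le> D * card {v \<in> {..<n}. 0 < P w j v y}"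
      by (rule card_heads) auto
    also have "\<dots> \<le> D * D ^ j" by (rule mult_le_mono2[OF card_reach_back[OF w y]])
    also have "\<dots> \<le> D ^ h" using \<open>j \<in> {..<h}\<close> D_ge power_increasing[of "Suc j" h D] by simp
    finally show "card {f \<in> H. fst f \<in> {v \<in> {..<n}. 0 < P w j v y}} \<le> D ^ h" .
  qed
  finally show ?thesis by simp
qed

lemma P_path:
  assumes w: "w \<in> Om" and "v < n" "y < n" "0 < P w j v y"
  shows "\<exists>as. path_from w v as \<and> length as = j \<and> path_end w v as = y"
  using assms(2-)
proof (induction j arbitrary: v)
  case 0 thus ?case by (auto split: if_splits intro: exI[of _ "[]"])
next
  case (Suc j)
  obtain k where k: "k < dout v" "0 < P w j (tgt w (v,k)) y" using P_pos_pred[OF w Suc.prems] by blast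
  have eT: "(v,k) \<in> T" using Suc k by (simp add: T_iff)
  obtain as where "path_from w (tgt w (v,k)) as" "length as = j" "path_end w (tgt w (v,k)) as = y"
    using Suc.IH[OF tgt_lt[OF w eT] Suc.prems(2) k(2)] by blast
  thus ?case using eT by (intro exI[of _ "(v,k) # as"]) simp
qed

text \<open>From a vertex that is not bad only one outgoing tail can still lead to \<open>y\<close>
  in the remaining steps, so each step costs a factor of at least 2.\<close>

lemma P_not_Bad:
  assumes w: "w \<in> Om" and "v < n" "y < n" "\<not> Bad w h v"
  shows "P w h v y \<le> (1/2) ^ h"
  using assms(2-)
proof (induction h arbitrary: v)
  case (Suc h)
  have d: "2 \<le> dout v" using deg Suc.prems by auto
  have eT: "(v,k) \<in> T" if "k < dout v" for k using that Suc.prems by (simp add: T_iff)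
  have IH: "P w h (tgt w (v,k)) y \<le> (1/2) ^ h" if k: "k < dout v" for k
  proof (rule Suc.IH[OF tgt_lt[OF w eT[OF k]] Suc.prems(2)])
    show "\<not> Bad w h (tgt w (v,k))" using Bad_Cons[OF eT[OF k]] Suc.prems(3) by auto
  qed
  have uniq: "k = k'" if k: "k < dout v" "0 < P w h (tgt w (v,k)) y" and k': "k' < dout v" "0 < P w h (tgt w (v,k')) y" for k k'
  proof (rule ccontr)
    assume ne: "k \<noteq> k'"
    obtain as where as: "path_from w (tgt w (v,k)) as" "length as = h" "path_end w (tgt w (v,k)) as = y"
      using P_path[OF w tgt_lt[OF w eT[OF k(1)]] Suc.prems(2) k(2)] by blast
    obtain bs where bs: "path_from w (tgt w (v,k')) bs" "length bs = h" "path_end w (tgt w (v,k')) bs = y"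
      using P_path[OF w tgt_lt[OF w eT[OF k'(1)]] Suc.prems(2) k'(2)] by blast
    have "Bad w (Suc h) v" unfolding Bad_def
      by (intro exI[of _ "(v,k) # as"] exI[of _ "(v,k') # bs"]) (use as bs eT k k' ne in auto)
    thus False using Suc.prems by simp
  qed
  have "(\<Sum>k<dout v. P w h (tgt w (v,k)) y) \<le> (1/2) ^ h"
  proof (cases "\<exists>k<dout v. 0 < P w h (tgt w (v,k)) y")
    case True
    then obtain k where k: "k < dout v" "0 < P w h (tgt w (v,k)) y" by blast
    have "(\<Sum>k\<in>{..<dout v} - {k}. P w h (tgt w (v,k)) y) = 0"
    proof (rule sum.neutral, rule ballI)
      fix k' assume k': "k' \<in> {..<dout v} - {k}"
      thus "P w h (tgt w (v,k')) y = 0" using uniq[OF k, of k'] P_nonneg[of w h "tgt w (v,k')" y] by fastforce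
    qed
    hence "(\<Sum>k<dout v. P w h (tgt w (v,k)) y) = P w h (tgt w (v,k)) y" using k by (subst sum.remove[of _ k]) auto
    thus ?thesis using IH[OF k(1)] by simp
  next
    case False
    hence "(\<Sum>k<dout v. P w h (tgt w (v,k)) y) = 0"
    proof (intro sum.neutral ballI)
      fix k assume "k \<in> {..<dout v}"
      hence "\<not> 0 < P w h (tgt w (v,k)) y" using False by blast
      thus "P w h (tgt w (v,k)) y = 0" using P_nonneg[of w h "tgt w (v,k)" y] by linarith
    qed
    thus ?thesis by simp
  qed
  hence "(\<Sum>k<dout v. P w h (tgt w (v,k)) y) / real (dout v) \<le> (1/2) ^ h / 2"
    using d by (intro frac_le) auto
  thus ?case using P_left[OF w Suc.prems(1,2)] by simp
qed simp

text \<open>Paths to \<open>y\<close> of length \<open>j < h\<close> and of length \<open>h\<close>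
  would make the vertex bad. Hence heads that matter at distance exactly \<open>h\<close> remain
  unrevealed when the backward ball is exposed.\<close>

lemma not_Bad_back_heads:
  assumes w: "w \<in> Om" and f: "f \<in> H" and y: "y < n" and nb: "\<not> Bad w h (fst f)" and p: "0 < P w h (fst f) y"
  shows "f \<notin> back_heads w h y"
proof
  assume "f \<in> back_heads w h y"
  then obtain j where j: "j < h" "0 < P w j (fst f) y" by (auto simp: back_heads_def)
  obtain as where as: "path_from w (fst f) as" "length as = j" "path_end w (fst f) as = y" using P_path[OF w H_fst[OF f] y j(2)] by blast
  obtain bs where bs: "path_from w (fst f) bs" "length bs = h" "path_end w (fst f) bs = y" using P_path[OF w H_fst[OF f] y p] by blast
  have "as \<noteq> bs" using as bs j by auto
  hence "Bad w h (fst f)" unfolding Bad_def using as bs j by (intro exI[of _ as] exI[of _ bs]) auto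
  thus False using nb by simp
qed

text \<open>Truncating at $2^{-h}$ only affects heads of vertices that are bad.\<close>
definition back_weight :: "(pt \<Rightarrow> pt) \<Rightarrow> nat \<Rightarrow> nat \<Rightarrow> pt \<Rightarrow> real" where
  "back_weight w h y f = (if P w h (fst f) y \<le> (1/2) ^ h then P w h (fst f) y else 0)"

definition nu :: "(pt \<Rightarrow> pt) \<Rightarrow> nat \<Rightarrow> nat \<Rightarrow> real" where
  "nu w h y = (\<Sum>f\<in>H. P w h (fst f) y) / real m"

lemma back_weight_bounds: "0 \<le> back_weight w h y f" "back_weight w h y f \<le> (1/2) ^ h" "back_weight w h y f \<le> P w h (fst f) y"
  using P_nonneg by (auto simp: back_weight_def)

lemma nu_nonneg: "0 \<le> nu w h y"
  by (simp add: nu_def sum_nonneg P_nonneg)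

lemma nu_sum: "w \<in> Om \<Longrightarrow> (\<Sum>y<n. nu w h y) = 1"
proof -
  assume w: "w \<in> Om"
  have "(\<Sum>y<n. nu w h y) = (\<Sum>f\<in>H. \<Sum>y<n. P w h (fst f) y) / real m"
    unfolding nu_def sum_divide_distrib[symmetric] by (subst sum.swap) simp
  also have "(\<Sum>f\<in>H. \<Sum>y<n. P w h (fst f) y) = (\<Sum>f\<in>H. 1)"
    by (rule sum.cong[OF refl]) (use P_row[OF w] H_fst in blast)
  finally show ?thesis using m_pos by (simp add: card_H)
qed

text \<open>In-degrees are at most \<open>D\<close>, so at most \<open>D ^ h\<close> vertices, with
  at most \<open>D\<close> heads each, can reach \<open>y\<close> in \<open>h\<close> steps. This
  makes small sets light under \<open>nu\<close>.\<close>

lemma nu_le: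
  assumes w: "w \<in> Om" and y: "y < n" shows "nu w h y \<le> real (D ^ Suc h) / real m"
proof -
  let ?R = "{v \<in> {..<n}. 0 < P w h v y}"
  have "(\<Sum>f\<in>H. P w h (fst f) y) \<le> (\<Sum>f\<in>H. of_bool (fst f \<in> ?R))"
  proof (rule sum_mono)
    fix f assume f: "f \<in> H"
    show "P w h (fst f) y \<le> of_bool (fst f \<in> ?R)"
      using P_le_1[OF w H_fst[OF f] y] P_nonneg[of w h "fst f" y] H_fst[OF f] by (cases "P w h (fst f) y = 0") auto
  qed
  also have "\<dots> = real (card {f \<in> H. fst f \<in> ?R})"
    unfolding of_bool_def by (simp add: sum.If_cases Int_def)
  also have "\<dots> \<le> real (D * card ?R)" using card_heads[of ?R] by (intro of_nat_mono) auto
  also have "\<dots> \<le> real (D * D ^ h)" by (intro of_nat_mono mult_le_mono2 card_reach_back[OF w y])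
  finally show ?thesis unfolding nu_def by (intro divide_right_mono) auto
qed

subsection \<open>Concentration of the number of connections\<close>

definition free_tails :: "nat \<Rightarrow> nat \<Rightarrow> real \<Rightarrow> real \<Rightarrow> nat \<Rightarrow> nat \<Rightarrow> nat \<Rightarrow> (pt \<Rightarrow> pt) \<Rightarrow> pt set" where
  "free_tails h0 S \<theta> cap h x y w = good_tails S \<theta> cap (forward h0 S \<theta> x w) - back_tails w h y"

definition free_heads :: "nat \<Rightarrow> nat \<Rightarrow> real \<Rightarrow> nat \<Rightarrow> nat \<Rightarrow> nat \<Rightarrow> (pt \<Rightarrow> pt) \<Rightarrow> pt set" where
  "free_heads h0 S \<theta> h x y w = H - w ` (dom (matched (forward h0 S \<theta> x w)) \<union> back_tails w h y)"

definition link_mass :: "nat \<Rightarrow> nat \<Rightarrow> real \<Rightarrow> real \<Rightarrow> nat \<Rightarrow> nat \<Rightarrow> nat \<Rightarrow> (pt \<Rightarrow> pt) \<Rightarrow> real" where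
  "link_mass h0 S \<theta> cap h x y w = (\<Sum>e\<in>free_tails h0 S \<theta> cap h x y w. tweight (forward h0 S \<theta> x w) e * back_weight w h y (w e))"

text \<open>The conditional mean of \<open>link_mass\<close> once the forward exploration and the
  backward ball are revealed: each free tail then has a uniform free head.\<close>

definition mean_link :: "nat \<Rightarrow> nat \<Rightarrow> real \<Rightarrow> real \<Rightarrow> nat \<Rightarrow> nat \<Rightarrow> nat \<Rightarrow> (pt \<Rightarrow> pt) \<Rightarrow> real" where
  "mean_link h0 S \<theta> cap h x y w = (\<Sum>e\<in>free_tails h0 S \<theta> cap h x y w. tweight (forward h0 S \<theta> x w) e) *
     ((\<Sum>f\<in>free_heads h0 S \<theta> h x y w. back_weight w h y f) / real (card (free_heads h0 S \<theta> h x y w)))"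

text \<open>With \<open>lam = \<delta> / (cap * q)\<close> every summand \<open>z\<close> of the
  exponent lies in [0, \<delta>], so \<open>exp (- z)\<close> is at most
  \<open>1 - (1 - \<delta>) * z\<close>. \<open>avg_prod_le\<close> decouples the tails, and the
  additive slack \<open>a\<close> yields the probability bound whatever the size of the
  mean.\<close>

lemma chernoff:
  fixes p u :: "pt \<Rightarrow> real"
  assumes v: "vld s" and A: "A \<subseteq> T - dom s" and p: "\<And>e. e \<in> A \<Longrightarrow> 0 \<le> p e \<and> p e \<le> cap"
    and u: "\<And>f. 0 \<le> u f \<and> u f \<le> q" and cap: "0 < cap" "0 < q" and \<delta>: "0 < \<delta>" "\<delta> \<le> 1" and a: "0 \<le> a"
  shows "avg s (\<lambda>w. of_bool ((\<Sum>e\<in>A. p e * u (w e)) <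
      (1 - \<delta>) * ((\<Sum>e\<in>A. p e) * ((\<Sum>f\<in>H - ran s. u f) / real (card (H - ran s)))) - a)) \<le> exp (- \<delta> * a / (cap * q))"
proof -
  define lam where "lam = \<delta> / (cap * q)"
  have lam: "0 < lam" using cap \<delta> by (simp add: lam_def)
  have finA: "finite A" using A by (rule finite_subset) simp
  define W where "W = (\<Sum>f\<in>H - ran s. u f) / real (card (H - ran s))"
  \<comment> \<open>\<open>avg_prod_le\<close> wants antitone factors for all tails; the coefficient
    0 outside \<open>A\<close> provides this where nothing is known about \<open>p\<close>.\<close>
  define g where "g e z = exp (- (lam * (if e \<in> A then p e else 0) * z))" for e :: pt and z :: real
  have "avg s (\<lambda>w. \<Prod>e\<in>A. g e (u (w e))) \<le> (\<Prod>e\<in>A. (\<Sum>f\<in>H - ran s. g e (u f)) / real (card (H - ran s)))"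
  proof (rule avg_prod_le[OF _ _ v A])
    show "g e y \<le> g e x" if "x \<le> y" for e x y
      unfolding g_def using that lam p[of e] by (auto intro!: mult_left_mono)
  qed (simp add: g_def)
  also have "\<dots> \<le> (\<Prod>e\<in>A. exp (- ((1 - \<delta>) * lam * p e * W)))"
  proof (rule prod_mono, intro conjI)
    fix e assume e: "e \<in> A"
    show "0 \<le> (\<Sum>f\<in>H - ran s. g e (u f)) / real (card (H - ran s))"
      by (intro divide_nonneg_nonneg sum_nonneg) (auto simp: g_def)
    show "(\<Sum>f\<in>H - ran s. g e (u f)) / real (card (H - ran s)) \<le> exp (- ((1 - \<delta>) * lam * p e * W))"
    proof (cases "card (H - ran s) = 0")
      case False
      have gb: "g e (u f) \<le> 1 - (1 - \<delta>) * lam * p e * u f" for f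
      proof -
        define z where "z = lam * p e * u f"
        have z0: "0 \<le> z" using lam p[OF e] u[of f] by (simp add: z_def)
        have "p e * u f \<le> cap * q" using p[OF e] u[of f] cap by (intro mult_mono) auto
        hence "lam * (p e * u f) \<le> lam * (cap * q)" using lam by simp
        also have "\<dots> = \<delta>" using cap by (simp add: lam_def)
        finally have zd: "z \<le> \<delta>" by (simp add: z_def mult.assoc)
        have "g e (u f) = exp (- z)" using e by (simp add: g_def z_def)
        also have "\<dots> \<le> 1 + (- z) + (- z)\<^sup>2" by (rule exp_le_quadratic) (use z0 in simp)
        also have "\<dots> \<le> 1 - z + \<delta> * z" using mult_right_mono[OF zd z0] by (simp add: power2_eq_square)
        finally show ?thesis by (simp add: z_def algebra_simps)
      qed
      have "(\<Sum>f\<in>H - ran s. g e (u f)) \<le> (\<Sum>f\<in>H - ran s. 1 - (1 - \<delta>) * lam * p e * u f)" by (rule sum_mono[OF gb])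
      also have "\<dots> = real (card (H - ran s)) - (1 - \<delta>) * lam * p e * (\<Sum>f\<in>H - ran s. u f)"
        by (simp add: sum_subtractf sum_distrib_left)
      finally have "(\<Sum>f\<in>H - ran s. g e (u f)) / real (card (H - ran s)) \<le>
        (real (card (H - ran s)) - (1 - \<delta>) * lam * p e * (\<Sum>f\<in>H - ran s. u f)) / real (card (H - ran s))"
        by (rule divide_right_mono) simp
      also have "\<dots> = 1 - (1 - \<delta>) * lam * p e * W" using False by (simp add: W_def diff_divide_distrib)
      also have "\<dots> \<le> exp (- ((1 - \<delta>) * lam * p e * W))" using exp_ge_add_one_self[of "- ((1 - \<delta>) * lam * p e * W)"] by simp
      finally show ?thesis .
    next
      case True
      thus ?thesis unfolding True by simp
    qed
  qed
  also have "\<dots> = exp (- ((1 - \<delta>) * lam * ((\<Sum>e\<in>A. p e) * W)))"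
    using finA by (simp add: exp_sum[symmetric] sum_negf sum_distrib_left sum_distrib_right mult.assoc)
  finally have E: "avg s (\<lambda>w. \<Prod>e\<in>A. g e (u (w e))) \<le> exp (- ((1 - \<delta>) * lam * ((\<Sum>e\<in>A. p e) * W)))" .
  have pr: "(\<Prod>e\<in>A. g e (u (w e))) = exp (- lam * (\<Sum>e\<in>A. p e * u (w e)))" for w
  proof -
    have "(\<Prod>e\<in>A. g e (u (w e))) = (\<Prod>e\<in>A. exp (- lam * (p e * u (w e))))" by (rule prod.cong) (auto simp: g_def)
    thus ?thesis using finA by (simp add: exp_sum[symmetric] sum_negf sum_distrib_left)
  qed
  have "avg s (\<lambda>w. of_bool ((\<Sum>e\<in>A. p e * u (w e)) < (1 - \<delta>) * ((\<Sum>e\<in>A. p e) * W) - a))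
    \<le> exp (- ((1 - \<delta>) * lam * ((\<Sum>e\<in>A. p e) * W))) / exp (- lam * ((1 - \<delta>) * ((\<Sum>e\<in>A. p e) * W) - a))"
  proof (rule markov_avg[OF _ _ _ E])
    fix w assume "(\<Sum>e\<in>A. p e * u (w e)) < (1 - \<delta>) * ((\<Sum>e\<in>A. p e) * W) - a"
    thus "exp (- lam * ((1 - \<delta>) * ((\<Sum>e\<in>A. p e) * W) - a)) \<le> (\<Prod>e\<in>A. g e (u (w e)))"
      unfolding pr using lam by simp
  qed (auto simp: pr)
  also have "\<dots> = exp (- lam * a)" by (simp add: exp_diff[symmetric] algebra_simps)
  finally show ?thesis by (simp add: W_def lam_def mult.commute)
qed

text \<open>The revealed tails, forward and backward together, form a self-determined set. On its
  cylinder all ingredients except the heads of the free tails are constant, and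
  \<open>chernoff\<close> applies with summands at most \<open>cap * (1/2) ^ h\<close> and slack
  \<open>\<delta> / n\<close>.\<close>

lemma back_prob:
  assumes pc: "phase_cond h0 S \<theta> L b lam" and x: "x < n" and y: "y < n" and cap: "0 < cap" and \<delta>: "0 < \<delta>" "\<delta> \<le> 1"
  shows "pr (\<lambda>w. link_mass h0 S \<theta> cap h x y w < (1 - \<delta>) * mean_link h0 S \<theta> cap h x y w - \<delta> / real n)
    \<le> exp (- \<delta>\<^sup>2 / (real n * cap * (1/2) ^ h))"
  unfolding pr_def
proof (rule avg_partition[where S = "\<lambda>w. dom (matched (forward h0 S \<theta> x w)) \<union> back_tails w h y"])
  fix w assume w: "w \<in> Om"
  note fp = forward_props[OF pc x w]
  let ?s = "forward h0 S \<theta> x w"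
  let ?D = "dom (matched ?s) \<union> back_tails w h y"
  have b: "tree_state x ?s" using fp(1) by (simp add: explored_def)
  show DT: "?D \<subseteq> T" using tree_stateD(1)[OF b] by (auto simp: vld_def back_tails_def)
  have same: "forward h0 S \<theta> x w' = ?s" "back_tails w' h y = back_tails w h y" "\<And>f. f \<in> H \<Longrightarrow> back_weight w' h y f = back_weight w h y f"
    if w': "w' \<in> Om" "\<forall>e\<in>?D. w' e = w e" for w'
  proof -
    show "forward h0 S \<theta> x w' = ?s" using fp(4)[OF w'(1)] w'(2) by blast
    have eq: "\<forall>e\<in>back_tails w h y. w' e = w e" using w'(2) by blast
    note sd = back_tails_det[OF w w'(1) eq y]
    show "back_tails w' h y = back_tails w h y" by (rule sd(2))
    show "back_weight w' h y f = back_weight w h y f" if "f \<in> H" for f using sd(1)[of h "fst f"] H_fst[OF that] by (simp add: back_weight_def)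
  qed
  show "dom (matched (forward h0 S \<theta> x w')) \<union> back_tails w' h y = ?D" if "w' \<in> Om" "\<forall>e\<in>?D. w' e = w e" for w'
    using same(1,2)[OF that] by simp
  define s where "s = (\<lambda>e. if e \<in> ?D then Some (w e) else None)"
  have vs: "vld s" unfolding s_def by (rule vld_restr[OF w DT])
  have ds: "dom s = ?D" unfolding s_def by (rule dom_ran_restr)
  have rs: "ran s = w ` ?D" unfolding s_def by (rule dom_ran_restr)
  let ?A = "free_tails h0 S \<theta> cap h x y w"
  have A: "?A \<subseteq> T - dom s" unfolding ds free_tails_def good_tails_def[OF pc] using frontierD by blast
  have p: "0 \<le> tweight ?s e \<and> tweight ?s e \<le> cap" if "e \<in> ?A" for e
  proof -
    have e: "e \<in> frontier ?s" "tweight ?s e \<le> cap" using that by (simp_all add: free_tails_def good_tails_def[OF pc])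
    thus ?thesis using tweight_bounds(1)[OF b frontierD(1)[OF e(1)] frontierD(2)[OF e(1)]] by (simp add: less_imp_le)
  qed
  have "avg s (\<lambda>w'. of_bool (link_mass h0 S \<theta> cap h x y w' < (1 - \<delta>) * mean_link h0 S \<theta> cap h x y w' - \<delta> / real n))
     = avg s (\<lambda>w'. of_bool ((\<Sum>e\<in>?A. tweight ?s e * back_weight w h y (w' e)) <
      (1 - \<delta>) * ((\<Sum>e\<in>?A. tweight ?s e) * ((\<Sum>f\<in>H - ran s. back_weight w h y f) / real (card (H - ran s)))) - \<delta> / real n))"
  proof (rule avg_cong)
    fix w' assume c: "w' \<in> Cyl s"
    have w': "w' \<in> Om" "\<forall>e\<in>?D. w' e = w e"
      using c CylD[OF c, of e "w e" for e] by (simp_all add: Cyl_def s_def)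
    note sm = same[OF w']
    have A': "free_tails h0 S \<theta> cap h x y w' = ?A" by (simp add: free_tails_def sm)
    have "w' ` ?D = w ` ?D" using w'(2) by (intro image_cong) auto
    hence F': "free_heads h0 S \<theta> h x y w' = H - ran s" by (simp add: free_heads_def sm rs)
    have Z: "link_mass h0 S \<theta> cap h x y w' = (\<Sum>e\<in>?A. tweight ?s e * back_weight w h y (w' e))"
      unfolding link_mass_def A' sm(1) 
    proof (rule sum.cong[OF refl])
      fix e assume "e \<in> ?A"
      hence "w' e \<in> H" using OmD(1)[OF w'(1)] A by blast
      thus "tweight ?s e * back_weight w' h y (w' e) = tweight ?s e * back_weight w h y (w' e)" by (simp only: sm(3))
    qed
    have W: "(\<Sum>f\<in>H - ran s. back_weight w' h y f) = (\<Sum>f\<in>H - ran s. back_weight w h y f)"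
      by (rule sum.cong[OF refl]) (use sm(3) in auto)
    show "of_bool (link_mass h0 S \<theta> cap h x y w' < (1 - \<delta>) * mean_link h0 S \<theta> cap h x y w' - \<delta> / real n) =
      (of_bool ((\<Sum>e\<in>?A. tweight ?s e * back_weight w h y (w' e)) <
      (1 - \<delta>) * ((\<Sum>e\<in>?A. tweight ?s e) * ((\<Sum>f\<in>H - ran s. back_weight w h y f) / real (card (H - ran s)))) - \<delta> / real n) :: real)"
      unfolding mean_link_def A' F' sm(1) Z W ..
  qed
  also have "\<dots> \<le> exp (- \<delta> * (\<delta> / real n) / (cap * (1/2) ^ h))"
    by (rule chernoff[OF vs A]) (use p back_weight_bounds cap \<delta> in auto)
  also have "- \<delta> * (\<delta> / real n) / (cap * (1/2) ^ h) = - \<delta>\<^sup>2 / (real n * cap * (1/2) ^ h)"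
    by (simp add: power2_eq_square)
  finally show "avg (\<lambda>e. if e \<in> ?D then Some (w e) else None)
      (\<lambda>w. of_bool (link_mass h0 S \<theta> cap h x y w < (1 - \<delta>) * mean_link h0 S \<theta> cap h x y w - \<delta> / real n)) \<le> exp (- \<delta>\<^sup>2 / (real n * cap * (1/2) ^ h))"
    unfolding s_def .
qed

lemma avg_sum: "finite I \<Longrightarrow> avg s (\<lambda>w. \<Sum>i\<in>I. F i w) = (\<Sum>i\<in>I. avg s (F i))"
  unfolding avg_def sum_divide_distrib[symmetric] by (subst sum.swap) simp

lemma pr_count:
  assumes "\<And>v. v < n \<Longrightarrow> pr (Q v) \<le> c" "0 < a"
  shows "pr (\<lambda>w. a \<le> real (card {v \<in> {..<n}. Q v w})) \<le> real n * c / a"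
  unfolding pr_def
proof (rule markov_avg[where G = "\<lambda>w. \<Sum>v<n. of_bool (Q v w)"])
  have eq: "(\<Sum>v<n. of_bool (Q v w)) = real (card {v \<in> {..<n}. Q v w})" for w
    unfolding of_bool_def by (simp add: sum.If_cases Int_def)
  show "0 \<le> (\<Sum>v<n. of_bool (Q v w) :: real)" for w by (simp add: sum_nonneg)
  show "a \<le> (\<Sum>v<n. of_bool (Q v w))" if "a \<le> real (card {v \<in> {..<n}. Q v w})" for w using that eq by simp
  have "avg Map.empty (\<lambda>w. \<Sum>v<n. of_bool (Q v w)) = (\<Sum>v<n. pr (Q v))" unfolding pr_def by (rule avg_sum) simp
  also have "\<dots> \<le> (\<Sum>v<n. c)" by (rule sum_mono) (use assms in auto)
  finally show "avg Map.empty (\<lambda>w. \<Sum>v<n. of_bool (Q v w)) \<le> real n * c" by simp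
qed (rule assms)

text \<open>The radius \<open>2 * h0\<close> in the first clause leaves room for \<open>h0\<close>
  steps of the walk followed by a test for badness at radius \<open>h0\<close>.\<close>

definition good :: "nat \<Rightarrow> nat \<Rightarrow> real \<Rightarrow> real \<Rightarrow> real \<Rightarrow> (pt \<Rightarrow> pt) \<Rightarrow> bool" where
  "good h0 S \<theta> cap \<delta> w \<longleftrightarrow>
    (\<forall>x<n. \<not> (Bad w (2 * h0) (tgt w (x, 0)) \<and> Bad w (2 * h0) (tgt w (x, 1)))) \<and>
    (\<forall>x<n. \<not> Bad w h0 x \<longrightarrow> 1 - \<delta> \<le> (\<Sum>e\<in>good_tails S \<theta> cap (forward h0 S \<theta> x w). tweight (forward h0 S \<theta> x w) e))"

text \<open>Both thresholds \<theta> and \<open>cap\<close> differ from the typical weight at depth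
  \<open>S\<close> by at least \<open>\<eta> * L\<close> on the logarithmic scale. The last clause
  bounds the initial potential plus the tolerated increase by what a lost mass of \<delta> would
  cost.\<close>

definition eta_cond :: "nat \<Rightarrow> nat \<Rightarrow> real \<Rightarrow> real \<Rightarrow> real \<Rightarrow> real \<Rightarrow> real \<Rightarrow> real \<Rightarrow> real \<Rightarrow> bool" where
  "eta_cond h0 S \<theta> L b \<eta> cap \<delta> \<delta>0 \<longleftrightarrow> 0 < \<eta> \<and> \<eta> \<le> 1 \<and> \<eta> * L \<le> - ln \<theta> - mu' * real S \<and>
     - ln cap - mu' * real S \<le> - \<eta> * L \<and> 0 < cap \<and> (real (Suc h0) * lnD / L)\<^sup>2 + b * real S + \<delta>0 \<le> \<delta> * \<eta>\<^sup>2"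

lemma good_prob:
  assumes pc: "phase_cond h0 S \<theta> L b lam" and bc: "ball_cond (Suc (2 * h0)) \<kappa>" and ec: "eta_cond h0 S \<theta> L b \<eta> cap \<delta> \<delta>0"
  shows "pr (\<lambda>w. \<not> good h0 S \<theta> cap \<delta> w) \<le> real n * (exp 1 * \<kappa>\<^sup>2) + real n * exp (- lam * \<delta>0)"
proof -
  note ec' = ec[unfolded eta_cond_def]
  have p0: "Psi0 h0 S L b + \<delta>0 \<le> \<delta> * \<eta>\<^sup>2" using ec' by (simp add: Psi0_def[OF pc])
  let ?Q1 = "\<lambda>x w. Bad w (2 * h0) (tgt w (x, 0)) \<and> Bad w (2 * h0) (tgt w (x, 1))"
  let ?Q2 = "\<lambda>x w. \<not> Bad w h0 x \<and> Psi0 h0 S L b + \<delta>0 \<le> Psi S b L (forward h0 S \<theta> x w)"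
  have "pr (\<lambda>w. \<not> good h0 S \<theta> cap \<delta> w) \<le> pr (\<lambda>w. (\<exists>x\<in>{..<n}. ?Q1 x w) \<or> (\<exists>x\<in>{..<n}. ?Q2 x w))"
  proof (rule pr_mono, rule ccontr)
    fix w assume w: "w \<in> Om" and g: "\<not> good h0 S \<theta> cap \<delta> w"
    assume n: "\<not> ((\<exists>x\<in>{..<n}. ?Q1 x w) \<or> (\<exists>x\<in>{..<n}. ?Q2 x w))"
    have "1 - \<delta> \<le> (\<Sum>e\<in>good_tails S \<theta> cap (forward h0 S \<theta> x w). tweight (forward h0 S \<theta> x w) e)" if x: "x < n" and nb: "\<not> Bad w h0 x" for x
    proof -
      note fp = forward_props[OF pc x w]
      have "Psi S b L (forward h0 S \<theta> x w) \<le> \<delta> * \<eta>\<^sup>2" using n x nb p0 by force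
      hence "Psi S b L (forward h0 S \<theta> x w) / \<eta>\<^sup>2 \<le> \<delta>" using ec' by (simp add: field_simps)
      moreover have "1 - Psi S b L (forward h0 S \<theta> x w) / \<eta>\<^sup>2 \<le> (\<Sum>e\<in>good_tails S \<theta> cap (forward h0 S \<theta> x w). tweight (forward h0 S \<theta> x w) e)"
        by (rule good_tails_mass[OF pc fp(1,3)]) (use ec' in auto)
      ultimately show ?thesis by linarith
    qed
    hence "good h0 S \<theta> cap \<delta> w" using n unfolding good_def by blast
    thus False using g by simp
  qed
  also have "\<dots> \<le> pr (\<lambda>w. \<exists>x\<in>{..<n}. ?Q1 x w) + pr (\<lambda>w. \<exists>x\<in>{..<n}. ?Q2 x w)" by (rule pr_union)
  also have "pr (\<lambda>w. \<exists>x\<in>{..<n}. ?Q1 x w) \<le> real (card {..<n}) * (exp 1 * \<kappa>\<^sup>2)"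
    by (rule pr_union_fin) (use two_Bad_prob[OF _ bc] in auto)
  also have "pr (\<lambda>w. \<exists>x\<in>{..<n}. ?Q2 x w) \<le> real (card {..<n}) * exp (- lam * \<delta>0)"
    by (rule pr_union_fin) (use forward_prob[OF pc] in auto)
  finally show ?thesis by simp
qed

lemma good_Bad_mass:
  assumes "good h0 S \<theta> cap \<delta> w" "w \<in> Om" "x < n"
  shows "(\<Sum>v<n. P w h0 x v * of_bool (Bad w h0 v)) \<le> (1 - 1 / real D) ^ h0"
  by (rule Bad_mass[where ?H0.0 = "2 * h0"]) (use assms in \<open>auto simp: good_def\<close>)

subsection \<open>Before the mixing time\<close>

lemma good_tails_tweight:
  assumes pc: "phase_cond h0 S \<theta> L b lam" and x: "x < n" and w: "w \<in> Om" and e: "e \<in> good_tails S \<theta> cap (forward h0 S \<theta> x w)"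
  shows "e \<in> T" "0 < tweight (forward h0 S \<theta> x w) e" "\<theta> \<le> tweight (forward h0 S \<theta> x w) e" "tweight (forward h0 S \<theta> x w) e \<le> cap"
    "tweight (forward h0 S \<theta> x w) e \<le> P w S x (fst e) / real (dout (fst e))"
proof -
  let ?s = "forward h0 S \<theta> x w"
  note fp = forward_props[OF pc x w]
  have b: "tree_state x ?s" using fp(1) by (simp add: explored_def)
  have E: "e \<in> frontier ?s" "tdepth ?s e = S" "\<theta> \<le> tweight ?s e" "tweight ?s e \<le> cap" using e by (simp_all add: good_tails_def[OF pc])
  note F = frontierD(1)[OF E(1)] frontierD(2)[OF E(1)]
  show "e \<in> T" by (rule F)
  show "0 < tweight ?s e" by (rule tweight_bounds(1)[OF b F])
  show "\<theta> \<le> tweight ?s e" "tweight ?s e \<le> cap" by (rule E)+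
  have "vweight ?s (fst e) \<le> P w S x (fst e)" using seen_path(2)[OF b fp(2) F(2)] E(2) by (simp add: tdepth_def)
  thus "tweight ?s e \<le> P w S x (fst e) / real (dout (fst e))" unfolding tweight_def by (intro divide_right_mono) auto
qed

lemma good_tails_total:
  assumes pc: "phase_cond h0 S \<theta> L b lam" and x: "x < n" and w: "w \<in> Om"
  shows "(\<Sum>e\<in>good_tails S \<theta> cap (forward h0 S \<theta> x w). tweight (forward h0 S \<theta> x w) e) \<le> 1"
proof -
  let ?s = "forward h0 S \<theta> x w"
  note fp = forward_props[OF pc x w]
  have b: "tree_state x ?s" using fp(1) by (simp add: explored_def)
  have wF: "0 \<le> tweight ?s e" if "e \<in> frontier ?s" for e using tweight_bounds(1)[OF b frontierD(1)[OF that] frontierD(2)[OF that]] by simp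
  have wcl: "0 \<le> tweight ?s e" if "e \<in> collided ?s" for e
  proof -
    have "e \<in> dom (matched ?s)" using tree_stateD(6)[OF b] that by auto
    moreover have "dom (matched ?s) \<subseteq> T" using tree_stateD(1)[OF b] by (simp add: vld_def)
    ultimately have "e \<in> T" "fst e \<in> dom (reached ?s)" using tree_stateD(4)[OF b] by blast+
    thus ?thesis using tweight_bounds(1)[OF b] by (simp add: less_imp_le)
  qed
  have "(\<Sum>e\<in>good_tails S \<theta> cap ?s. tweight ?s e) \<le> (\<Sum>e\<in>frontier ?s. tweight ?s e)"
    by (rule sum_mono2) (use wF in \<open>auto simp: good_tails_def[OF pc]\<close>)
  also have "\<dots> \<le> (\<Sum>e\<in>frontier ?s. tweight ?s e) + (\<Sum>e\<in>collided ?s. tweight ?s e)" using sum_nonneg[OF wcl] by simp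
  also have "\<dots> = 1" using fp(1) by (simp add: explored_def)
  finally show ?thesis .
qed

text \<open>Good tails weigh at least \<theta> each and at most 1 together, which bounds their
  number; their weights are dominated by the probability of standing at their vertex.\<close>

lemma good_tails_cover:
  fixes cap :: real
  assumes pc: "phase_cond h0 S \<theta> L b lam" and x: "x < n" and w: "w \<in> Om"
  defines "A \<equiv> fst ` good_tails S \<theta> cap (forward h0 S \<theta> x w)"
  shows "A \<subseteq> {..<n}" "real (card A) \<le> 1 / \<theta>"
    "(\<Sum>e\<in>good_tails S \<theta> cap (forward h0 S \<theta> x w). tweight (forward h0 S \<theta> x w) e) \<le> (\<Sum>v\<in>A. P w S x v)"
proof -
  let ?s = "forward h0 S \<theta> x w" and ?G = "good_tails S \<theta> cap (forward h0 S \<theta> x w)"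
  note G = good_tails_tweight[OF pc x w, of _ cap]
  have th: "0 < \<theta>" using pc by (simp add: phase_cond_def)
  have GT: "?G \<subseteq> T" using G(1) by blast
  have fG: "finite ?G" by (rule finite_subset[OF GT finite_T])
  show A: "A \<subseteq> {..<n}" unfolding A_def using GT T_fst by blast
  have fA: "finite A" by (rule finite_subset[OF A finite_lessThan])
  have "real (card A) \<le> real (card ?G)" unfolding A_def using card_image_le[OF fG] by simp
  also have "real (card ?G) * \<theta> = (\<Sum>e\<in>?G. \<theta>)" by simp
  hence "real (card ?G) * \<theta> \<le> 1" using order_trans[OF sum_mono[of ?G "\<lambda>_. \<theta>" "tweight ?s", OF G(3)] good_tails_total[OF pc x w, of cap]] by simp
  hence "real (card ?G) \<le> 1 / \<theta>" using th by (simp add: field_simps)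
  finally show "real (card A) \<le> 1 / \<theta>" .
  have "(\<Sum>e\<in>?G. tweight ?s e) \<le> (\<Sum>e\<in>?G. P w S x (fst e) / real (dout (fst e)))" by (rule sum_mono[OF G(5)])
  also have "\<dots> \<le> (\<Sum>e\<in>Sigma A (\<lambda>v. {..<dout v}). P w S x (fst e) / real (dout (fst e)))"
  proof (rule sum_mono2)
    show "?G \<subseteq> Sigma A (\<lambda>v. {..<dout v})" using GT unfolding A_def T_Sigma by force
  qed (use fA P_nonneg in auto)
  also have "\<dots> = (\<Sum>v\<in>A. \<Sum>k<dout v. P w S x v / real (dout v))" using fA by (subst sum.Sigma) (auto intro: sum.cong)
  also have "\<dots> = (\<Sum>v\<in>A. P w S x v)"
  proof (rule sum.cong[OF refl])
    fix v assume "v \<in> A"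
    hence "0 < dout v" using deg[of v] A by auto
    thus "(\<Sum>k<dout v. P w S x v / real (dout v)) = P w S x v" by simp
  qed
  finally show "(\<Sum>e\<in>?G. tweight ?s e) \<le> (\<Sum>v\<in>A. P w S x v)" .
qed

text \<open>After \<open>h0\<close> steps the walk is at one of at most \<open>D ^ h0\<close>
  vertices, which is bad only with small probability. The union of the good end sets of all these
  vertices catches nearly all the mass \<open>S\<close> steps later.\<close>

lemma lower_set:
  assumes pc: "phase_cond h0 S \<theta> L b lam" and g: "good h0 S \<theta> cap \<delta> w" and w: "w \<in> Om" and x: "x < n" and \<delta>: "0 \<le> \<delta>"
  shows "\<exists>A. A \<subseteq> {..<n} \<and> real (card A) \<le> real D ^ h0 / \<theta> \<and> 1 - \<delta> - (1 - 1 / real D) ^ h0 \<le> (\<Sum>y\<in>A. P w (h0 + S) x y)"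
proof -
  define V where "V = {v \<in> {..<n}. 0 < P w h0 x v}"
  define B where "B v = fst ` good_tails S \<theta> cap (forward h0 S \<theta> v w)" for v
  define A where "A = (\<Union>v\<in>V. B v)"
  have th: "0 < \<theta>" using pc by (simp add: phase_cond_def)
  note cov = good_tails_cover[OF pc _ w, of _ cap, folded B_def]
  have Vn: "v < n" if "v \<in> V" for v using that by (simp add: V_def)
  have fV: "finite V" by (simp add: V_def)
  have An: "A \<subseteq> {..<n}" unfolding A_def using cov(1) Vn by blast
  have "card A \<le> (\<Sum>v\<in>V. card (B v))" unfolding A_def by (rule card_UN_le[OF fV])
  hence "real (card A) \<le> (\<Sum>v\<in>V. real (card (B v)))" by (simp only: of_nat_sum[symmetric] of_nat_le_iff)
  also have "\<dots> \<le> (\<Sum>v\<in>V. 1 / \<theta>)" by (rule sum_mono) (use cov(2) Vn in blast)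
  also have "\<dots> = real (card V) * (1 / \<theta>)" by simp
  also have "\<dots> \<le> real (D ^ h0) * (1 / \<theta>)"
    unfolding V_def using th card_reach_forward[OF w x, of h0] by (intro mult_right_mono of_nat_mono) auto
  finally have cA: "real (card A) \<le> real D ^ h0 / \<theta>" by simp
  have "1 - \<delta> - (1 - 1 / real D) ^ h0 \<le> (1 - \<delta>) - (\<Sum>v<n. P w h0 x v * of_bool (Bad w h0 v))"
    using good_Bad_mass[OF g w x] by simp
  also have "\<dots> = (1 - \<delta>) * (\<Sum>v<n. P w h0 x v) - (\<Sum>v<n. P w h0 x v * of_bool (Bad w h0 v))" using P_row[OF w x] by simp
  also have "\<dots> = (\<Sum>v<n. P w h0 x v * ((1 - \<delta>) - of_bool (Bad w h0 v)))"
    by (simp only: sum_distrib_left sum_subtractf[symmetric]) (simp add: algebra_simps)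
  also have "\<dots> \<le> (\<Sum>v<n. P w h0 x v * (\<Sum>y\<in>A. P w S v y))"
  proof (rule sum_mono)
    fix v assume v: "v \<in> {..<n}"
    show "P w h0 x v * ((1 - \<delta>) - of_bool (Bad w h0 v)) \<le> P w h0 x v * (\<Sum>y\<in>A. P w S v y)"
    proof (cases "0 < P w h0 x v")
      case True
      hence vV: "v \<in> V" using v by (simp add: V_def)
      have "(1 - \<delta>) - of_bool (Bad w h0 v) \<le> (\<Sum>y\<in>A. P w S v y)"
      proof (cases "Bad w h0 v")
        case True
        moreover have "0 \<le> (\<Sum>y\<in>A. P w S v y)" by (rule sum_nonneg) (rule P_nonneg)
        ultimately show ?thesis using \<delta> by simp
      next
        case False
        hence "1 - \<delta> \<le> (\<Sum>e\<in>good_tails S \<theta> cap (forward h0 S \<theta> v w). tweight (forward h0 S \<theta> v w) e)" using g v by (simp add: good_def)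
        also have "\<dots> \<le> (\<Sum>y\<in>B v. P w S v y)" using cov(3) v by simp
        also have "\<dots> \<le> (\<Sum>y\<in>A. P w S v y)"
          by (rule sum_mono2) (use finite_subset[OF An finite_lessThan] vV P_nonneg in \<open>auto simp: A_def\<close>)
        finally show ?thesis using False by simp
      qed
      thus ?thesis using True by (intro mult_left_mono) auto
    next
      case False
      hence "P w h0 x v = 0" using P_nonneg[of w h0 x v] by linarith
      thus ?thesis by simp
    qed
  qed
  also have "\<dots> = (\<Sum>y\<in>A. \<Sum>v<n. P w h0 x v * P w S v y)" unfolding sum_distrib_left by (rule sum.swap)
  also have "\<dots> = (\<Sum>y\<in>A. P w (h0 + S) x y)" by (rule sum.cong[OF refl]) (use An P_add[OF x] in auto)
  finally show ?thesis using An cA by blast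
qed

subsection \<open>After the mixing time\<close>

text \<open>\<open>S\<close> steps lead to the vertex of a free tail, one step crosses it and
  \<open>h\<close> steps lead to \<open>y\<close>, hence the time \<open>S + Suc h\<close>.
  Different tails give disjoint contributions.\<close>

lemma link_mass_le:
  assumes pc: "phase_cond h0 S \<theta> L b lam" and x: "x < n" and y: "y < n" and w: "w \<in> Om"
  shows "link_mass h0 S \<theta> cap h x y w \<le> P w (S + Suc h) x y"
proof -
  let ?s = "forward h0 S \<theta> x w"
  let ?A = "free_tails h0 S \<theta> cap h x y w"
  have AG: "?A \<subseteq> good_tails S \<theta> cap ?s" by (auto simp: free_tails_def)
  note G = good_tails_tweight[OF pc x w, of _ cap]
  let ?f = "\<lambda>e. P w S x (fst e) / real (dout (fst e)) * P w h (tgt w e) y"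
  have "link_mass h0 S \<theta> cap h x y w \<le> (\<Sum>e\<in>?A. ?f e)"
    unfolding link_mass_def
  proof (rule sum_mono)
    fix e assume "e \<in> ?A"
    hence e: "e \<in> good_tails S \<theta> cap ?s" using AG by blast
    show "tweight ?s e * back_weight w h y (w e) \<le> ?f e"
      using G(2,5)[OF e] back_weight_bounds[of w h y "w e"] by (intro mult_mono) auto
  qed
  also have "\<dots> \<le> (\<Sum>e\<in>T. ?f e)"
    by (rule sum_mono2) (use AG G(1) P_nonneg in auto)
  also have "\<dots> = (\<Sum>i<n. P w S x i * P w (Suc h) i y)"
    unfolding sum_T
  proof (rule sum.cong[OF refl])
    fix i assume "i \<in> {..<n}"
    hence "P w (Suc h) i y = (\<Sum>k<dout i. P w h (tgt w (i,k)) y) / real (dout i)" using P_left[OF w _ y] by blast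
    thus "(\<Sum>k<dout i. ?f (i,k)) = P w S x i * P w (Suc h) i y"
      by (simp add: sum_distrib_left sum_divide_distrib del: trans_pow.simps)
  qed
  also have "\<dots> = P w (S + Suc h) x y" by (rule P_add[OF x y, symmetric])
  finally show ?thesis .
qed

text \<open>Heads are lost only to the forward exploration and to bad vertices. Those used by the
  backward ball cost nothing, by \<open>not_Bad_back_heads\<close>, and truncation is harmless where
  \<open>P_not_Bad\<close> applies.\<close>

lemma nu_loss:
  fixes h :: nat
  assumes pc: "phase_cond h0 S \<theta> L b lam" and x: "x < n" and w: "w \<in> Om"
  defines "nu' \<equiv> \<lambda>y. (\<Sum>f\<in>free_heads h0 S \<theta> h x y w. back_weight w h y f) / real m"
  shows "\<And>y. nu' y \<le> nu w h y"
    and "1 - (real S / \<theta> + real (D * card {v \<in> {..<n}. Bad w h v})) / real m \<le> (\<Sum>y<n. nu' y)"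
proof -
  let ?s = "forward h0 S \<theta> x w"
  note fp = forward_props[OF pc x w]
  have b: "tree_state x ?s" using fp(1) by (simp add: explored_def)
  have th: "0 < \<theta>" using pc by (simp add: phase_cond_def)
  have FH: "free_heads h0 S \<theta> h x y w \<subseteq> H" for y by (auto simp: free_heads_def)
  show "nu' y \<le> nu w h y" for y
  proof -
    have "(\<Sum>f\<in>free_heads h0 S \<theta> h x y w. back_weight w h y f) \<le> (\<Sum>f\<in>free_heads h0 S \<theta> h x y w. P w h (fst f) y)"
      by (rule sum_mono) (rule back_weight_bounds)
    also have "\<dots> \<le> (\<Sum>f\<in>H. P w h (fst f) y)" by (rule sum_mono2) (use FH P_nonneg in auto)
    finally show ?thesis unfolding nu'_def nu_def by (rule divide_right_mono) simp
  qed
  define X where "X = {f \<in> H. f \<in> w ` dom (matched ?s) \<or> Bad w h (fst f)}"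
  have XH: "X \<subseteq> H" by (auto simp: X_def)
  have fX: "finite X" by (rule finite_subset[OF XH finite_H])
  have key: "nu w h y - (\<Sum>f\<in>X. P w h (fst f) y) / real m \<le> nu' y" if y: "y < n" for y
  proof -
    have "(\<Sum>f\<in>H. P w h (fst f) y) = (\<Sum>f\<in>H - X. P w h (fst f) y) + (\<Sum>f\<in>X. P w h (fst f) y)"
      by (rule sum.subset_diff[OF XH]) simp
    moreover have "(\<Sum>f\<in>H - X. P w h (fst f) y) \<le> (\<Sum>f\<in>free_heads h0 S \<theta> h x y w. back_weight w h y f)"
    proof -
      have "(\<Sum>f\<in>H - X. P w h (fst f) y) \<le> (\<Sum>f\<in>H - X. if f \<in> free_heads h0 S \<theta> h x y w then back_weight w h y f else 0)"
      proof (rule sum_mono)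
        fix f assume f: "f \<in> H - X"
        hence fH: "f \<in> H" and nb: "\<not> Bad w h (fst f)" and nd: "f \<notin> w ` dom (matched ?s)" by (auto simp: X_def)
        show "P w h (fst f) y \<le> (if f \<in> free_heads h0 S \<theta> h x y w then back_weight w h y f else 0)"
        proof (cases "0 < P w h (fst f) y")
          case True
          have "f \<notin> back_heads w h y" by (rule not_Bad_back_heads[OF w fH y nb True])
          hence "f \<notin> w ` back_tails w h y" by (auto simp: back_tails_def)
          hence "f \<in> free_heads h0 S \<theta> h x y w" using fH nd by (simp add: free_heads_def image_Un)
          moreover have "P w h (fst f) y \<le> (1/2) ^ h" by (rule P_not_Bad[OF w H_fst[OF fH] y nb])
          ultimately show ?thesis by (simp add: back_weight_def)
        next
          case False
          thus ?thesis using back_weight_bounds(1)[of w h y f] by simp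
        qed
      qed
      also have "\<dots> \<le> (\<Sum>f\<in>H. if f \<in> free_heads h0 S \<theta> h x y w then back_weight w h y f else 0)"
        by (rule sum_mono2) (use back_weight_bounds(1) in auto)
      also have "\<dots> = (\<Sum>f\<in>free_heads h0 S \<theta> h x y w. back_weight w h y f)"
        using FH[of y] by (simp add: sum.If_cases Int_absorb1 inf_absorb2)
      finally show ?thesis .
    qed
    ultimately have "(\<Sum>f\<in>H. P w h (fst f) y) - (\<Sum>f\<in>X. P w h (fst f) y) \<le> (\<Sum>f\<in>free_heads h0 S \<theta> h x y w. back_weight w h y f)" by linarith
    from divide_right_mono[OF this, of "real m"] show ?thesis
      by (simp add: nu_def nu'_def diff_divide_distrib)
  qed
  have "real (card X) \<le> real S / \<theta> + real (D * card {v \<in> {..<n}. Bad w h v})"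
  proof -
    have "X \<subseteq> w ` dom (matched ?s) \<union> {f \<in> H. fst f \<in> {v \<in> {..<n}. Bad w h v}}" unfolding X_def using H_fst by blast
    hence "card X \<le> card (w ` dom (matched ?s) \<union> {f \<in> H. fst f \<in> {v \<in> {..<n}. Bad w h v}})"
      using tree_state_finite[OF b] by (intro card_mono) auto
    also have "\<dots> \<le> card (w ` dom (matched ?s)) + card {f \<in> H. fst f \<in> {v \<in> {..<n}. Bad w h v}}" by (rule card_Un_le)
    also have "\<dots> \<le> card (dom (matched ?s)) + D * card {v \<in> {..<n}. Bad w h v}"
      by (intro add_mono card_image_le tree_state_finite[OF b] card_heads) auto
    finally have "real (card X) \<le> real (card (dom (matched ?s))) + real (D * card {v \<in> {..<n}. Bad w h v})" by (simp only: of_nat_add[symmetric] of_nat_le_iff)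
    thus ?thesis using explored_bound[OF fp(1) th] by linarith
  qed
  moreover have "(\<Sum>y<n. nu w h y - (\<Sum>f\<in>X. P w h (fst f) y) / real m) = 1 - real (card X) / real m"
  proof -
    have "(\<Sum>y<n. \<Sum>f\<in>X. P w h (fst f) y) = (\<Sum>f\<in>X. \<Sum>y<n. P w h (fst f) y)" by (rule sum.swap)
    also have "\<dots> = (\<Sum>f\<in>X. 1)" by (rule sum.cong[OF refl]) (use P_row[OF w] H_fst XH in blast)
    finally show ?thesis using nu_sum[OF w] by (simp add: sum_subtractf sum_divide_distrib[symmetric])
  qed
  moreover have "(\<Sum>y<n. nu w h y - (\<Sum>f\<in>X. P w h (fst f) y) / real m) \<le> (\<Sum>y<n. nu' y)" by (rule sum_mono) (use key in auto)
  ultimately show "1 - (real S / \<theta> + real (D * card {v \<in> {..<n}. Bad w h v})) / real m \<le> (\<Sum>y<n. nu' y)"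
    using m_pos by (smt (verit) divide_right_mono of_nat_0_less_iff)
qed

text \<open>A pointwise lower bound is enough: the row and \<open>nu\<close> both have mass 1, so
  the l1 distance is at most twice the total deficit.\<close>

lemma upper_not_Bad:
  assumes pc: "phase_cond h0 S \<theta> L b lam" and g: "good h0 S \<theta> cap \<delta> w" and w: "w \<in> Om" and x: "x < n" and nb: "\<not> Bad w h0 x"
    and \<delta>: "0 < \<delta>" "5 * \<delta> \<le> 1" and cap: "0 < cap"
    and Z: "\<And>y. y < n \<Longrightarrow> (1 - \<delta>) * mean_link h0 S \<theta> cap h x y w - \<delta> / real n \<le> link_mass h0 S \<theta> cap h x y w"
    and s2: "cap * real (h * D ^ h) \<le> \<delta>"
    and loss: "(real S / \<theta> + real (D * card {v \<in> {..<n}. Bad w h v})) / real m \<le> \<delta>"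
  shows "(\<Sum>y<n. \<bar>P w (S + Suc h) x y - nu w h y\<bar>) \<le> 10 * \<delta>"
proof -
  let ?s = "forward h0 S \<theta> x w"
  define Q where "Q = P w (S + Suc h) x"
  define nu' where "nu' y = (\<Sum>f\<in>free_heads h0 S \<theta> h x y w. back_weight w h y f) / real m" for y
  note nl = nu_loss[OF pc x w, of h, folded nu'_def]
  note G = good_tails_tweight[OF pc x w, of _ cap]
  have GT: "good_tails S \<theta> cap ?s \<subseteq> T" using G(1) by blast
  have fG: "finite (good_tails S \<theta> cap ?s)" by (rule finite_subset[OF GT finite_T])
  \<comment> \<open>The factor \<open>1 - \<delta>\<close> is the Chernoff loss. The factor
    \<open>1 - 2 * \<delta>\<close> is the mass of the good tails: one \<delta> is missing in
    \<open>good\<close>, another is the weight of those inside the backward ball.\<close>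
  define c where "c = (1 - \<delta>) * (1 - 2 * \<delta>)"
  have c: "0 \<le> c" "c \<le> 1" using \<delta> by (auto simp: c_def intro!: mult_le_one mult_nonneg_nonneg)
  have "c = 1 - 3 * \<delta> + 2 * \<delta>\<^sup>2" by (simp add: c_def power2_eq_square algebra_simps)
  hence c3: "1 - 3 * \<delta> \<le> c" by simp
  have nu'0: "0 \<le> nu' y" for y unfolding nu'_def by (intro divide_nonneg_nonneg sum_nonneg back_weight_bounds) auto
  have low: "c * nu' y - \<delta> / real n \<le> Q y" if y: "y < n" for y
  proof -
    let ?A = "free_tails h0 S \<theta> cap h x y w"
    define p where "p = (\<Sum>e\<in>?A. tweight ?s e)"
    have "1 - 2 * \<delta> \<le> p"
    proof -
      have "1 - \<delta> \<le> (\<Sum>e\<in>good_tails S \<theta> cap ?s. tweight ?s e)" using g x nb by (simp add: good_def)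
      also have "\<dots> = (\<Sum>e\<in>good_tails S \<theta> cap ?s - back_tails w h y. tweight ?s e) + (\<Sum>e\<in>good_tails S \<theta> cap ?s \<inter> back_tails w h y. tweight ?s e)"
        using fG by (metis add.commute sum.Int_Diff)
      also have "(\<Sum>e\<in>good_tails S \<theta> cap ?s \<inter> back_tails w h y. tweight ?s e) \<le> (\<Sum>e\<in>good_tails S \<theta> cap ?s \<inter> back_tails w h y. cap)" by (rule sum_mono) (use G(4) in blast)
      also have "\<dots> = real (card (good_tails S \<theta> cap ?s \<inter> back_tails w h y)) * cap" by simp
      also have "\<dots> \<le> real (h * D ^ h) * cap"
      proof (intro mult_right_mono of_nat_mono)
        have "card (good_tails S \<theta> cap ?s \<inter> back_tails w h y) \<le> card (back_tails w h y)" by (intro card_mono) (auto simp: back_tails_def)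
        also have "\<dots> \<le> h * D ^ h" by (rule card_back_tails[OF w y])
        finally show "card (good_tails S \<theta> cap ?s \<inter> back_tails w h y) \<le> h * D ^ h" .
      qed (use cap in simp)
      also have "\<dots> \<le> \<delta>" using s2 by (simp add: mult.commute)
      finally show ?thesis by (simp add: p_def free_tails_def)
    qed
    moreover have "p * nu' y \<le> mean_link h0 S \<theta> cap h x y w"
    proof -
      have p0: "0 \<le> p" unfolding p_def by (rule sum_nonneg) (use G(2) in \<open>auto simp: free_tails_def less_imp_le\<close>)
      let ?F = "free_heads h0 S \<theta> h x y w"
      have "nu' y \<le> (\<Sum>f\<in>?F. back_weight w h y f) / real (card ?F)"
      proof (cases "card ?F = 0")
        case True
        hence "?F = {}" by (simp add: free_heads_def)
        thus ?thesis by (simp add: nu'_def)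
      next
        case False
        have "card ?F \<le> m" unfolding card_H[symmetric] by (rule card_mono) (auto simp: free_heads_def)
        thus ?thesis unfolding nu'_def using False
          by (intro divide_left_mono sum_nonneg back_weight_bounds mult_pos_pos) auto
      qed
      thus ?thesis unfolding mean_link_def p_def[symmetric] using p0 by (rule mult_left_mono)
    qed
    ultimately have "(1 - 2 * \<delta>) * nu' y \<le> mean_link h0 S \<theta> cap h x y w" using mult_right_mono[OF _ nu'0[of y], of "1 - 2 * \<delta>" p] by linarith
    hence "c * nu' y \<le> (1 - \<delta>) * mean_link h0 S \<theta> cap h x y w" using \<delta> by (simp add: c_def mult.assoc mult_left_mono)
    thus ?thesis using Z[OF y] link_mass_le[OF pc x y w, of cap h] unfolding Q_def by linarith
  qed
  \<comment> \<open>Summed over \<open>y\<close>, the signed differences cancel and only twice the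
    bound \<open>R\<close> on the deficit remains.\<close>
  have aux: "\<bar>a\<bar> \<le> a + 2 * R" if "0 \<le> R" "- a \<le> R" for a R :: real using that by linarith
  have "(\<Sum>y<n. \<bar>Q y - nu w h y\<bar>) \<le> (\<Sum>y<n. (Q y - nu w h y) + 2 * (nu w h y - c * nu' y + \<delta> / real n))"
  proof (rule sum_mono)
    fix y assume y: "y \<in> {..<n}"
    have "c * nu' y \<le> 1 * nu' y" using c nu'0 by (intro mult_right_mono) auto
    hence "0 \<le> nu w h y - c * nu' y + \<delta> / real n" using nl(1)[of y] \<delta> by simp
    moreover have "- (Q y - nu w h y) \<le> nu w h y - c * nu' y + \<delta> / real n" using low[of y] y unfolding lessThan_iff by linarith
    ultimately show "\<bar>Q y - nu w h y\<bar> \<le> (Q y - nu w h y) + 2 * (nu w h y - c * nu' y + \<delta> / real n)"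
      by (rule aux)
  qed
  also have "\<dots> = (\<Sum>y<n. Q y) + (\<Sum>y<n. nu w h y) - 2 * c * (\<Sum>y<n. nu' y) + 2 * \<delta>"
    using n_pos by (simp add: sum.distrib sum_subtractf sum_distrib_left algebra_simps)
  also have "\<dots> = 2 - 2 * (c * (\<Sum>y<n. nu' y)) + 2 * \<delta>" using P_row[OF w x, of "S + Suc h", folded Q_def] nu_sum[OF w] by simp
  also have "\<dots> \<le> 10 * \<delta>"
  proof -
    have "1 - \<delta> \<le> (\<Sum>y<n. nu' y)" using nl(2) loss by linarith
    hence "c * (1 - \<delta>) \<le> c * (\<Sum>y<n. nu' y)" using c by (intro mult_left_mono) auto
    moreover have "c * \<delta> \<le> 1 * \<delta>" using c \<delta> by (intro mult_right_mono) auto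
    ultimately show ?thesis using c3 by (simp add: algebra_simps)
  qed
  finally show ?thesis unfolding Q_def .
qed

text \<open>Conditioning on the position after \<open>h0\<close> steps averages the rows of the
  vertices reached; a bad vertex costs at most 2, the l1 distance of any two laws, and carries
  little mass.\<close>

lemma upper_all:
  assumes g: "good h0 S \<theta> cap \<delta> w" and w: "w \<in> Om" and x: "x < n" and r: "0 \<le> r"
    and nb: "\<And>v. v < n \<Longrightarrow> \<not> Bad w h0 v \<Longrightarrow> (\<Sum>y<n. \<bar>P w t v y - nu w h y\<bar>) \<le> r"
  shows "(\<Sum>y<n. \<bar>P w (h0 + t) x y - nu w h y\<bar>) \<le> r + 2 * (1 - 1 / real D) ^ h0"
proof -
  have "(\<Sum>y<n. \<bar>P w (h0 + t) x y - nu w h y\<bar>) \<le> (\<Sum>y<n. \<Sum>v<n. P w h0 x v * \<bar>P w t v y - nu w h y\<bar>)"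
  proof (rule sum_mono)
    fix y assume y: "y \<in> {..<n}"
    have "P w (h0 + t) x y - nu w h y = (\<Sum>v<n. P w h0 x v * P w t v y) - (\<Sum>v<n. P w h0 x v) * nu w h y"
      using P_add[OF x] P_row[OF w x] y by simp
    also have "\<dots> = (\<Sum>v<n. P w h0 x v * (P w t v y - nu w h y))"
      by (simp only: sum_distrib_right sum_subtractf[symmetric] right_diff_distrib)
    finally have "\<bar>P w (h0 + t) x y - nu w h y\<bar> = \<bar>\<Sum>v<n. P w h0 x v * (P w t v y - nu w h y)\<bar>" by (rule arg_cong)
    also have "\<dots> \<le> (\<Sum>v<n. \<bar>P w h0 x v * (P w t v y - nu w h y)\<bar>)" by (rule sum_abs)
    also have "\<dots> = (\<Sum>v<n. P w h0 x v * \<bar>P w t v y - nu w h y\<bar>)" by (simp add: abs_mult P_nonneg)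
    finally show "\<bar>P w (h0 + t) x y - nu w h y\<bar> \<le> (\<Sum>v<n. P w h0 x v * \<bar>P w t v y - nu w h y\<bar>)" .
  qed
  also have "\<dots> = (\<Sum>v<n. P w h0 x v * (\<Sum>y<n. \<bar>P w t v y - nu w h y\<bar>))" unfolding sum_distrib_left by (rule sum.swap)
  also have "\<dots> \<le> (\<Sum>v<n. P w h0 x v * (r + 2 * of_bool (Bad w h0 v)))"
  proof (intro sum_mono mult_left_mono P_nonneg)
    fix v assume v: "v \<in> {..<n}"
    have "(\<Sum>y<n. \<bar>P w t v y - nu w h y\<bar>) \<le> (\<Sum>y<n. P w t v y + nu w h y)"
      by (rule sum_mono) (use P_nonneg[of w t v] nu_nonneg[of w h] in \<open>smt (verit)\<close>)
    also have "\<dots> = 2" using P_row[OF w, of v t] nu_sum[OF w, of h] v by (simp add: sum.distrib)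
    finally show "(\<Sum>y<n. \<bar>P w t v y - nu w h y\<bar>) \<le> r + 2 * of_bool (Bad w h0 v)"
      using nb[of v] v r by (cases "Bad w h0 v") auto
  qed
  also have "\<dots> = r * (\<Sum>v<n. P w h0 x v) + 2 * (\<Sum>v<n. P w h0 x v * of_bool (Bad w h0 v))"
    by (simp only: sum_distrib_left sum.distrib[symmetric]) (simp add: algebra_simps)
  also have "\<dots> \<le> r + 2 * (1 - 1 / real D) ^ h0" using P_row[OF w x] good_Bad_mass[OF g w x] by simp
  finally show ?thesis .
qed

text \<open>The exceptional events are: failure of \<open>good\<close>, failure of the Chernoff
  bound for one of n^2 pairs, and too many vertices that are bad at the backward radius. The last is
  controlled by Markov's inequality for their number.\<close>

lemma upper_prob:
  assumes pc: "phase_cond h0 S \<theta> L b lam" and bc: "ball_cond (Suc (2 * h0)) \<kappa>" and ec: "eta_cond h0 S \<theta> L b \<eta> cap \<delta> \<delta>0"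
    and bc2: "ball_cond h \<kappa>2" and \<delta>: "0 < \<delta>" "5 * \<delta> \<le> 1"
    and s2: "cap * real (h * D ^ h) \<le> \<delta>" and s1: "real S / \<theta> \<le> \<delta> * real m / 2"
  shows "pr (\<lambda>w. \<not> (\<forall>x<n. (\<Sum>y<n. \<bar>P w (h0 + (S + Suc h)) x y - nu w h y\<bar>) \<le> 10 * \<delta> + 2 * (1 - 1 / real D) ^ h0))
    \<le> real n * (exp 1 * \<kappa>\<^sup>2) + real n * exp (- lam * \<delta>0) + real n * (real n * exp (- \<delta>\<^sup>2 / (real n * cap * (1/2) ^ h)))
      + real n * (exp 1 * \<kappa>2) / (\<delta> * real m / (2 * real D))"
proof -
  have cap: "0 < cap" using ec by (simp add: eta_cond_def)
  have D0: "real D > 0" using D_ge by simp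
  let ?Q1 = "\<lambda>w. \<not> good h0 S \<theta> cap \<delta> w"
  let ?q = "\<lambda>x y w. link_mass h0 S \<theta> cap h x y w < (1 - \<delta>) * mean_link h0 S \<theta> cap h x y w - \<delta> / real n"
  let ?Q2 = "\<lambda>w. \<exists>x\<in>{..<n}. \<exists>y\<in>{..<n}. ?q x y w"
  let ?Q3 = "\<lambda>w. \<delta> * real m / (2 * real D) \<le> real (card {v \<in> {..<n}. Bad w h v})"
  let ?E = "exp (- \<delta>\<^sup>2 / (real n * cap * (1/2) ^ h))"
  have "pr (\<lambda>w. \<not> (\<forall>x<n. (\<Sum>y<n. \<bar>P w (h0 + (S + Suc h)) x y - nu w h y\<bar>) \<le> 10 * \<delta> + 2 * (1 - 1 / real D) ^ h0))
      \<le> pr (\<lambda>w. (?Q1 w \<or> ?Q2 w) \<or> ?Q3 w)"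
  proof (rule pr_mono, rule ccontr)
    fix w assume w: "w \<in> Om"
    assume "\<not> ((?Q1 w \<or> ?Q2 w) \<or> ?Q3 w)"
    hence g: "good h0 S \<theta> cap \<delta> w" and q: "\<And>x y. x < n \<Longrightarrow> y < n \<Longrightarrow> \<not> ?q x y w" and B: "real (card {v \<in> {..<n}. Bad w h v}) < \<delta> * real m / (2 * real D)"
      by (blast, blast, linarith)
    have "real D * real (card {v \<in> {..<n}. Bad w h v}) \<le> real D * (\<delta> * real m / (2 * real D))" using B D0 by (intro mult_left_mono) auto
    also have "\<dots> = \<delta> * real m / 2" using D0 by simp
    finally have "real S / \<theta> + real (D * card {v \<in> {..<n}. Bad w h v}) \<le> \<delta> * real m" using s1 unfolding of_nat_mult by linarith
    hence loss: "(real S / \<theta> + real (D * card {v \<in> {..<n}. Bad w h v})) / real m \<le> \<delta>" using m_pos by (simp add: field_simps)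
    have "(\<Sum>y<n. \<bar>P w (h0 + (S + Suc h)) x y - nu w h y\<bar>) \<le> 10 * \<delta> + 2 * (1 - 1 / real D) ^ h0" if x: "x < n" for x
    proof (rule upper_all[OF g w x])
      show "(\<Sum>y<n. \<bar>P w (S + Suc h) v y - nu w h y\<bar>) \<le> 10 * \<delta>" if v: "v < n" and nb: "\<not> Bad w h0 v" for v
        by (rule upper_not_Bad[OF pc g w v nb \<delta> cap _ s2 loss]) (use q[OF v] in \<open>simp add: not_less\<close>)
    qed (use \<delta> in simp)
    moreover assume "\<not> (\<forall>x<n. (\<Sum>y<n. \<bar>P w (h0 + (S + Suc h)) x y - nu w h y\<bar>) \<le> 10 * \<delta> + 2 * (1 - 1 / real D) ^ h0)"
    ultimately show False by blast
  qed
  also have "\<dots> \<le> (pr ?Q1 + pr ?Q2) + pr ?Q3" by (intro order_trans[OF pr_union] add_right_mono pr_union)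
  also have "pr ?Q1 \<le> real n * (exp 1 * \<kappa>\<^sup>2) + real n * exp (- lam * \<delta>0)" by (rule good_prob[OF pc bc ec])
  also have "pr ?Q2 \<le> real (card {..<n}) * (real (card {..<n}) * ?E)"
    by (intro pr_union_fin finite_lessThan) (use back_prob[OF pc _ _ cap] \<delta> in auto)
  also have "pr ?Q3 \<le> real n * (exp 1 * \<kappa>2) / (\<delta> * real m / (2 * real D))"
    by (rule pr_count) (use Bad_prob[OF _ bc2] \<delta> m_pos D0 in auto)
  finally show ?thesis by simp
qed

lemma tv_lower:
  assumes w: "w \<in> Om" and st: "stationary dout n w (pi_star dout n w)" and x: "x < n" and A: "A \<subseteq> {..<n}"
  shows "(\<Sum>y\<in>A. P w t x y) - (\<Sum>y\<in>A. pi_star dout n w y) \<le> tv_dist dout n w t x" and "tv_dist dout n w t x \<le> 1"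
proof -
  let ?q = "pi_star dout n w"
  have q: "(\<Sum>j<n. ?q j) = 1" "\<And>j. 0 \<le> ?q j" using st by (auto simp: stationary_def)
  have fA: "finite A" by (rule finite_subset[OF A finite_lessThan])
  define d where "d y = P w t x y - ?q y" for y
  have z: "(\<Sum>y\<in>A. d y) + (\<Sum>y\<in>{..<n} - A. d y) = 0"
    using sum.subset_diff[OF A, of d] P_row[OF w x] q by (simp add: d_def sum_subtractf)
  have "2 * (\<Sum>y\<in>A. d y) = (\<Sum>y\<in>A. d y) - (\<Sum>y\<in>{..<n} - A. d y)" using z by linarith
  also have "\<dots> \<le> (\<Sum>y\<in>A. \<bar>d y\<bar>) + (\<Sum>y\<in>{..<n} - A. \<bar>d y\<bar>)"
    using sum_abs[of d A] sum_abs[of d "{..<n} - A"] by linarith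
  also have "\<dots> = (\<Sum>y<n. \<bar>d y\<bar>)" using sum.subset_diff[OF A, of "\<lambda>y. \<bar>d y\<bar>"] by simp
  also have "\<dots> = 2 * tv_dist dout n w t x" by (simp add: tv_dist_def d_def)
  finally show "(\<Sum>y\<in>A. P w t x y) - (\<Sum>y\<in>A. ?q y) \<le> tv_dist dout n w t x" by (simp add: d_def sum_subtractf)
  have "(\<Sum>y<n. \<bar>P w t x y - ?q y\<bar>) \<le> (\<Sum>y<n. P w t x y + ?q y)"
    by (rule sum_mono) (use P_nonneg[of w t x] q(2) in \<open>smt (verit)\<close>)
  also have "\<dots> = 2" using P_row[OF w x, of t] q by (simp add: sum.distrib)
  finally show "tv_dist dout n w t x \<le> 1" by (simp add: tv_dist_def)
qed

text \<open>Nothing explicit is known about \<open>pi_star\<close>. Closeness of all rows to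
  \<open>nu\<close> at some time \<open>N\<close>, which may be later than \<open>t\<close>,
  transfers the pointwise bound \<open>nu_le\<close> to it, so the small set of
  \<open>lower_set\<close> has little stationary mass.\<close>

lemma lower_tv:
  assumes pc: "phase_cond h0 S \<theta> L b lam" and g: "good h0 S \<theta> cap \<delta> w" and w: "w \<in> Om" and x: "x < n" and \<delta>: "0 \<le> \<delta>"
    and up: "\<And>x. x < n \<Longrightarrow> (\<Sum>y<n. \<bar>P w N x y - nu w h y\<bar>) \<le> r" "r < 1"
    and t: "t \<le> h0 + S"
  shows "1 - \<delta> - (1 - 1 / real D) ^ h0 - real D ^ h0 / \<theta> * (real D ^ Suc h / real m) - r \<le> tv_dist dout n w t x"
    and "tv_dist dout n w t x \<le> 1"
proof -
  let ?q = "pi_star dout n w"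
  note st = tv_dist_upper(1,2)[OF w up]
  obtain A where A: "A \<subseteq> {..<n}" "real (card A) \<le> real D ^ h0 / \<theta>" "1 - \<delta> - (1 - 1 / real D) ^ h0 \<le> (\<Sum>y\<in>A. P w (h0 + S) x y)"
    using lower_set[OF pc g w x \<delta>] by blast
  have "(\<Sum>y\<in>A. ?q y) \<le> (\<Sum>y\<in>A. real D ^ Suc h / real m + \<bar>?q y - nu w h y\<bar>)"
    by (rule sum_mono) (use nu_le[OF w, of _ h] A(1) in \<open>force simp: abs_if\<close>)
  also have "\<dots> = real (card A) * (real D ^ Suc h / real m) + (\<Sum>y\<in>A. \<bar>?q y - nu w h y\<bar>)" by (simp add: sum.distrib)
  also have "(\<Sum>y\<in>A. \<bar>?q y - nu w h y\<bar>) \<le> (\<Sum>y<n. \<bar>?q y - nu w h y\<bar>)" by (rule sum_mono2) (use A in auto)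
  also have "\<dots> \<le> r" by (rule st(2))
  also have "real (card A) * (real D ^ Suc h / real m) \<le> real D ^ h0 / \<theta> * (real D ^ Suc h / real m)"
    using A(2) by (intro mult_right_mono) auto
  finally have "(\<Sum>y\<in>A. ?q y) \<le> real D ^ h0 / \<theta> * (real D ^ Suc h / real m) + r" by simp
  moreover have "(\<Sum>y\<in>A. P w (h0 + S) x y) - (\<Sum>y\<in>A. ?q y) \<le> tv_dist dout n w (h0 + S) x" by (rule tv_lower(1)[OF w st(1) x A(1)])
  moreover have "tv_dist dout n w (h0 + S) x \<le> tv_dist dout n w t x" by (rule tv_dist_antimono[OF w st(1) x t])
  ultimately show "1 - \<delta> - (1 - 1 / real D) ^ h0 - real D ^ h0 / \<theta> * (real D ^ Suc h / real m) - r \<le> tv_dist dout n w t x"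
    using A(3) by linarith
  show "tv_dist dout n w t x \<le> 1" by (rule tv_lower(2)[OF w st(1) x A(1)])
qed

end

subsection \<open>Choice of the parameters\<close>

definition ball_len :: "real \<Rightarrow> nat \<Rightarrow> nat" where "ball_len a n = nat \<lfloor>a * ln (real n)\<rfloor>"

lemma ball_len_le: "0 \<le> a \<Longrightarrow> 1 \<le> n \<Longrightarrow> real (ball_len a n) \<le> a * ln (real n)"
  unfolding ball_len_def by (simp add: of_nat_nat)

lemma ball_len_ge: "a * ln (real n) - 1 \<le> real (ball_len a n)"
  unfolding ball_len_def by linarith

text \<open>Only \<open>n\<close>, \<open>D\<close> and the parameters occur, not the degrees
  themselves, so one threshold for \<open>n\<close> serves all degree sequences bounded by
  \<open>D\<close>.\<close>

definition large_n :: "nat \<Rightarrow> real \<Rightarrow> real \<Rightarrow> real \<Rightarrow> nat \<Rightarrow> bool" where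
  "large_n D \<beta> a \<delta> n \<longleftrightarrow> 3 \<le> n \<and> 1 \<le> ln (real n) \<and> 2 * ln (real D) \<le> ln (real n) \<and> ln (real D) \<le> \<beta> * ln (real n) / 2 \<and>
    1 \<le> a * ln (real n) \<and> 4 * ln (real D) \<le> ln (real n) \<and>
    (ln (real D))\<^sup>2 / (ln (real n))\<^sup>2 \<le> \<delta> * (\<beta>/2)\<^sup>2 / (32 * ln (real n)) \<and>
    2 * ln (real n) * real n powr (1 - \<beta>/2) \<le> real n \<and>
    4 * real D * (2 * ln (real n) * real n powr (1 - \<beta>/2) + 1) \<le> real n * (\<delta> * (\<beta>/2)\<^sup>2 / (16 * ln (real n))) \<and>
    2 * ln (real n) * real n powr (1 - \<beta>/2) \<le> \<delta> * real n \<and>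
    (2 * a * ln (real n) + 1) * (real D * real n powr (1/16)) \<le> real n powr (1/10) \<and>
    real D * (real n powr (1/10) + 1) * real n powr (1/10) \<le> real n powr (-3/4) * real n"

lemma large_n_eventually:
  assumes "2 \<le> D" "0 < \<beta>" "0 < a" "0 < \<delta>"
  shows "eventually (large_n D \<beta> a \<delta>) at_top"
proof -
  have D: "0 < real D" "0 < ln (real D)" using assms by auto
  have c: "0 < \<delta> * (\<beta>/2)\<^sup>2" using assms by simp
  have ln_ge: "eventually (\<lambda>n::nat. x \<le> ln (real n)) at_top" for x :: real by real_asymp
  have 1: "eventually (\<lambda>n::nat. ln (real D) \<le> \<beta> * ln (real n) / 2) at_top"
    using ln_ge[of "2 * ln (real D) / \<beta>"] by eventually_elim (use assms in \<open>simp add: field_simps\<close>)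
  have 2: "eventually (\<lambda>n::nat. 1 \<le> a * ln (real n)) at_top"
    using ln_ge[of "1 / a"] by eventually_elim (use assms in \<open>simp add: field_simps\<close>)
  have 3: "eventually (\<lambda>n::nat. lnD\<^sup>2 / (ln (real n))\<^sup>2 \<le> c / (32 * ln (real n))) at_top" if "0 < c" for c lnD :: real
    using that by real_asymp
  have 4: "eventually (\<lambda>n::nat. 2 * ln (real n) * real n powr (1 - \<beta>/2) \<le> e * real n) at_top" if "0 < e" for e
    using that assms(2) by real_asymp
  have 5: "eventually (\<lambda>n::nat. 4 * d * (2 * ln (real n) * real n powr (1 - \<beta>/2) + 1) \<le> real n * (c / (16 * ln (real n)))) at_top"
    if "0 < c" "0 < d" for c d :: real
  proof -
    have "eventually (\<lambda>n::nat. 4 * d * (2 * ln (real n) * real n powr (1 - \<beta>/2)) \<le> real n * (c / (32 * ln (real n)))) at_top"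
      using that assms(2) by real_asymp
    moreover have "eventually (\<lambda>n::nat. 4 * d \<le> real n * (c / (32 * ln (real n)))) at_top"
      using that by real_asymp
    ultimately show ?thesis
    proof eventually_elim
      case (elim n)
      have "real n * (c / (16 * ln (real n))) = real n * (c / (32 * ln (real n))) + real n * (c / (32 * ln (real n)))" by simp
      thus ?case using elim by (simp only: distrib_left mult_1_right)
    qed
  qed
  have 6: "eventually (\<lambda>n::nat. (2 * a * ln (real n) + 1) * (d * real n powr (1/16)) \<le> real n powr (1/10)) at_top" if "0 < d" for d :: real
    using that assms(3) by real_asymp
  have 7: "eventually (\<lambda>n::nat. d * (real n powr (1/10) + 1) * real n powr (1/10) \<le> real n powr (-3/4) * real n) at_top" if "0 < d" for d :: real
    using that by real_asymp
  show ?thesis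
    unfolding large_n_def[abs_def]
    using 4[of 1] by (intro eventually_conj eventually_ge_at_top ln_ge 1 2 3 4 5 6 7 c D assms(4)) auto
qed

definition large_n_up :: "nat \<Rightarrow> real \<Rightarrow> real \<Rightarrow> nat \<Rightarrow> bool" where
  "large_n_up D \<beta> \<delta> n \<longleftrightarrow> (5 * \<beta> * ln (real n) + 1) * (real D * real n powr (1/32)) \<le> real n powr (1/10) \<and>
     real n powr (-(1 - 2 * \<beta>)) * real n powr (1/10) \<le> \<delta>"

lemma large_n_up_eventually:
  assumes "2 \<le> D" "0 < \<beta>" "\<beta> \<le> 1/4" "0 < \<delta>"
  shows "eventually (large_n_up D \<beta> \<delta>) at_top"
proof -
  have 1: "eventually (\<lambda>n::nat. (5 * \<beta> * ln (real n) + 1) * (d * real n powr (1/32)) \<le> real n powr (1/10)) at_top" if "0 < d" for d :: real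
    using that assms(2) by real_asymp
  have 2: "eventually (\<lambda>n::nat. real n powr (-(1 - 2 * \<beta>)) * real n powr (1/10) \<le> \<delta>) at_top"
  proof -
    have "eventually (\<lambda>n::nat. real n powr (-(1/2)) * real n powr (1/10) \<le> \<delta>) at_top" using assms(4) by real_asymp
    moreover have "eventually (\<lambda>n::nat. 1 \<le> n) at_top" by (rule eventually_ge_at_top)
    ultimately show ?thesis
    proof eventually_elim
      case (elim n)
      have "real n powr (-(1 - 2 * \<beta>)) * real n powr (1/10) \<le> real n powr (-(1/2)) * real n powr (1/10)"
        by (intro mult_right_mono powr_mono) (use elim assms in auto)
      thus ?case using elim(1) by (rule order_trans)
    qed
  qed
  show ?thesis unfolding large_n_up_def[abs_def] by (intro eventually_conj 1 2) (use assms in auto)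
qed

text \<open>The first term accounts for two bad neighbours at some vertex, the second for the
  supermartingale at some starting vertex. In \<open>err2\<close> the terms come from the Chernoff
  bound over all pairs and from the number of bad vertices.\<close>

definition err1 :: "real \<Rightarrow> real \<Rightarrow> real \<Rightarrow> nat \<Rightarrow> real" where
  "err1 \<beta> a \<delta> n = real n * (exp 1 * (real n powr (-3/4))\<^sup>2) +
     real n * exp (- ((\<delta> * (\<beta>/2)\<^sup>2)\<^sup>2 / 1024 * (real n powr (a * ln 2) / ln (real n))))"

definition err2 :: "nat \<Rightarrow> real \<Rightarrow> real \<Rightarrow> nat \<Rightarrow> real" where
  "err2 D \<beta> \<delta> n = real n * (real n * exp (- (\<delta>\<^sup>2 * real n powr \<beta>))) + exp 1 * real n powr (-3/4) * (real D / \<delta>)"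

lemma err_tendsto:
  assumes "0 < \<beta>" "0 < a" "0 < \<delta>"
  shows "err1 \<beta> a \<delta> \<longlonglongrightarrow> 0" "err2 D \<beta> \<delta> \<longlonglongrightarrow> 0"
proof -
  have 1: "(\<lambda>n::nat. real n * exp (- (c * (real n powr a / ln (real n))))) \<longlonglongrightarrow> 0" if "0 < c" "0 < a" for a c :: real
    using that by real_asymp
  have 2: "(\<lambda>n::nat. real n * (exp 1 * (real n powr (-3/4))\<^sup>2)) \<longlonglongrightarrow> 0" by real_asymp
  have "0 < (\<delta> * (\<beta>/2)\<^sup>2)\<^sup>2 / 1024" "0 < a * ln 2" using assms by auto
  from tendsto_add[OF 2 1[OF this]] show "err1 \<beta> a \<delta> \<longlonglongrightarrow> 0" by (simp add: err1_def[abs_def])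
  have 3: "(\<lambda>n::nat. real n * (real n * exp (- (c * real n powr a)))) \<longlonglongrightarrow> 0" if "0 < c" "0 < a" for a c :: real
    using that by real_asymp
  have "(\<lambda>n::nat. exp 1 * real n powr (-3/4)) \<longlonglongrightarrow> (0::real)" by real_asymp
  from tendsto_mult[OF this tendsto_const[of "real D / \<delta>"]]
  have 4: "(\<lambda>n::nat. exp 1 * real n powr (-3/4) * (real D / \<delta>)) \<longlonglongrightarrow> 0" by simp
  have "0 < \<delta>\<^sup>2" using assms by simp
  from tendsto_add[OF 3[OF this assms(1)] 4] show "err2 D \<beta> \<delta> \<longlonglongrightarrow> 0" by (simp add: err2_def[abs_def])
qed

context conf begin

definition forward_len :: "real \<Rightarrow> nat" where "forward_len \<beta> = nat \<lfloor>(1 - \<beta>) * ln (real n) / mu'\<rfloor>"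

lemma D_pow: "real D ^ k = exp (real k * lnD)"
  using D_ge by (simp add: lnD_def exp_of_nat_mult)

lemma D_pow_le:
  assumes "real k \<le> a * ln (real n)" "a * lnD \<le> c" "1 \<le> ln (real n)"
  shows "real D ^ k \<le> real n powr c"
proof -
  have "real k * lnD \<le> a * ln (real n) * lnD" using assms(1) lnD_pos by (intro mult_right_mono) auto
  also have "\<dots> = a * lnD * ln (real n)" by simp
  also have "\<dots> \<le> c * ln (real n)" using assms by (intro mult_right_mono) auto
  finally show ?thesis unfolding D_pow using n_pos by (simp add: powr_def)
qed

text \<open>Exploring about n^{1/10} heads gives an expected number of collisions of order n^{-4/5},
  and n \<kappa>^2 must vanish, so the exponent of \<kappa> has to lie between -4/5 and -1/2; -3/4
  is such a value.\<close>

lemma ball_condI: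
  assumes K: "real k * real D ^ k \<le> real n powr (1/10)"
    and c: "real D * (real n powr (1/10) + 1) * real n powr (1/10) \<le> real n powr (-3/4) * real n"
  shows "ball_cond k (real n powr (-3/4))"
proof -
  have n1: "1 \<le> real n" using n_pos by simp
  have small: "real n powr (1/10) \<le> real n powr 1" using n1 by (intro powr_mono) auto
  have m2: "2 * real n \<le> real m" using of_nat_mono[OF m_ge, where 'a = real] by simp
  have K0: "0 \<le> real k * real D ^ k" by simp
  have "real D * (real k * real D ^ k + 1) * (real k * real D ^ k) \<le> real D * (real n powr (1/10) + 1) * real n powr (1/10)"
    using K K0 by (intro mult_mono) auto
  also have "\<dots> \<le> real n powr (-3/4) * real n" by (rule c)
  also have "\<dots> \<le> real n powr (-3/4) * (real m - real k * real D ^ k)" using m2 K small n1 by (intro mult_left_mono) auto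
  finally have "real D * (real k * real D ^ k + 1) * (real k * real D ^ k) \<le> real n powr (-3/4) * (real m - real k * real D ^ k)" .
  moreover have "real k * real D ^ k < real m" using K small m2 n1 by simp
  moreover have "real n powr (-3/4) \<le> real n powr 0" using n1 by (intro powr_mono) auto
  ultimately show ?thesis using n1 by (simp add: ball_cond_def)
qed

context
  fixes \<beta> a \<delta> :: real
  assumes nm: "large_n D \<beta> a \<delta> n" and par: "0 < \<beta>" "\<beta> \<le> 1/4" "0 < a" "a * lnD \<le> 1/32" "(4 * a * lnD)\<^sup>2 \<le> \<delta> * (\<beta>/2)\<^sup>2" "0 < \<delta>" "5 * \<delta> \<le> 1"
begin

text \<open>The thresholds \<open>th\<close> and \<open>cp\<close> enclose the typical weight
  n^{-(1-\<beta>)}. Since the depth is at most \<open>2 * LL\<close>, the total allowance from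
  \<open>bb\<close> is at most a quarter of \<delta> (\<beta>/2)^2; \<open>lm\<close> is chosen so
  that \<open>4 * lm * (1/2) ^ hz\<close> equals \<open>bb / 4\<close>.\<close>

abbreviation (input) "LL \<equiv> ln (real n)"
abbreviation (input) "hz \<equiv> ball_len a n"
abbreviation (input) "th \<equiv> real n powr (-(1 - \<beta>/2))"
abbreviation (input) "bb \<equiv> \<delta> * (\<beta>/2)\<^sup>2 / (8 * ln (real n))"
abbreviation (input) "lm \<equiv> \<delta> * (\<beta>/2)\<^sup>2 / (8 * ln (real n)) * 2 ^ ball_len a n / 16"
abbreviation (input) "cp \<equiv> real n powr (-(1 - 2 * \<beta>))"

lemma large_n_facts:
  "1 \<le> LL" "1 \<le> real n" "0 < th" "real hz \<le> a * LL" "a * LL - 1 \<le> real hz" "real (forward_len \<beta>) \<le> (1 - \<beta>) * LL / mu'"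
  "(1 - \<beta>) * LL / mu' - 1 \<le> real (forward_len \<beta>)" "real (forward_len \<beta>) / th \<le> 2 * LL * real n powr (1 - \<beta>/2)"
  "mu' * real (forward_len \<beta>) \<le> (1 - \<beta>) * LL" "(1 - \<beta>) * LL - mu' \<le> mu' * real (forward_len \<beta>)"
proof -
  note N = nm[unfolded large_n_def]
  show L1: "1 \<le> LL" and n1: "1 \<le> real n" and th: "0 < th" using N by auto
  show "real hz \<le> a * LL" using par n_pos by (intro ball_len_le) auto
  show "a * LL - 1 \<le> real hz" by (rule ball_len_ge)
  have "0 \<le> (1 - \<beta>) * LL / mu'" using par L1 mu_pos by simp
  thus S1: "real (forward_len \<beta>) \<le> (1 - \<beta>) * LL / mu'" unfolding forward_len_def by (simp add: of_nat_nat)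
  show back_tails: "(1 - \<beta>) * LL / mu' - 1 \<le> real (forward_len \<beta>)" unfolding forward_len_def by linarith
  show "mu' * real (forward_len \<beta>) \<le> (1 - \<beta>) * LL" using S1 mu_pos by (simp add: field_simps)
  show "(1 - \<beta>) * LL - mu' \<le> mu' * real (forward_len \<beta>)" using back_tails mu_pos by (simp add: field_simps)
  have "(1 - \<beta>) * LL / mu' \<le> 1 * LL / (1/2)"
    using par L1 mu_bounds(1) ln2_ge_two_thirds by (intro frac_le mult_right_mono) auto
  hence S3: "real (forward_len \<beta>) \<le> 2 * LL" using S1 by simp
  have "real (forward_len \<beta>) / th = real (forward_len \<beta>) * real n powr (1 - \<beta>/2)" using n1 by (simp add: powr_minus field_simps)
  also have "\<dots> \<le> 2 * LL * real n powr (1 - \<beta>/2)" by (intro mult_right_mono S3) auto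
  finally show "real (forward_len \<beta>) / th \<le> 2 * LL * real n powr (1 - \<beta>/2)" .
qed

lemma half_pow: "2 ^ hz * (1/2::real) ^ hz = 1"
  by (simp add: power_mult_distrib[symmetric])

lemma large_n_phase: "phase_cond hz (forward_len \<beta>) th LL bb lm"
proof -
  note N = nm[unfolded large_n_def, folded lnD_def] and F = large_n_facts
  have d2: "\<delta> * (\<beta>/2)\<^sup>2 \<le> 1"
  proof -
    have "(\<beta>/2)\<^sup>2 \<le> 1" using par by (intro power_le_one) auto
    hence "\<delta> * (\<beta>/2)\<^sup>2 \<le> 1 * 1" using par by (intro mult_mono) auto
    thus ?thesis by simp
  qed
  have d0: "0 < \<delta> * (\<beta>/2)\<^sup>2" using par by simp
  have b0: "0 < bb" using d0 F(1) by simp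
  have b1: "bb \<le> 1/8" using d2 F(1) by (simp add: field_simps)
  have m2: "2 * real n \<le> real m" using of_nat_mono[OF m_ge, where 'a = real] by simp
  have lam: "4 * lm * (1/2) ^ hz = bb / 4"
  proof -
    have "4 * lm * (1/2) ^ hz = bb / 4 * (2 ^ hz * (1/2) ^ hz)" by simp
    thus ?thesis unfolding half_pow by simp
  qed
  have C2: "lnD\<^sup>2 / LL\<^sup>2 \<le> bb / 4" using N by simp
  \<comment> \<open>A quarter of \<open>bb\<close> pays for the variance, a quarter for the
    exponential correction, and half is left for collisions.\<close>
  have R: "bb / 2 \<le> bb - lnD\<^sup>2 / LL\<^sup>2 - 4 * lm * (1/2) ^ hz"
  proof -
    have "y / 2 \<le> y - z - y / 4" if "z \<le> y / 4" for y z :: real using that by linarith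
    from this[OF C2] show ?thesis unfolding lam .
  qed
  have Sn: "real (forward_len \<beta>) / th \<le> real n" using F(8) N by linarith
  have th1: "th \<le> (1 / real D) ^ hz"
  proof -
    have "real D ^ hz \<le> real n powr (1 - \<beta>/2)" using par by (intro D_pow_le[OF F(4) _ F(1)]) auto
    hence "1 / real n powr (1 - \<beta>/2) \<le> 1 / real D ^ hz" using D_ge n_pos by (intro divide_left_mono) auto
    thus ?thesis unfolding powr_minus_divide power_one_over .
  qed
  have hS: "hz \<le> forward_len \<beta>"
  proof -
    have "a * LL \<le> LL / (32 * lnD)" using par(4) F(1) lnD_pos by (simp add: field_simps)
    also have "\<dots> \<le> (3/4) * LL / lnD - 1" using N F(1) lnD_pos by (simp add: field_simps)
    also have "\<dots> \<le> (1 - \<beta>) * LL / mu' - 1" using par F(1) mu_bounds(2) mu_pos by (intro diff_right_mono frac_le mult_right_mono mult_nonneg_nonneg) auto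
    finally have "real hz \<le> real (forward_len \<beta>)" using F(4,7) by linarith
    thus ?thesis by simp
  qed
  have last: "4 * real D * (real (forward_len \<beta>) / th + 1) \<le> (real m - real (forward_len \<beta>) / th) * (bb - lnD\<^sup>2 / LL\<^sup>2 - 4 * lm * (1/2) ^ hz)"
  proof -
    have "4 * real D * (real (forward_len \<beta>) / th + 1) \<le> 4 * real D * (2 * LL * real n powr (1 - \<beta>/2) + 1)"
      using F(8) by (intro mult_left_mono) auto
    also have "\<dots> \<le> real n * (\<delta> * (\<beta>/2)\<^sup>2 / (16 * ln (real n)))" using N by blast
    also have "\<dots> = real n * (bb / 2)" by simp
    also have "\<dots> \<le> (real m - real (forward_len \<beta>) / th) * (bb - lnD\<^sup>2 / LL\<^sup>2 - 4 * lm * (1/2) ^ hz)"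
      using Sn m2 R b0 by (intro mult_mono) auto
    finally show ?thesis .
  qed
  have "ln th = - ((1 - \<beta>/2) * LL)" using n_pos by (simp add: ln_powr algebra_simps)
  hence lth: "- ln th \<le> LL" using par F(1) by simp
  have muS: "mu' * real (forward_len \<beta>) \<le> LL" 
  proof -
    have "(1 - \<beta>) * LL \<le> 1 * LL" using par F(1) by (intro mult_right_mono) auto
    thus ?thesis using F(9) by simp
  qed
  have lm0: "0 < lm" by (rule divide_pos_pos[OF mult_pos_pos[OF b0]]) auto
  have "2 * lm * (1/2) ^ hz = bb / 8 * (2 ^ hz * (1/2) ^ hz)" by simp
  hence lm8: "2 * lm * (1/2) ^ hz = bb / 8" unfolding half_pow by (simp only: mult_1_right)
  have "y / 8 \<le> 1" if "y \<le> 1/8" for y :: real using that by linarith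
  from this[OF b1] have l2: "2 * lm * (1/2) ^ hz \<le> 1" unfolding lm8 .
  have Sm: "real (forward_len \<beta>) / th < real m" using Sn m2 F(2) by linarith
  have R0: "0 \<le> bb - lnD\<^sup>2 / LL\<^sup>2 - 4 * lm * (1/2) ^ hz" by (rule order_trans[OF _ R]) (use b0 in simp)
  have b2: "bb \<le> 1/2" using b1 by linarith
  have L0: "0 < LL" using F(1) by linarith
  have C2L: "2 * lnD \<le> LL" using N by blast
  show ?thesis unfolding phase_cond_def
    by (intro conjI L0 F(3) th1 hS lth muS C2L less_imp_le[OF b0] b2 lm0 l2 Sm R0 last)
qed

lemma large_n_ball: "ball_cond (Suc (2 * hz)) (real n powr (-3/4))"
proof (rule ball_condI)
  note N = nm[unfolded large_n_def] and F = large_n_facts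
  have "real D ^ (2 * hz) \<le> real n powr (1/16)"
    by (rule D_pow_le[of _ "2 * a"]) (use F par in auto)
  hence "real (Suc (2 * hz)) * (real D * real D ^ (2 * hz)) \<le> (2 * a * LL + 1) * (real D * real n powr (1/16))"
    using F par by (intro mult_mono mult_left_mono) auto
  also have "\<dots> \<le> real n powr (1/10)" using N by blast
  finally show "real (Suc (2 * hz)) * real D ^ Suc (2 * hz) \<le> real n powr (1/10)" by simp
  show "real D * (real n powr (1/10) + 1) * real n powr (1/10) \<le> real n powr (-3/4) * real n" using N by blast
qed

text \<open>The budget \<delta> (\<beta>/2)^2 is spent in quarters: one on the deviation built up
  inside the complete ball, one on the allowance, one on the tolerated increase.\<close>

lemma large_n_eta: "eta_cond hz (forward_len \<beta>) th LL bb (\<beta>/2) cp \<delta> (\<delta> * (\<beta>/2)\<^sup>2 / 4)"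
proof -
  note N = nm[unfolded large_n_def, folded lnD_def] and F = large_n_facts
  have 1: "ln th = - ((1 - \<beta>/2) * LL)" and 2: "ln cp = - ((1 - 2 * \<beta>) * LL)" using n_pos by (simp_all add: ln_powr algebra_simps)
  have 3: "\<beta>/2 * LL \<le> - ln th - mu' * real (forward_len \<beta>)" unfolding 1 using F(9) by (simp add: algebra_simps)
  have "mu' \<le> \<beta> * LL / 2" using mu_bounds(2) N by linarith
  hence 4: "- ln cp - mu' * real (forward_len \<beta>) \<le> - (\<beta>/2) * LL" unfolding 2 using F(10) by (simp add: algebra_simps)
  have 5: "(real (Suc hz) * lnD / LL)\<^sup>2 \<le> \<delta> * (\<beta>/2)\<^sup>2 / 4"
  proof -
    have "real (Suc hz) \<le> 2 * a * LL" using F(4) N by simp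
    hence "real (Suc hz) * lnD / LL \<le> 2 * a * LL * lnD / LL" using lnD_pos F(1) by (intro divide_right_mono mult_right_mono) auto
    hence "real (Suc hz) * lnD / LL \<le> 2 * a * lnD" using F(1) by simp
    hence "(real (Suc hz) * lnD / LL)\<^sup>2 \<le> (2 * a * lnD)\<^sup>2" using lnD_pos F(1) by (intro power_mono) auto
    also have "\<dots> = (4 * a * lnD)\<^sup>2 / 4" by (simp add: power2_eq_square)
    finally show ?thesis using par(5) by linarith
  qed
  have 6: "bb * real (forward_len \<beta>) \<le> \<delta> * (\<beta>/2)\<^sup>2 / 4"
  proof -
    have "(1 - \<beta>) * LL / mu' \<le> 1 * LL / (1/2)"
      using par F(1) mu_bounds(1) ln2_ge_two_thirds by (intro frac_le mult_right_mono) auto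
    hence "real (forward_len \<beta>) \<le> 2 * LL" using F(6) by simp
    hence "bb * real (forward_len \<beta>) \<le> bb * (2 * LL)" using par F(1) by (intro mult_left_mono) auto
    thus ?thesis using F(1) by simp
  qed
  have "0 \<le> \<delta> * (\<beta>/2)\<^sup>2" using par by simp
  hence "(real (Suc hz) * lnD / LL)\<^sup>2 + bb * real (forward_len \<beta>) + \<delta> * (\<beta>/2)\<^sup>2 / 4 \<le> \<delta> * (\<beta>/2)\<^sup>2" using 5 6 by linarith
  moreover have "0 < cp" using n_pos by simp
  ultimately show ?thesis unfolding eta_cond_def using 3 4 par by auto
qed

lemma err1_ge: "real n * (exp 1 * (real n powr (-3/4))\<^sup>2) + real n * exp (- lm * (\<delta> * (\<beta>/2)\<^sup>2 / 4)) \<le> err1 \<beta> a \<delta> n"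
proof -
  note F = large_n_facts
  let ?d = "\<delta> * (\<beta>/2)\<^sup>2"
  have "real n powr (a * ln 2) / 2 = exp ((a * LL - 1) * ln 2)" using n_pos by (simp add: powr_def exp_diff algebra_simps)
  also have "\<dots> \<le> exp (real hz * ln 2)" using F(5) by (simp add: mult_right_mono)
  also have "\<dots> = 2 ^ hz" by (simp add: exp_of_nat_mult)
  finally have p: "real n powr (a * ln 2) / 2 \<le> 2 ^ hz" .
  have "?d\<^sup>2 / 1024 * (real n powr (a * ln 2) / LL) = ?d\<^sup>2 / (512 * LL) * (real n powr (a * ln 2) / 2)" by simp
  also have "\<dots> \<le> ?d\<^sup>2 / (512 * LL) * 2 ^ hz" using F(1) by (intro mult_left_mono p) auto
  also have "\<dots> = lm * (?d / 4)" using F(1) by (simp add: power2_eq_square)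
  finally have "exp (- lm * (?d / 4)) \<le> exp (- (?d\<^sup>2 / 1024 * (real n powr (a * ln 2) / LL)))" by simp
  thus ?thesis unfolding err1_def by (intro add_left_mono mult_left_mono) auto
qed

lemma good_prob_large_n: "pr (\<lambda>w. \<not> good hz (forward_len \<beta>) th cp \<delta> w) \<le> err1 \<beta> a \<delta> n"
  using good_prob[OF large_n_phase large_n_ball large_n_eta] err1_ge by linarith

text \<open>The backward radius is long enough for its weights \<open>(1/2) ^ h\<close> to beat the
  excess of \<open>cp\<close> over 1/n, and short enough, thanks to the small \<beta>, for its ball
  to stay below n^{1/10}.\<close>

lemma upper_prob_large_n:
  assumes up: "large_n_up D \<beta> \<delta> n" and b5: "5 * \<beta> * lnD \<le> 1/32"
  defines "h \<equiv> nat \<lceil>5 * \<beta> * ln (real n)\<rceil>"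
  shows "pr (\<lambda>w. \<not> (\<forall>x<n. (\<Sum>y<n. \<bar>P w (hz + (forward_len \<beta> + Suc h)) x y - nu w h y\<bar>) \<le> 10 * \<delta> + 2 * (1 - 1 / real D) ^ hz))
      \<le> err1 \<beta> a \<delta> n + err2 D \<beta> \<delta> n"
    and "real D ^ Suc h \<le> (real D)\<^sup>2 * real n powr (5 * \<beta> * lnD)"
    and "real h \<le> 5 * \<beta> * LL + 1"
proof -
  note N = nm[unfolded large_n_def] and F = large_n_facts and U = up[unfolded large_n_up_def]
  have h1: "real h \<le> 5 * \<beta> * LL + 1" and h2: "5 * \<beta> * LL \<le> real h" unfolding h_def using par F(1) by (simp_all add: of_nat_nat of_int_ceiling_le_add_one)
  show "real h \<le> 5 * \<beta> * LL + 1" by (rule h1)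
  have Dh': "real D ^ h \<le> real D * real n powr (5 * \<beta> * lnD)"
  proof -
    have "real h * lnD \<le> (5 * \<beta> * LL + 1) * lnD" using h1 lnD_pos by (intro mult_right_mono) auto
    hence "real D ^ h \<le> exp (lnD + 5 * \<beta> * lnD * LL)" unfolding D_pow by (simp add: algebra_simps)
    also have "\<dots> = real D * real n powr (5 * \<beta> * lnD)" using D_ge n_pos by (simp add: exp_add lnD_def powr_def)
    finally show ?thesis .
  qed
  thus "real D ^ Suc h \<le> (real D)\<^sup>2 * real n powr (5 * \<beta> * lnD)" using mult_left_mono[OF Dh', of "real D"] by (simp add: power2_eq_square mult.assoc)
  have Dh: "real D ^ h \<le> real D * real n powr (1/32)"
  proof -
    have "real n powr (5 * \<beta> * lnD) \<le> real n powr (1/32)" using b5 F(2) by (intro powr_mono) auto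
    thus ?thesis using Dh' by (meson mult_left_mono of_nat_0_le_iff order_trans)
  qed
  have K: "real h * real D ^ h \<le> real n powr (1/10)"
  proof -
    have "real h * real D ^ h \<le> (5 * \<beta> * LL + 1) * (real D * real n powr (1/32))"
      using h1 Dh par F(1) by (intro mult_mono) auto
    thus ?thesis using U by linarith
  qed
  have bc2: "ball_cond h (real n powr (-3/4))" by (rule ball_condI[OF K]) (use N in blast)
  have s2: "cp * real (h * D ^ h) \<le> \<delta>"
  proof -
    have "cp * (real h * real D ^ h) \<le> cp * real n powr (1/10)" by (intro mult_left_mono K) auto
    thus ?thesis using U by simp
  qed
  have m2: "2 * real n \<le> real m" using of_nat_mono[OF m_ge, where 'a = real] by simp
  have s1: "real (forward_len \<beta>) / th \<le> \<delta> * real m / 2"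
  proof -
    have "\<delta> * (2 * real n) \<le> \<delta> * real m" using m2 par by (intro mult_left_mono) auto
    thus ?thesis using F(8) N by linarith
  qed
  note B = upper_prob[OF large_n_phase large_n_ball large_n_eta bc2 par(6,7) s2 s1]
  have "real n * (real n * exp (- \<delta>\<^sup>2 / (real n * cp * (1/2) ^ h))) + real n * (exp 1 * real n powr (-3/4)) / (\<delta> * real m / (2 * real D)) \<le> err2 D \<beta> \<delta> n"
    unfolding err2_def
  proof (rule add_mono)
    have "(1/2::real) ^ h = exp (- (real h * ln 2))" by (simp add: exp_of_nat_mult exp_minus power_one_over inverse_eq_divide)
    \<comment> \<open>The factor 5 in \<open>h\<close> enters here: 5 ln 2 is at least 3. The
      resulting n^{-3\<beta>} against n^{2\<beta>} from \<open>n * cp\<close> leaves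
      n^{-\<beta>}.\<close>
    also have "\<dots> \<le> exp (- (3 * \<beta> * LL))"
    proof -
      have "\<beta> * LL * 3 \<le> \<beta> * LL * (5 * ln 2)" using ln2_ge_two_thirds par F(1) by (intro mult_left_mono) auto
      hence "3 * \<beta> * LL \<le> 5 * \<beta> * LL * ln 2" by (simp only: mult_ac)
      also have "\<dots> \<le> real h * ln 2" by (intro mult_right_mono h2) auto
      finally show ?thesis by simp
    qed
    also have "\<dots> = real n powr (- 3 * \<beta>)" using n_pos by (simp add: powr_def)
    finally have "real n * cp * (1/2) ^ h \<le> real n powr 1 * cp * real n powr (- 3 * \<beta>)" using F(2) by (simp add: mult_left_mono)
    also have "\<dots> = real n powr (- \<beta>)" unfolding powr_add[symmetric] by (rule arg_cong[where f = "\<lambda>z. real n powr z"]) simp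
    finally have le: "real n * cp * (1/2) ^ h \<le> real n powr (- \<beta>)" .
    have "\<delta>\<^sup>2 * real n powr \<beta> = \<delta>\<^sup>2 / real n powr (- \<beta>)" by (simp add: powr_minus_divide)
    also have "\<dots> \<le> \<delta>\<^sup>2 / (real n * cp * (1/2) ^ h)" using le n_pos by (intro divide_left_mono mult_pos_pos) auto
    finally show "real n * (real n * exp (- \<delta>\<^sup>2 / (real n * cp * (1/2) ^ h))) \<le> real n * (real n * exp (- (\<delta>\<^sup>2 * real n powr \<beta>)))"
      by (intro mult_left_mono) auto
    have "real n * (exp 1 * real n powr (-3/4)) / (\<delta> * real m / (2 * real D)) = (exp 1 * real n powr (-3/4) * (real D / \<delta>)) * (2 * real n / real m)"
      by simp
    also have "\<dots> \<le> (exp 1 * real n powr (-3/4) * (real D / \<delta>)) * 1"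
      using m2 m_pos par by (intro mult_left_mono) (auto simp: field_simps)
    finally show "real n * (exp 1 * real n powr (-3/4)) / (\<delta> * real m / (2 * real D)) \<le> exp 1 * real n powr (-3/4) * (real D / \<delta>)" by simp
  qed
  thus "pr (\<lambda>w. \<not> (\<forall>x<n. (\<Sum>y<n. \<bar>P w (hz + (forward_len \<beta> + Suc h)) x y - nu w h y\<bar>) \<le> 10 * \<delta> + 2 * (1 - 1 / real D) ^ hz))
      \<le> err1 \<beta> a \<delta> n + err2 D \<beta> \<delta> n" using B err1_ge by linarith
qed

end

definition mixed :: "nat \<Rightarrow> nat \<Rightarrow> real \<Rightarrow> (pt \<Rightarrow> pt) \<Rightarrow> bool" where
  "mixed N h r w \<longleftrightarrow> (\<forall>x<n. (\<Sum>y<n. \<bar>P w N x y - nu w h y\<bar>) \<le> r)"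

lemma t_star_eq: "t_star din dout n = ln (real n) / mu'"
  by (simp add: t_star_def mu'_def)

text \<open>Besides the forward depth, at most (1-\<beta>) \<open>t_star\<close>, the time contains
  the two radii and 1. These are small multiples of ln n up to rounding, and ln n is at most
  \<open>lnD * t_star\<close>, so \<gamma> \<open>t_star\<close> absorbs them.\<close>

lemma mixed_prob:
  assumes nm: "large_n D \<beta> a \<delta> n" and par: "0 < \<beta>" "\<beta> \<le> 1/4" "0 < a" "a * lnD \<le> 1/32" "(4 * a * lnD)\<^sup>2 \<le> \<delta> * (\<beta>/2)\<^sup>2" "0 < \<delta>" "5 * \<delta> \<le> 1"
    and up: "large_n_up D \<beta> \<delta> n" and b5: "5 * \<beta> * lnD \<le> 1/32"
    and g: "a * lnD + 5 * \<beta> * lnD \<le> \<gamma> / 2" "4 * lnD \<le> \<gamma> * ln (real n)"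
    and r: "10 * \<delta> + 2 * (1 - 1 / real D) ^ ball_len a n \<le> r"
  shows "\<exists>N h. pr (\<lambda>w. \<not> mixed N h r w) \<le> err1 \<beta> a \<delta> n + err2 D \<beta> \<delta> n \<and>
    real D ^ Suc h \<le> (real D)\<^sup>2 * real n powr \<gamma> \<and> real N \<le> (1 + \<gamma>) * t_star din dout n"
proof -
  note U = upper_prob_large_n[OF nm par up b5] and F = large_n_facts[OF nm par]
  define h where "h = nat \<lceil>5 * \<beta> * ln (real n)\<rceil>"
  define N where "N = ball_len a n + (forward_len \<beta> + Suc h)"
  have "pr (\<lambda>w. \<not> mixed N h r w) \<le> pr (\<lambda>w. \<not> (\<forall>x<n. (\<Sum>y<n. \<bar>P w N x y - nu w h y\<bar>) \<le> 10 * \<delta> + 2 * (1 - 1 / real D) ^ ball_len a n))"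
    unfolding mixed_def using r by (intro pr_mono) (meson order_trans)
  also have "\<dots> \<le> err1 \<beta> a \<delta> n + err2 D \<beta> \<delta> n" unfolding N_def h_def by (rule U(1))
  finally have 1: "pr (\<lambda>w. \<not> mixed N h r w) \<le> err1 \<beta> a \<delta> n + err2 D \<beta> \<delta> n" .
  have "0 < a * lnD" using par lnD_pos by simp
  moreover have "0 < 5 * \<beta> * lnD" using par lnD_pos by simp
  ultimately have g0: "0 \<le> \<gamma>" and bg: "5 * \<beta> * lnD \<le> \<gamma>" using g(1) by linarith+
  have "real n powr (5 * \<beta> * lnD) \<le> real n powr \<gamma>" using bg F(2) by (intro powr_mono) auto
  hence 2: "real D ^ Suc h \<le> (real D)\<^sup>2 * real n powr \<gamma>"
    using U(2) unfolding h_def by (meson mult_left_mono order_trans zero_le_power2)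
  have h1: "real h \<le> 5 * \<beta> * ln (real n) + 1" unfolding h_def by (rule U(3))
  have L: "0 < ln (real n)" using F(1) by simp
  have t0: "0 < ln (real n) / mu'" using L mu_pos by simp
  have LC: "ln (real n) \<le> lnD * (ln (real n) / mu')" 
  proof -
    have "mu' * (ln (real n) / mu') \<le> lnD * (ln (real n) / mu')" by (intro mult_right_mono mu_bounds(2) less_imp_le[OF t0])
    thus ?thesis using mu_pos by simp
  qed
  have "real N \<le> a * ln (real n) + (1 - \<beta>) * ln (real n) / mu' + 5 * \<beta> * ln (real n) + 2"
    unfolding N_def using F(4,6) h1 by simp
  also have "\<dots> \<le> (1 + \<gamma>) * (ln (real n) / mu')"
  proof -
    have "(a + 5 * \<beta>) * ln (real n) \<le> (a + 5 * \<beta>) * (lnD * (ln (real n) / mu'))" using LC par by (intro mult_left_mono) auto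
    also have "\<dots> = (a * lnD + 5 * \<beta> * lnD) * (ln (real n) / mu')" by (simp only: distrib_right distrib_left mult_ac)
    also have "\<dots> \<le> \<gamma> / 2 * (ln (real n) / mu')" using g(1) t0 by (intro mult_right_mono) auto
    finally have A: "(a + 5 * \<beta>) * ln (real n) \<le> \<gamma> / 2 * (ln (real n) / mu')" .
    have "4 * lnD \<le> \<gamma> * (lnD * (ln (real n) / mu'))" using g(2) mult_left_mono[OF LC g0] by linarith
    hence "lnD * 4 \<le> lnD * (\<gamma> * (ln (real n) / mu'))" by (simp add: mult_ac)
    hence g4: "4 \<le> \<gamma> * (ln (real n) / mu')" using lnD_pos by (simp only: mult_le_cancel_left_pos)
    have "2 \<le> z / 2" if "4 \<le> z" for z :: real using that by linarith
    from this[OF g4] have B: "2 \<le> \<gamma> / 2 * (ln (real n) / mu')" unfolding times_divide_eq_left .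
    have "(1 - \<beta>) * (ln (real n) / mu') \<le> 1 * (ln (real n) / mu')" by (rule mult_right_mono) (use par t0 in auto)
    hence D: "(1 - \<beta>) * ln (real n) / mu' \<le> ln (real n) / mu'" by simp
    have "p * l + x + 5 * \<beta> * l + 2 \<le> (1 + \<gamma>) * u" if "(p + 5 * \<beta>) * l \<le> \<gamma> / 2 * u" "2 \<le> \<gamma> / 2 * u" "x \<le> u" for p l x u :: real
    proof -
      have "(p + 5 * \<beta>) * l = p * l + 5 * \<beta> * l" by (rule distrib_right)
      moreover have "(1 + \<gamma>) * u = u + \<gamma> / 2 * u + \<gamma> / 2 * u" by (simp add: algebra_simps)
      ultimately show ?thesis using that by linarith
    qed
    from this[OF A B D] show ?thesis .
  qed
  finally have 3: "real N \<le> (1 + \<gamma>) * t_star din dout n" by (simp add: t_star_eq)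
  show ?thesis using 1 2 3 by blast
qed

lemma tv_dist_nonneg: "0 \<le> tv_dist dout n w t x"
  by (simp add: tv_dist_def sum_nonneg)

lemma max_prob:
  assumes "pr (\<lambda>w. \<not> mixed N h r w) \<le> e" "r < 1" "r \<le> \<epsilon>" "N \<le> t"
  shows "measure_pmf.prob (env_pmf din dout n) {w. \<bar>MAX x\<in>{..<n}. tv_dist dout n w t x\<bar> > \<epsilon>} \<le> e"
  unfolding pr_prob
proof (rule order_trans[OF pr_mono assms(1)], rule ccontr)
  fix w assume w: "w \<in> Om" and gt: "\<bar>MAX x\<in>{..<n}. tv_dist dout n w t x\<bar> > \<epsilon>" and "\<not> \<not> mixed N h r w"
  hence m: "\<And>x. x < n \<Longrightarrow> (\<Sum>y<n. \<bar>P w N x y - nu w h y\<bar>) \<le> r" by (simp add: mixed_def)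
  have "(MAX x\<in>{..<n}. tv_dist dout n w t x) \<in> (\<lambda>x. tv_dist dout n w t x) ` {..<n}"
    using n_pos by (intro Max_in) auto
  then obtain x where x: "x < n" "(MAX x\<in>{..<n}. tv_dist dout n w t x) = tv_dist dout n w t x" by auto
  have "tv_dist dout n w t x \<le> r" by (rule tv_dist_upper(3)[OF w m assms(2) assms(4) x(1)])
  thus False using gt x tv_dist_nonneg[of w t x] assms(3) by simp
qed

lemma min_prob:
  assumes nm: "large_n D \<beta> a \<delta> n" and par: "0 < \<beta>" "\<beta> \<le> 1/4" "0 < a" "a * lnD \<le> 1/32" "(4 * a * lnD)\<^sup>2 \<le> \<delta> * (\<beta>/2)\<^sup>2" "0 < \<delta>" "5 * \<delta> \<le> 1"
    and a8: "a * lnD \<le> \<beta> / 8" and mx: "pr (\<lambda>w. \<not> mixed N h r w) \<le> e" "r < 1" and Dh: "real D ^ Suc h \<le> (real D)\<^sup>2 * real n powr (\<beta>/8)"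
    and t: "real t \<le> (1 - \<beta>) * t_star din dout n - 1"
    and eps: "\<delta> + (1 - 1 / real D) ^ ball_len a n + (real D)\<^sup>2 * real n powr (- (\<beta>/4)) + r \<le> \<epsilon>"
  shows "measure_pmf.prob (env_pmf din dout n) {w. \<bar>(MIN x\<in>{..<n}. tv_dist dout n w t x) - 1\<bar> > \<epsilon>} \<le> err1 \<beta> a \<delta> n + e"
  unfolding pr_prob
proof -
  note F = large_n_facts[OF nm par] and pc = large_n_phase[OF nm par]
  let ?th = "real n powr (-(1 - \<beta>/2))" and ?cp = "real n powr (-(1 - 2 * \<beta>))"
  let ?g = "good (ball_len a n) (forward_len \<beta>) ?th ?cp \<delta>"
  have "pr (\<lambda>w. \<bar>(MIN x\<in>{..<n}. tv_dist dout n w t x) - 1\<bar> > \<epsilon>) \<le> pr (\<lambda>w. \<not> ?g w \<or> \<not> mixed N h r w)"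
  proof (rule pr_mono, rule ccontr)
    fix w assume w: "w \<in> Om" and gt: "\<bar>(MIN x\<in>{..<n}. tv_dist dout n w t x) - 1\<bar> > \<epsilon>" and "\<not> (\<not> ?g w \<or> \<not> mixed N h r w)"
    hence g: "?g w" and m: "\<And>x. x < n \<Longrightarrow> (\<Sum>y<n. \<bar>P w N x y - nu w h y\<bar>) \<le> r" by (auto simp: mixed_def)
    have "(MIN x\<in>{..<n}. tv_dist dout n w t x) \<in> (\<lambda>x. tv_dist dout n w t x) ` {..<n}"
      using n_pos by (intro Min_in) auto
    then obtain x where x: "x < n" "(MIN x\<in>{..<n}. tv_dist dout n w t x) = tv_dist dout n w t x" by auto
    have "real t \<le> real (forward_len \<beta>)" using t F(7) by (simp add: t_star_eq)
    hence tS: "t \<le> ball_len a n + forward_len \<beta>" by simp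
    have "0 \<le> \<delta>" using par by simp
    note lt = lower_tv[OF pc g w x(1) this m mx(2) tS]
    have "real D ^ ball_len a n / ?th * (real D ^ Suc h / real m) \<le> (real D)\<^sup>2 * real n powr (- (\<beta>/4))"
    proof -
      have m2: "2 * real n \<le> real m" using of_nat_mono[OF m_ge, where 'a = real] by simp
      have A: "real D ^ ball_len a n \<le> real n powr (\<beta>/8)" by (rule D_pow_le[OF F(4) a8 F(1)])
      have "real D ^ Suc h / real m \<le> (real D)\<^sup>2 * real n powr (\<beta>/8) / real n"
        using Dh m2 n_pos by (intro frac_le) auto
      hence "real D ^ ball_len a n / ?th * (real D ^ Suc h / real m) \<le> real n powr (\<beta>/8) / ?th * ((real D)\<^sup>2 * real n powr (\<beta>/8) / real n)"
        using A by (intro mult_mono divide_right_mono) auto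
      \<comment> \<open>The exponents are \<beta>/8 for the complete ball, 1-\<beta>/2 for the
        number of good tails, \<beta>/8 for the backward ball and -1 for the normalisation; they add
        up to -\<beta>/4.\<close>
      also have "\<dots> = (real D)\<^sup>2 * (real n powr (\<beta>/8) * real n powr (1 - \<beta>/2) * real n powr (\<beta>/8) * real n powr (-1))"
      proof -
        have T: "u / ?th = u * real n powr (1 - \<beta>/2)" for u unfolding powr_minus_divide by simp
        have V: "u / real n = u * real n powr (-1)" for u using n_pos by (simp add: powr_minus_divide)
        show ?thesis unfolding T V by (simp only: mult_ac)
      qed
      also have "\<dots> = (real D)\<^sup>2 * real n powr (- (\<beta>/4))"
        unfolding powr_add[symmetric] by (rule arg_cong[where f = "\<lambda>z. (real D)\<^sup>2 * real n powr z"]) (simp add: field_simps)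
      finally show ?thesis .
    qed
    thus False using lt gt x(2) eps by (simp add: abs_if split: if_splits)
  qed
  also have "\<dots> \<le> pr (\<lambda>w. \<not> ?g w) + pr (\<lambda>w. \<not> mixed N h r w)" by (rule pr_union)
  also have "\<dots> \<le> err1 \<beta> a \<delta> n + e" by (intro add_mono good_prob_large_n[OF nm par] mx)
  finally show "pr (\<lambda>w. \<bar>(MIN x\<in>{..<n}. tv_dist dout n w t x) - 1\<bar> > \<epsilon>) \<le> err1 \<beta> a \<delta> n + e" .
qed

end

section \<open>Constants and passage to the limit\<close>

lemma param_ex:
  fixes lnD \<beta> \<delta> c :: real
  assumes "0 < lnD" "0 < \<beta>" "0 < \<delta>" "0 < c"
  obtains a where "0 < a" "a * lnD \<le> 1/32" "(4 * a * lnD)\<^sup>2 \<le> \<delta> * (\<beta>/2)\<^sup>2" "a * lnD \<le> c"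
proof -
  define z where "z = min (min (1/32) c) (sqrt \<delta> * \<beta> / 8)"
  have z: "0 < z" "z \<le> 1/32" "z \<le> c" "z \<le> sqrt \<delta> * \<beta> / 8" using assms by (auto simp: z_def)
  have "(4 * z)\<^sup>2 \<le> (sqrt \<delta> * (\<beta>/2))\<^sup>2" using z by (intro power_mono) auto
  also have "\<dots> = \<delta> * (\<beta>/2)\<^sup>2" using assms by (subst power_mult_distrib) simp
  finally have "(4 * z)\<^sup>2 \<le> \<delta> * (\<beta>/2)\<^sup>2" .
  thus ?thesis using that[of "z / lnD"] z assms by simp
qed

lemma ball_len_power_tendsto:
  assumes "2 \<le> D" "0 < a"
  shows "(\<lambda>n. (1 - 1 / real D) ^ ball_len a n) \<longlonglongrightarrow> 0"
proof -
  have "filterlim (ball_len a) at_top at_top"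
    unfolding filterlim_at_top
  proof
    fix Z :: nat
    have "eventually (\<lambda>n::nat. (real Z + 1) / a \<le> ln (real n)) at_top" by real_asymp
    thus "eventually (\<lambda>n. Z \<le> ball_len a n) at_top"
    proof eventually_elim
      case (elim n)
      hence "real Z + 1 \<le> a * ln (real n)" using assms by (simp add: field_simps)
      hence "real Z \<le> real (ball_len a n)" using ball_len_ge[of a n] by linarith
      thus ?case by simp
    qed
  qed
  moreover have "(\<lambda>k. (1 - 1 / real D) ^ k) \<longlonglongrightarrow> 0" using assms by (intro LIMSEQ_power_zero) auto
  ultimately show ?thesis by (rule filterlim_compose[rotated])
qed

text \<open>Both halves of the theorem use this: above \<open>t_star\<close> for mixing itself,
  below it to locate the stationary law. The error sequence is fixed beforehand, whereas
  \<open>N\<close> and \<open>h\<close> may vary with \<open>n\<close>.\<close>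

lemma mixed_eventually:
  fixes din dout :: "nat \<Rightarrow> nat \<Rightarrow> nat"
  assumes conf: "\<And>n. 1 \<le> n \<Longrightarrow> conf n (din n) (dout n) D" and D: "2 \<le> D" and r: "0 < r" "r < 1" and \<gamma>: "0 < \<gamma>"
  obtains e :: "nat \<Rightarrow> real" where "e \<longlonglongrightarrow> 0"
    "eventually (\<lambda>n. \<exists>N h. matching.pr (tails (dout n) n) (heads (din n) n) (\<lambda>w. \<not> conf.mixed n (din n) (dout n) N h r w) \<le> e n \<and>
      real D ^ Suc h \<le> (real D)\<^sup>2 * real n powr \<gamma> \<and> real N \<le> (1 + \<gamma>) * t_star (din n) (dout n) n) at_top"
proof -
  define c0 where "c0 = ln (real D)"
  have c0: "0 < c0" using D by (simp add: c0_def)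
  \<comment> \<open>This splits \<open>r\<close> evenly: \<open>10 * \<delta>\<close> is
    \<open>r / 2\<close>, and the contribution of bad starting vertices is eventually below
    \<open>r / 2\<close>.\<close>
  define \<delta> where "\<delta> = r / 20"
  have \<delta>: "0 < \<delta>" "5 * \<delta> \<le> 1" using r by (auto simp: \<delta>_def)
  \<comment> \<open>The two inner bounds give \<open>5 * \<beta> * c0 \<le> 1/32\<close>, which
    keeps the backward ball small, and \<open>5 * \<beta> * c0 \<le> \<gamma> / 4\<close>, which
    keeps the extra time small.\<close>
  define \<beta> where "\<beta> = min (1/4) (min (1 / (160 * c0)) (\<gamma> / (20 * c0)))"
  have \<beta>: "0 < \<beta>" "\<beta> \<le> 1/4" using c0 \<gamma> by (auto simp: \<beta>_def)
  have "\<beta> \<le> 1 / (160 * c0)" "\<beta> \<le> \<gamma> / (20 * c0)" by (auto simp: \<beta>_def)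
  hence b5: "5 * \<beta> * c0 \<le> 1/32" "5 * \<beta> * c0 \<le> \<gamma>/4" using c0 by (simp_all add: field_simps)
  have "0 < \<gamma> / 4" using \<gamma> by simp
  from param_ex[OF c0 \<beta>(1) \<delta>(1) this]
  obtain a where a: "0 < a" "a * c0 \<le> 1/32" "(4 * a * c0)\<^sup>2 \<le> \<delta> * (\<beta>/2)\<^sup>2" "a * c0 \<le> \<gamma>/4" by blast
  show ?thesis
  proof (rule that[of "\<lambda>n. err1 \<beta> a \<delta> n + err2 D \<beta> \<delta> n"])
    show "(\<lambda>n. err1 \<beta> a \<delta> n + err2 D \<beta> \<delta> n) \<longlonglongrightarrow> 0"
      using tendsto_add[OF err_tendsto[OF \<beta>(1) a(1) \<delta>(1)]] by simp
    have e1: "eventually (\<lambda>n. (1 - 1 / real D) ^ ball_len a n < r / 4) at_top"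
      by (rule order_tendstoD(2)[OF ball_len_power_tendsto[OF D a(1)]]) (use r in simp)
    have e2: "eventually (\<lambda>n::nat. 4 * c0 / \<gamma> \<le> ln (real n)) at_top" by real_asymp
    from e1 e2 large_n_eventually[OF D \<beta>(1) a(1) \<delta>(1)] large_n_up_eventually[OF D \<beta> \<delta>(1)] eventually_ge_at_top[of 1]
    show "eventually (\<lambda>n. \<exists>N h. matching.pr (tails (dout n) n) (heads (din n) n) (\<lambda>w. \<not> conf.mixed n (din n) (dout n) N h r w) \<le> err1 \<beta> a \<delta> n + err2 D \<beta> \<delta> n \<and>
      real D ^ Suc h \<le> (real D)\<^sup>2 * real n powr \<gamma> \<and> real N \<le> (1 + \<gamma>) * t_star (din n) (dout n) n) at_top"
    proof eventually_elim
      case (elim n)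
      interpret conf n "din n" "dout n" D by (rule conf) (rule elim)
      have CC: "lnD = c0" by (simp add: c0_def lnD_def)
      have "10 * \<delta> + 2 * (1 - 1 / real D) ^ ball_len a n \<le> r" using elim(1) by (simp add: \<delta>_def)
      moreover have "4 * c0 \<le> \<gamma> * ln (real n)" using elim(2) \<gamma> by (simp add: field_simps)
      moreover have "a * c0 + 5 * \<beta> * c0 \<le> \<gamma> / 2" using a b5 by linarith
      ultimately show ?case
        using mixed_prob[OF elim(3) \<beta> a(1) _ _ \<delta> elim(4), of \<gamma> r, unfolded CC] a b5 by blast
    qed
  qed
qed

theorem theorem1:
  fixes din dout :: "nat \<Rightarrow> nat \<Rightarrow> nat" and lam :: real and t :: "nat \<Rightarrow> nat"
  assumes deg_min: "\<And>n i. i < n \<Longrightarrow> 2 \<le> din n i \<and> 2 \<le> dout n i"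
    and deg_bdd: "\<exists>D::nat. \<forall>n i. i < n \<longrightarrow> din n i \<le> D \<and> dout n i \<le> D"
    and deg_sum: "\<And>n. (\<Sum>i<n. din n i) = (\<Sum>i<n. dout n i)"
    and lam: "0 \<le> lam"
    and t_asymp: "(\<lambda>n. real (t n) - lam * t_star (din n) (dout n) n)
                    \<in> o(\<lambda>n. t_star (din n) (dout n) n)"
  shows "(lam < 1 \<longrightarrow> (\<forall>\<epsilon>>0. (\<lambda>n. measure_pmf.prob (env_pmf (din n) (dout n) n)
            {\<omega>. \<bar>(MIN i\<in>{..<n}. tv_dist (dout n) n \<omega> (t n) i) - 1\<bar> > \<epsilon>}) \<longlonglongrightarrow> 0))
       \<and> (1 < lam \<longrightarrow> (\<forall>\<epsilon>>0. (\<lambda>n. measure_pmf.prob (env_pmf (din n) (dout n) n)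
            {\<omega>. \<bar>(MAX i\<in>{..<n}. tv_dist (dout n) n \<omega> (t n) i)\<bar> > \<epsilon>}) \<longlonglongrightarrow> 0))"
proof -
  obtain D where D: "\<And>n i. i < n \<Longrightarrow> din n i \<le> D \<and> dout n i \<le> D" using deg_bdd by blast
  have D2: "2 \<le> D" using D[of 0 1] deg_min[of 0 1] by simp
  have conf: "conf n (din n) (dout n) D" if "1 \<le> n" for n
    by standard (use that deg_min D deg_sum in auto)
  have ts: "0 \<le> t_star (din n) (dout n) n \<and> ln (real n) \<le> ln (real D) * t_star (din n) (dout n) n" if "1 \<le> n" for n
  proof -
    interpret conf n "din n" "dout n" D by (rule conf[OF that])
    have t0: "0 \<le> ln (real n) / mu'" using that mu_pos by simp
    have "mu' * (ln (real n) / mu') \<le> lnD * (ln (real n) / mu')" by (intro mult_right_mono mu_bounds(2) t0)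
    thus ?thesis using mu_pos t0 by (simp add: t_star_eq lnD_def)
  qed
  have small: "eventually (\<lambda>n. \<bar>real (t n) - lam * t_star (din n) (dout n) n\<bar> \<le> c * t_star (din n) (dout n) n) at_top" if "0 < c" for c
    using landau_o.smallD[OF t_asymp that] eventually_ge_at_top[of 1]
    by eventually_elim (use ts in auto)
  have conv: "f \<longlonglongrightarrow> 0" if "e \<longlonglongrightarrow> 0" "eventually (\<lambda>n. f n \<le> e n) at_top" "\<And>n. 0 \<le> f n" for f e :: "nat \<Rightarrow> real"
    by (rule tendsto_sandwich[OF _ that(2) tendsto_const that(1)]) (simp add: that(3))
  show ?thesis
  proof (intro conjI impI allI)
    fix \<epsilon> :: real assume l1: "1 < lam" and \<epsilon>: "0 < \<epsilon>"
    define r where "r = min \<epsilon> (1/2)"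
    have r: "0 < r" "r < 1" "r \<le> \<epsilon>" using \<epsilon> by (auto simp: r_def)
    \<comment> \<open>Half the gap: \<open>1 + \<gamma> = lam - \<gamma>\<close>, so one half covers
      the mixing time and the other the fluctuation of \<open>t n\<close>.\<close>
    define \<gamma> where "\<gamma> = (lam - 1) / 2"
    have \<gamma>: "0 < \<gamma>" using l1 by (simp add: \<gamma>_def)
    obtain e where e: "e \<longlonglongrightarrow> 0" and ev: "eventually (\<lambda>n. \<exists>N h. matching.pr (tails (dout n) n) (heads (din n) n) (\<lambda>w. \<not> conf.mixed n (din n) (dout n) N h r w) \<le> e n \<and>
      real D ^ Suc h \<le> (real D)\<^sup>2 * real n powr \<gamma> \<and> real N \<le> (1 + \<gamma>) * t_star (din n) (dout n) n) at_top"
      using mixed_eventually[OF conf D2 r(1,2) \<gamma>] by blast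
    show "(\<lambda>n. measure_pmf.prob (env_pmf (din n) (dout n) n)
            {\<omega>. \<bar>(MAX i\<in>{..<n}. tv_dist (dout n) n \<omega> (t n) i)\<bar> > \<epsilon>}) \<longlonglongrightarrow> 0"
    proof (rule conv[OF e])
      from ev small[OF \<gamma>] eventually_ge_at_top[of 1]
      show "eventually (\<lambda>n. measure_pmf.prob (env_pmf (din n) (dout n) n)
            {\<omega>. \<bar>(MAX i\<in>{..<n}. tv_dist (dout n) n \<omega> (t n) i)\<bar> > \<epsilon>} \<le> e n) at_top"
      proof eventually_elim
        case (elim n)
        interpret conf n "din n" "dout n" D by (rule conf[OF elim(3)])
        obtain N h where N: "pr (\<lambda>w. \<not> mixed N h r w) \<le> e n" "real N \<le> (1 + \<gamma>) * t_star (din n) (dout n) n"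
          using elim(1) by blast
        have "(1 + \<gamma>) * t_star (din n) (dout n) n = (lam - \<gamma>) * t_star (din n) (dout n) n" by (simp add: \<gamma>_def field_simps)
        also have "\<dots> \<le> real (t n)" using elim(2) by (simp add: algebra_simps)
        finally have "N \<le> t n" using N(2) by simp
        from max_prob[OF N(1) r(2,3) this] show ?case .
      qed
    qed simp
  next
    fix \<epsilon> :: real assume l1: "lam < 1" and \<epsilon>: "0 < \<epsilon>"
    define r where "r = min (\<epsilon>/4) (1/2)"
    have r: "0 < r" "r < 1" "r \<le> \<epsilon>/4" using \<epsilon> by (auto simp: r_def)
    \<comment> \<open>With a quarter of the gap, \<open>1 - \<beta> = lam + 3 * \<beta>\<close>: one
      \<beta> absorbs the error of \<open>t n\<close>, and \<open>2 * \<beta> * t_star\<close>,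
      eventually at least 1, absorbs the rounding of the forward depth. Nonnegativity of
      \<open>lam\<close> yields \<open>\<beta> \<le> 1/4\<close>.\<close>
    define \<beta> where "\<beta> = (1 - lam) / 4"
    have \<beta>: "0 < \<beta>" "\<beta> \<le> 1/4" using l1 lam by (auto simp: \<beta>_def)
    define \<delta> where "\<delta> = min (\<epsilon>/4) (1/5)"
    have \<delta>: "0 < \<delta>" "5 * \<delta> \<le> 1" "\<delta> \<le> \<epsilon>/4" using \<epsilon> by (auto simp: \<delta>_def)
    have lnD: "0 < ln (real D)" using D2 by simp
    have b8: "0 < \<beta>/8" using \<beta> by simp
    from param_ex[OF lnD \<beta>(1) \<delta>(1) b8]
    obtain a where a: "0 < a" "a * ln (real D) \<le> 1/32" "(4 * a * ln (real D))\<^sup>2 \<le> \<delta> * (\<beta>/2)\<^sup>2" "a * ln (real D) \<le> \<beta>/8" by blast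
    \<comment> \<open>Mixing at a later time is needed here only to compare \<open>pi_star\<close>
      with \<open>nu\<close>; the value \<beta>/8 keeps \<open>D ^ Suc h\<close>, hence the
      pointwise bound on \<open>nu\<close>, small enough.\<close>
    obtain e where e: "e \<longlonglongrightarrow> 0" and ev: "eventually (\<lambda>n. \<exists>N h. matching.pr (tails (dout n) n) (heads (din n) n) (\<lambda>w. \<not> conf.mixed n (din n) (dout n) N h r w) \<le> e n \<and>
      real D ^ Suc h \<le> (real D)\<^sup>2 * real n powr (\<beta>/8) \<and> real N \<le> (1 + \<beta>/8) * t_star (din n) (dout n) n) at_top"
      using mixed_eventually[OF conf D2 r(1,2) b8] by blast
    have "(\<lambda>n. err1 \<beta> a \<delta> n + e n) \<longlonglongrightarrow> 0" using tendsto_add[OF err_tendsto(1)[OF \<beta>(1) a(1) \<delta>(1)] e] by simp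
    thus "(\<lambda>n. measure_pmf.prob (env_pmf (din n) (dout n) n)
            {\<omega>. \<bar>(MIN i\<in>{..<n}. tv_dist (dout n) n \<omega> (t n) i) - 1\<bar> > \<epsilon>}) \<longlonglongrightarrow> 0"
    proof (rule conv)
      have e1: "eventually (\<lambda>n. (1 - 1 / real D) ^ ball_len a n < \<epsilon> / 4) at_top"
        by (rule order_tendstoD(2)[OF ball_len_power_tendsto[OF D2 a(1)]]) (use \<epsilon> in simp)
      have "(\<lambda>n::nat. (real D)\<^sup>2 * real n powr (- (\<beta>/4))) \<longlonglongrightarrow> (real D)\<^sup>2 * 0"
        by (intro tendsto_mult tendsto_const) (use \<beta> in real_asymp)
      hence e2: "eventually (\<lambda>n::nat. (real D)\<^sup>2 * real n powr (- (\<beta>/4)) < \<epsilon> / 4) at_top"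
        by (rule order_tendstoD(2)) (use \<epsilon> in simp)
      have e3: "eventually (\<lambda>n::nat. ln (real D) / (2 * \<beta>) \<le> ln (real n)) at_top" by real_asymp
      from ev small[OF \<beta>(1)] eventually_ge_at_top[of 1] large_n_eventually[OF D2 \<beta>(1) a(1) \<delta>(1)] e1 e2 e3
      show "eventually (\<lambda>n. measure_pmf.prob (env_pmf (din n) (dout n) n)
            {\<omega>. \<bar>(MIN i\<in>{..<n}. tv_dist (dout n) n \<omega> (t n) i) - 1\<bar> > \<epsilon>} \<le> err1 \<beta> a \<delta> n + e n) at_top"
      proof eventually_elim
        case (elim n)
        interpret conf n "din n" "dout n" D by (rule conf[OF elim(3)])
        obtain N h where N: "pr (\<lambda>w. \<not> mixed N h r w) \<le> e n" "real D ^ Suc h \<le> (real D)\<^sup>2 * real n powr (\<beta>/8)"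
          using elim(1) by blast
        have "ln (real D) \<le> 2 * \<beta> * ln (real n)" using elim(7) \<beta> by (simp add: field_simps)
        also have "\<dots> \<le> 2 * \<beta> * (ln (real D) * t_star (din n) (dout n) n)" using ts[OF elim(3)] \<beta> by (intro mult_left_mono) auto
        finally have "ln (real D) * 1 \<le> ln (real D) * (2 * \<beta> * t_star (din n) (dout n) n)" by (simp add: mult_ac)
        hence "1 \<le> 2 * \<beta> * t_star (din n) (dout n) n" using lnD by simp
        moreover have "real (t n) \<le> (lam + \<beta>) * t_star (din n) (dout n) n" using elim(2) by (simp add: algebra_simps)
        moreover have "(1 - \<beta>) * t_star (din n) (dout n) n = (lam + \<beta>) * t_star (din n) (dout n) n + 2 * \<beta> * t_star (din n) (dout n) n"
          by (simp add: \<beta>_def field_simps)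
        ultimately have t: "real (t n) \<le> (1 - \<beta>) * t_star (din n) (dout n) n - 1" by linarith
        have eps: "\<delta> + (1 - 1 / real D) ^ ball_len a n + (real D)\<^sup>2 * real n powr (- (\<beta>/4)) + r \<le> \<epsilon>"
          using elim(5,6) \<delta>(3) r(3) by linarith
        show ?case
          by (rule min_prob[OF elim(4) \<beta> a(1) _ _ \<delta>(1,2) _ N(1) r(2) N(2) t eps]) (use a in \<open>simp_all add: lnD_def\<close>)
      qed
    qed simp
  qed
qed

end
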